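(* Let $G$ be a finite group, let $\theta:G\to G$ be an involution, and let $H\subset G$ be a subgroup. Let $\sigma:=\theta\circ\mathrm{inv}:G\to G$, $\sigma(g)=\theta(g^{-1})$, where $\mathrm{inv}$ is the inversion. Let $V$ be the space of functions $f:G\to\mathbb{C}$ which are left invariant with respect to $H$, right invariant with respect to $\theta(H)$, and anti-invariant with respect to $\sigma$ (i.e. $f\circ\sigma=-f$). Then there is an isomorphism of complex vector spaces $$V\cong\left(\bigoplus_{\varepsilon_\theta(\pi)=0}\pi^H\otimes(\pi^* )^{\theta(H)}\right)^{S_2,\mathrm{sign}}\oplus\left(\bigoplus_{\varepsilon_\theta(\pi)=1}\Lambda^2(\pi^H)\right)\oplus\left(\bigoplus_{\varepsilon_\theta(\pi)=-1}\mathrm{Sym}^2(\pi^H)\right),$$ where the sums are over $\pi\in\mathrm{irr}(G)$ with the indicated value of $\varepsilon_\theta(\pi)$. Here the action of $S_2$ on $\bigoplus_{\varepsilon_\theta(\pi)=0}\pi^H\otimes(\pi^* )^{\theta(H)}$ is given by the involution $s$ sending $v\otimes w\in\pi^H\otimes(\pi^* )^{\theta(H)}$ (in the summand of $\pi$) to $w\otimes v\in(\pi^* )^{\theta(H)}\otimes\pi^H\cong(\pi^*\circ\theta)^H\otimes((\pi^*\circ\theta)^* )^{\theta(H)}$ (in the summand of $\pi^*\circ\theta$), and the superscript $(S_2,\mathrm{sign})$ denotes the subspace on which $s$ acts by $-1$.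
   Context: All representations are finite-dimensional complex representations. An involution $\theta:G\to G$ is a group automorphism with $\theta\circ\theta=\mathrm{id}_G$. $\mathrm{irr}(G)$ is the set of isomorphism classes of irreducible representations of $G$; $\pi^*$ is the dual representation, $\pi\circ\theta$ is $g\mapsto\pi(\theta(g))$, and $\pi^K$ is the space of $K$-invariant vectors for a subgroup $K$. The twisted Frobenius–Schur indicator of $\pi\in\mathrm{irr}(G)$ is defined by: $\varepsilon_\theta(\pi)=0$ if $\pi\not\simeq\pi^*\circ\theta$; $\varepsilon_\theta(\pi)=1$ if $\pi$ possesses a non-zero symmetric bilinear form $B$ with $B(\pi(g)v,w)=B(v,\pi(\theta(g^{-1}))w)$ for all $g,v,w$; $\varepsilon_\theta(\pi)=-1$ if $\pi$ possesses a non-zero anti-symmetric bilinear form $B$ with the same property. (Exactly one of these cases occurs.) In the $\varepsilon_\theta(\pi)=0$ sum, representatives of the isomorphism classes are chosen compatibly: in each pair of distinct classes $\{\pi,\pi^*\circ\theta\}$, the representative of one is taken to be $\pi^*\circ\theta$ for the representative $\pi$ of the other, with $(\pi^*\circ\theta)^*\circ\theta=\pi^{**}$ identified with $\pi$ canonically. The identifications used are $(\pi^* )^{\theta(H)}=(\pi^*\circ\theta)^H$ and $\pi^H\cong((\pi^*\circ\theta)^* )^{\theta(H)}$. *)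

theory Defs
  imports "Jordan_Normal_Form.VS_Connect"
begin

text \<open>
  Complex vector spaces are modules, in the sense of HOL-Algebra, over the ring
  \<^term>\<open>class_ring :: complex ring\<close>, and representations are matrix representations: choosing a
  basis, every finite-dimensional complex representation of \<^term>\<open>G\<close> is isomorphic to one on
  \<^term>\<open>carrier_vec n\<close>. They are extensional on the carrier of \<^term>\<open>G\<close>, so that equality of
  functions is equality of representations.
\<close>

abbreviation GL :: "nat \<Rightarrow> complex mat monoid" where
  "GL n \<equiv> units_of (ring_mat TYPE(complex) n ())"

definition rep_dim :: "('g, 'b) monoid_scheme \<Rightarrow> ('g \<Rightarrow> complex mat) \<Rightarrow> nat" where
  "rep_dim G \<pi> = dim_row (\<pi> \<one>\<^bsub>G\<^esub>)"

definition is_rep :: "('g, 'b) monoid_scheme \<Rightarrow> ('g \<Rightarrow> complex mat) \<Rightarrow> bool" where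
  "is_rep G \<pi> \<longleftrightarrow> \<pi> \<in> hom G (GL (rep_dim G \<pi>)) \<and> \<pi> \<in> extensional (carrier G)"

definition irreducible_rep :: "('g, 'b) monoid_scheme \<Rightarrow> ('g \<Rightarrow> complex mat) \<Rightarrow> bool" where
  "irreducible_rep G \<pi> \<longleftrightarrow> is_rep G \<pi> \<and> rep_dim G \<pi> > 0 \<and>
     (\<forall>U. VectorSpace.subspace class_ring U (module_vec TYPE(complex) (rep_dim G \<pi>)) \<and>
          (\<forall>g\<in>carrier G. \<forall>u\<in>U. \<pi> g *\<^sub>v u \<in> U) \<longrightarrow>
          U = {0\<^sub>v (rep_dim G \<pi>)} \<or> U = carrier_vec (rep_dim G \<pi>))"

definition rep_iso ::
  "('g, 'b) monoid_scheme \<Rightarrow> ('g \<Rightarrow> complex mat) \<Rightarrow> ('g \<Rightarrow> complex mat) \<Rightarrow> bool" where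
  "rep_iso G \<pi> \<rho> \<longleftrightarrow> rep_dim G \<pi> = rep_dim G \<rho> \<and>
     (\<exists>P\<in>carrier (GL (rep_dim G \<pi>)). \<forall>g\<in>carrier G. P * \<pi> g = \<rho> g * P)"

text \<open>
  The dual of the space \<^term>\<open>carrier_vec n\<close> is identified with \<^term>\<open>carrier_vec n\<close> through the dual
  basis, that is, \<^term>\<open>w\<close> stands for the functional sending \<^term>\<open>v\<close> to \<^term>\<open>w \<bullet> v\<close>. In
  these coordinates the dual representation is the inverse transpose, and the canonical
  isomorphism with the bidual is an equality.
\<close>

definition dual_rep ::
  "('g, 'b) monoid_scheme \<Rightarrow> ('g \<Rightarrow> complex mat) \<Rightarrow> 'g \<Rightarrow> complex mat" where
  "dual_rep G \<pi> = (\<lambda>g\<in>carrier G. transpose_mat (\<pi> (inv\<^bsub>G\<^esub> g)))"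

definition twisted_dual ::
  "('g, 'b) monoid_scheme \<Rightarrow> ('g \<Rightarrow> 'g) \<Rightarrow> ('g \<Rightarrow> complex mat) \<Rightarrow> 'g \<Rightarrow> complex mat" where
  "twisted_dual G \<theta> \<pi> = compose (carrier G) (dual_rep G \<pi>) \<theta>"

definition invariants ::
  "('g, 'b) monoid_scheme \<Rightarrow> ('g \<Rightarrow> complex mat) \<Rightarrow> 'g set \<Rightarrow> complex vec set" where
  "invariants G \<pi> K = {v \<in> carrier_vec (rep_dim G \<pi>). \<forall>k\<in>K. \<pi> k *\<^sub>v v = v}"

definition bilinear_form :: "nat \<Rightarrow> (complex vec \<Rightarrow> complex vec \<Rightarrow> complex) \<Rightarrow> bool" where
  "bilinear_form n B \<longleftrightarrow>
     (\<forall>u\<in>carrier_vec n. \<forall>v\<in>carrier_vec n. \<forall>w\<in>carrier_vec n.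
        B (u + v) w = B u w + B v w \<and> B u (v + w) = B u v + B u w) \<and>
     (\<forall>c. \<forall>v\<in>carrier_vec n. \<forall>w\<in>carrier_vec n.
        B (c \<cdot>\<^sub>v v) w = c * B v w \<and> B v (c \<cdot>\<^sub>v w) = c * B v w)"

definition twisted_invariant_form ::
  "('g, 'b) monoid_scheme \<Rightarrow> ('g \<Rightarrow> 'g) \<Rightarrow> ('g \<Rightarrow> complex mat) \<Rightarrow>
   (complex vec \<Rightarrow> complex vec \<Rightarrow> complex) \<Rightarrow> bool" where
  "twisted_invariant_form G \<theta> \<pi> B \<longleftrightarrow> bilinear_form (rep_dim G \<pi>) B \<and>
     (\<exists>v\<in>carrier_vec (rep_dim G \<pi>). \<exists>w\<in>carrier_vec (rep_dim G \<pi>). B v w \<noteq> 0) \<and>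
     (\<forall>g\<in>carrier G. \<forall>v\<in>carrier_vec (rep_dim G \<pi>). \<forall>w\<in>carrier_vec (rep_dim G \<pi>).
        B (\<pi> g *\<^sub>v v) w = B v (\<pi> (\<theta> (inv\<^bsub>G\<^esub> g)) *\<^sub>v w))"

text \<open>For irreducible \<^term>\<open>\<pi>\<close> exactly one of the three cases occurs.\<close>

definition fs_indicator ::
  "('g, 'b) monoid_scheme \<Rightarrow> ('g \<Rightarrow> 'g) \<Rightarrow> ('g \<Rightarrow> complex mat) \<Rightarrow> int" where
  "fs_indicator G \<theta> \<pi> = (THE e.
     (e = 0 \<and> \<not> rep_iso G \<pi> (twisted_dual G \<theta> \<pi>)) \<or>
     (e = 1 \<and> (\<exists>B. twisted_invariant_form G \<theta> \<pi> B \<and>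
        (\<forall>v\<in>carrier_vec (rep_dim G \<pi>). \<forall>w\<in>carrier_vec (rep_dim G \<pi>). B v w = B w v))) \<or>
     (e = -1 \<and> (\<exists>B. twisted_invariant_form G \<theta> \<pi> B \<and>
        (\<forall>v\<in>carrier_vec (rep_dim G \<pi>). \<forall>w\<in>carrier_vec (rep_dim G \<pi>). B v w = - B w v))))"

text \<open>
  A set of representatives of the isomorphism classes of irreducible representations in which
  distinct classes of the form \<open>\<pi>\<close>, \<open>\<pi>\<^sup>* \<circ> \<theta>\<close> are represented by a matrix representation and
  precisely its twisted dual.
\<close>

definition irr_representatives ::
  "('g, 'b) monoid_scheme \<Rightarrow> ('g \<Rightarrow> 'g) \<Rightarrow> ('g \<Rightarrow> complex mat) set \<Rightarrow> bool" where
  "irr_representatives G \<theta> R \<longleftrightarrow>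
     (\<forall>\<pi>\<in>R. irreducible_rep G \<pi>) \<and>
     (\<forall>\<rho>. irreducible_rep G \<rho> \<longrightarrow> (\<exists>!\<pi>. \<pi> \<in> R \<and> rep_iso G \<rho> \<pi>)) \<and>
     (\<forall>\<pi>\<in>R. \<not> rep_iso G \<pi> (twisted_dual G \<theta> \<pi>) \<longrightarrow> twisted_dual G \<theta> \<pi> \<in> R)"

abbreviation irr_with ::
  "('g, 'b) monoid_scheme \<Rightarrow> ('g \<Rightarrow> 'g) \<Rightarrow> ('g \<Rightarrow> complex mat) set \<Rightarrow> int \<Rightarrow> ('g \<Rightarrow> complex mat) set"
  where "irr_with G \<theta> R e \<equiv> {\<pi> \<in> R. fs_indicator G \<theta> \<pi> = e}"

text \<open>
  The tensor product of the coordinate spaces of dimensions \<^term>\<open>n\<close> and \<^term>\<open>m\<close> is the space of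
  \<^term>\<open>n\<close> by \<^term>\<open>m\<close> matrices, with \<open>v \<otimes> w\<close> the outer product. Since tensor products over a
  field preserve injections, the tensor product of subspaces \<^term>\<open>U\<close> and \<^term>\<open>W\<close> is the span of
  the \<open>u \<otimes> w\<close>. The flip sending \<open>v \<otimes> w\<close> to \<open>w \<otimes> v\<close> is transposition, and the exterior and
  symmetric squares are its eigenspaces on \<open>U \<otimes> U\<close> for -1 and 1.
\<close>

definition pure_tensor :: "complex vec \<Rightarrow> complex vec \<Rightarrow> complex mat" where
  "pure_tensor v w = mat (dim_vec v) (dim_vec w) (\<lambda>(i, j). v $ i * w $ j)"

definition tensor_space ::
  "nat \<Rightarrow> nat \<Rightarrow> complex vec set \<Rightarrow> complex vec set \<Rightarrow> (complex, complex mat) module" where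
  "tensor_space n m U W = (module_mat TYPE(complex) n m)
     \<lparr>carrier := LinearCombinations.module.span class_ring (module_mat TYPE(complex) n m)
        {pure_tensor u w | u w. u \<in> U \<and> w \<in> W}\<rparr>"

definition ext_square :: "nat \<Rightarrow> complex vec set \<Rightarrow> (complex, complex mat) module" where
  "ext_square n U = (tensor_space n n U U)
     \<lparr>carrier := {T \<in> carrier (tensor_space n n U U). transpose_mat T = - T}\<rparr>"

definition sym_square :: "nat \<Rightarrow> complex vec set \<Rightarrow> (complex, complex mat) module" where
  "sym_square n U = (tensor_space n n U U)
     \<lparr>carrier := {T \<in> carrier (tensor_space n n U U). transpose_mat T = T}\<rparr>"

text \<open>The \<open>mult\<close> and \<open>one\<close> fields of a module record carry no information.\<close>

definition direct_sum_family ::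
  "'i set \<Rightarrow> ('i \<Rightarrow> ('a, 'c, 'd) module_scheme) \<Rightarrow> ('a, 'i \<Rightarrow> 'c) module" where
  "direct_sum_family I M =
     \<lparr>carrier = {x \<in> Pi\<^sub>E I (\<lambda>i. carrier (M i)). finite {i \<in> I. x i \<noteq> \<zero>\<^bsub>M i\<^esub>}},
      mult = (\<lambda>x y. \<lambda>i\<in>I. \<zero>\<^bsub>M i\<^esub>),
      one = (\<lambda>i\<in>I. \<zero>\<^bsub>M i\<^esub>),
      zero = (\<lambda>i\<in>I. \<zero>\<^bsub>M i\<^esub>),
      add = (\<lambda>x y. \<lambda>i\<in>I. x i \<oplus>\<^bsub>M i\<^esub> y i),
      smult = (\<lambda>c x. \<lambda>i\<in>I. c \<odot>\<^bsub>M i\<^esub> x i)\<rparr>"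

definition zero_indicator_sum ::
  "('g, 'b) monoid_scheme \<Rightarrow> ('g \<Rightarrow> 'g) \<Rightarrow> 'g set \<Rightarrow> ('g \<Rightarrow> complex mat) set \<Rightarrow>
   (complex, ('g \<Rightarrow> complex mat) \<Rightarrow> complex mat) module" where
  "zero_indicator_sum G \<theta> H R = direct_sum_family (irr_with G \<theta> R 0)
     (\<lambda>\<pi>. tensor_space (rep_dim G \<pi>) (rep_dim G \<pi>)
       (invariants G \<pi> H) (invariants G (dual_rep G \<pi>) (\<theta> ` H)))"

text \<open>
  The swap sends \<open>v \<otimes> w\<close> in the summand of \<^term>\<open>\<pi>\<close> to \<open>w \<otimes> v\<close> in the summand of the twisted
  dual of \<^term>\<open>\<pi>\<close>. As the twisted dual is an involution on representations, the component of the
  image at \<^term>\<open>\<pi>\<close> comes from the component at the twisted dual of \<^term>\<open>\<pi>\<close>; see \<open>swap_pure_tensor\<close>.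
\<close>

definition swap ::
  "('g, 'b) monoid_scheme \<Rightarrow> ('g \<Rightarrow> 'g) \<Rightarrow> ('g \<Rightarrow> complex mat) set \<Rightarrow>
   (('g \<Rightarrow> complex mat) \<Rightarrow> complex mat) \<Rightarrow> ('g \<Rightarrow> complex mat) \<Rightarrow> complex mat" where
  "swap G \<theta> R T = (\<lambda>\<pi>\<in>irr_with G \<theta> R 0. transpose_mat (T (twisted_dual G \<theta> \<pi>)))"

definition zero_indicator_sum_sign ::
  "('g, 'b) monoid_scheme \<Rightarrow> ('g \<Rightarrow> 'g) \<Rightarrow> 'g set \<Rightarrow> ('g \<Rightarrow> complex mat) set \<Rightarrow>
   (complex, ('g \<Rightarrow> complex mat) \<Rightarrow> complex mat) module" where
  "zero_indicator_sum_sign G \<theta> H R = (zero_indicator_sum G \<theta> H R)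
     \<lparr>carrier := {T \<in> carrier (zero_indicator_sum G \<theta> H R).
        swap G \<theta> R T = \<ominus>\<^bsub>zero_indicator_sum G \<theta> H R\<^esub> T}\<rparr>"

definition anti_invariant_functions ::
  "('g, 'b) monoid_scheme \<Rightarrow> ('g \<Rightarrow> 'g) \<Rightarrow> 'g set \<Rightarrow> (complex, 'g \<Rightarrow> complex) module" where
  "anti_invariant_functions G \<theta> H = (ring.func_space class_ring (carrier G))
     \<lparr>carrier := {f \<in> carrier G \<rightarrow>\<^sub>E UNIV.
        (\<forall>h\<in>H. \<forall>g\<in>carrier G. f (h \<otimes>\<^bsub>G\<^esub> g) = f g) \<and>
        (\<forall>k\<in>\<theta> ` H. \<forall>g\<in>carrier G. f (g \<otimes>\<^bsub>G\<^esub> k) = f g) \<and>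
        (\<forall>g\<in>carrier G. f (\<theta> (inv\<^bsub>G\<^esub> g)) = - f g)}\<rparr>"

lemma is_rep_carrier:
  assumes "is_rep G \<pi>" "g \<in> carrier G"
  shows "\<pi> g \<in> carrier_mat (rep_dim G \<pi>) (rep_dim G \<pi>)"
  using assms by (auto simp: is_rep_def hom_def units_of_def Units_def ring_mat_def)

lemma rep_dim_twisted_dual:
  assumes "group G" "\<theta> \<in> hom G G" "is_rep G \<pi>"
  shows "rep_dim G (twisted_dual G \<theta> \<pi>) = rep_dim G \<pi>"
proof -
  interpret group G by fact
  interpret t: group_hom G G \<theta>
    using assms(1,2) by (simp add: group_hom_def group_hom_axioms_def)
  have "twisted_dual G \<theta> \<pi> \<one>\<^bsub>G\<^esub> = transpose_mat (\<pi> \<one>\<^bsub>G\<^esub>)"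
    by (simp add: twisted_dual_def dual_rep_def compose_def)
  moreover have "dim_col (\<pi> \<one>\<^bsub>G\<^esub>) = rep_dim G \<pi>"
    using is_rep_carrier[OF assms(3) one_closed] by (rule carrier_matD(2))
  ultimately show ?thesis
    unfolding rep_dim_def[of G "twisted_dual G \<theta> \<pi>"] by simp
qed

lemma twisted_dual_involution:
  assumes "group G" "\<theta> \<in> hom G G" "\<And>g. g \<in> carrier G \<Longrightarrow> \<theta> (\<theta> g) = g" "is_rep G \<pi>"
  shows "twisted_dual G \<theta> (twisted_dual G \<theta> \<pi>) = \<pi>"
proof
  interpret group G by fact
  interpret t: group_hom G G \<theta>
    using assms(1,2) by (simp add: group_hom_def group_hom_axioms_def)
  fix g
  show "twisted_dual G \<theta> (twisted_dual G \<theta> \<pi>) g = \<pi> g"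
  proof (cases "g \<in> carrier G")
    case True
    then show ?thesis
      using assms(3) by (simp add: twisted_dual_def dual_rep_def compose_def)
  next
    case False
    then show ?thesis
      using assms(4) by (auto simp: twisted_dual_def compose_def is_rep_def extensional_def)
  qed
qed

lemma swap_pure_tensor:
  assumes "group G" "\<theta> \<in> hom G G" "\<And>g. g \<in> carrier G \<Longrightarrow> \<theta> (\<theta> g) = g"
    and R: "irr_representatives G \<theta> R"
    and "twisted_dual G \<theta> ` irr_with G \<theta> R 0 \<subseteq> irr_with G \<theta> R 0"
    and "\<pi> \<in> irr_with G \<theta> R 0"
  shows "swap G \<theta> R (\<lambda>\<rho>\<in>irr_with G \<theta> R 0.
            if \<rho> = \<pi> then pure_tensor v w else 0\<^sub>m (rep_dim G \<rho>) (rep_dim G \<rho>)) =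
         (\<lambda>\<rho>\<in>irr_with G \<theta> R 0.
            if \<rho> = twisted_dual G \<theta> \<pi> then pure_tensor w v else 0\<^sub>m (rep_dim G \<rho>) (rep_dim G \<rho>))"
    (is "swap G \<theta> R ?T = ?S")
proof
  fix \<rho>
  have rep: "is_rep G \<rho>" if "\<rho> \<in> R" for \<rho>
    using that R by (auto simp: irr_representatives_def irreducible_rep_def)
  have tr: "transpose_mat (pure_tensor v w) = pure_tensor w v"
    by (auto simp: pure_tensor_def)
  define I where "I = irr_with G \<theta> R 0"
  note in_I = assms(5,6)[folded I_def]
  have rep_I: "is_rep G \<rho>" if "\<rho> \<in> I" for \<rho>
    using that rep by (simp add: I_def)
  show "swap G \<theta> R ?T \<rho> = ?S \<rho>"
    unfolding swap_def I_def[symmetric]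
  proof (cases "\<rho> \<in> I")
    case True
    then have dual: "twisted_dual G \<theta> \<rho> \<in> I"
      using in_I by blast
    have eq: "twisted_dual G \<theta> \<rho> = \<pi> \<longleftrightarrow> \<rho> = twisted_dual G \<theta> \<pi>"
      using twisted_dual_involution[OF assms(1-3) rep_I] in_I(2) True by metis
    have dim: "rep_dim G (twisted_dual G \<theta> \<rho>) = rep_dim G \<rho>"
      by (rule rep_dim_twisted_dual[OF assms(1,2) rep_I[OF True]])
    show "(\<lambda>\<rho>\<in>I. transpose_mat ((\<lambda>\<rho>\<in>I. if \<rho> = \<pi> then pure_tensor v w
              else 0\<^sub>m (rep_dim G \<rho>) (rep_dim G \<rho>)) (twisted_dual G \<theta> \<rho>))) \<rho> =
          (\<lambda>\<rho>\<in>I. if \<rho> = twisted_dual G \<theta> \<pi> then pure_tensor w v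
              else 0\<^sub>m (rep_dim G \<rho>) (rep_dim G \<rho>)) \<rho>"
    proof (cases "twisted_dual G \<theta> \<rho> = \<pi>")
      case True
      then have "\<rho> = twisted_dual G \<theta> \<pi>" by (simp only: eq)
      then show ?thesis
        using True \<open>\<rho> \<in> I\<close> dual tr by (simp only: restrict_apply' if_P)
    next
      case False
      then have "\<rho> \<noteq> twisted_dual G \<theta> \<pi>" by (simp only: eq not_False_eq_True)
      moreover have "transpose_mat (0\<^sub>m (rep_dim G \<rho>) (rep_dim G \<rho>)) =
          (0\<^sub>m (rep_dim G \<rho>) (rep_dim G \<rho>) :: complex mat)"
        by auto
      ultimately show ?thesis
        using False \<open>\<rho> \<in> I\<close> dual by (simp only: restrict_apply' if_False dim)
    qed
  qed simp
qed

end

theory Submission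
  imports Defs "Jordan_Normal_Form.Spectral_Radius"
begin

text \<open>
  The Fourier transform sends a function \<open>f\<close> on the group to the matrices
  \<open>A \<pi> = \<Sum>g. f g \<cdot> \<pi> g\<close>, one for each representative \<open>\<pi>\<close> of the irreducible
  representations. This is a bijection onto all families of square matrices (\<open>fourier_injective\<close>,
  \<open>fourier_surjective\<close>), so the three conditions on \<open>f\<close> can be read off from the family
  (\<open>anti_invariant_functions_iff\<close>). Invariance under \<open>H\<close> on the left and \<open>\<theta>(H)\<close> on the right
  makes the columns of \<open>A \<pi>\<close> invariant in \<open>\<pi>\<close> and its rows invariant in the dual, that is,
  \<open>A \<pi> \<in> \<pi>\<^sup>H \<otimes> (\<pi>\<^sup>*)\<^sup>K\<close> with \<open>K = \<theta>(H)\<close> (\<open>zero_tensor_iff\<close>). Writing \<open>\<tau> \<pi>\<close> for the twisted dual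
  \<open>\<pi>\<^sup>* \<circ> \<theta>\<close>, the coefficient of \<open>f \<circ> \<sigma>\<close> at \<open>\<pi>\<close> is the transpose of the coefficient of \<open>f\<close>
  at \<open>\<tau> \<pi>\<close> (\<open>fourier_twist\<close>), so anti-invariance says \<open>(A (\<tau> \<pi>))\<^sup>T = - A \<pi>\<close>.

  If \<open>\<pi>\<close> and \<open>\<tau> \<pi>\<close> are not isomorphic, both occur among the representatives, and this equation
  relates two summands: it is the sign condition for the swap. Otherwise let \<open>P\<close> be an
  isomorphism from \<open>\<pi>\<close> to \<open>\<tau> \<pi>\<close>. By Schur's lemma it is unique up to scalars; its transpose is
  one as well, so \<open>P\<^sup>T = \<epsilon> P\<close> with \<open>\<epsilon> = 1\<close> or \<open>\<epsilon> = -1\<close>, and since \<open>P\<close> is the matrix of the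
  invariant bilinear forms, \<open>\<epsilon>\<close> is the indicator (\<open>fs_indicator_iso\<close>). Now
  \<open>A (\<tau> \<pi>) = P * A \<pi> * P\<inverse>\<close>, and in terms of \<open>T = A \<pi> * P\<inverse>\<close> the conditions become
  \<open>T \<in> \<pi>\<^sup>H \<otimes> \<pi>\<^sup>H\<close> and \<open>T\<^sup>T = - \<epsilon> T\<close> (\<open>anti_invariant_coefficient_iff\<close>): the exterior square
  for \<open>\<epsilon> = 1\<close>, the symmetric square for \<open>\<epsilon> = -1\<close>.

  As to the Fourier transform, surjectivity comes from the orthogonality relations for matrix
  coefficients. For injectivity, suppose that all coefficients of \<open>f\<close> vanish. Then each translate
  of \<open>f\<close> pairs to zero with every irreducible character. In a basis adapted to an invariant
  subspace a representation is block triangular, so every character is a sum of irreducible ones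
  (\<open>character_sum_zero\<close>). The character of the regular representation then gives the vanishing
  of the value of each translate at the unit, which is to say of \<open>f\<close>.
\<close>

section \<open>Linear algebra\<close>

lemma index_mult_mat_sum:
  assumes "A \<in> carrier_mat n m" "B \<in> carrier_mat m p" "i < n" "j < p"
  shows "(A * B) $$ (i, j) = (\<Sum>k<m. A $$ (i, k) * B $$ (k, j))"
  using assms by (auto simp: scalar_prod_def atLeast0LessThan intro!: sum.cong)

lemma index_mult_mat_vec_sum:
  assumes "A \<in> carrier_mat n m" "x \<in> carrier_vec m" "i < n"
  shows "(A *\<^sub>v x) $ i = (\<Sum>k<m. A $$ (i, k) * x $ k)"
  using assms by (auto simp: scalar_prod_def atLeast0LessThan intro!: sum.cong)

lemma mult_unit_vec:
  assumes "(A :: complex mat) \<in> carrier_mat n m" "j < m"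
  shows "A *\<^sub>v unit_vec m j = col A j"
  using assms by (intro eq_vecI) auto

definition trace :: "'a :: comm_semiring_0 mat \<Rightarrow> 'a" where
  "trace A = (\<Sum>i<dim_row A. A $$ (i, i))"

lemma trace_mult_comm:
  assumes "A \<in> carrier_mat n m" "B \<in> carrier_mat m n"
  shows "trace (A * B) = trace (B * A)"
proof -
  have "trace (A * B) = (\<Sum>i<n. \<Sum>k<m. A $$ (i, k) * B $$ (k, i))"
    using assms by (auto simp: trace_def index_mult_mat_sum[OF assms] simp del: index_mult_mat(1))
  also have "\<dots> = (\<Sum>k<m. \<Sum>i<n. B $$ (k, i) * A $$ (i, k))"
    by (subst sum.swap) (simp add: mult.commute)
  also have "\<dots> = trace (B * A)"
    using assms by (auto simp: trace_def index_mult_mat_sum[OF assms(2,1)] simp del: index_mult_mat(1))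
  finally show ?thesis .
qed

lemma trace_one: "trace (1\<^sub>m n :: complex mat) = of_nat n"
  by (simp add: trace_def)

text \<open>Both identity matrices have the same trace, so they have the same size.\<close>

lemma two_sided_inverse_dim:
  fixes A B :: "complex mat"
  assumes "A \<in> carrier_mat n m" "B \<in> carrier_mat m n" "A * B = 1\<^sub>m n" "B * A = 1\<^sub>m m"
  shows "n = m"
  using trace_mult_comm[OF assms(1,2)] assms(3,4) by (simp add: trace_one)

lemma trivial_kernel_invertible:
  fixes P :: "complex mat"
  assumes P: "P \<in> carrier_mat n n"
    and ker: "\<And>x. x \<in> carrier_vec n \<Longrightarrow> P *\<^sub>v x = 0\<^sub>v n \<Longrightarrow> x = 0\<^sub>v n"
  obtains Q where "Q \<in> carrier_mat n n" "Q * P = 1\<^sub>m n" "P * Q = 1\<^sub>m n"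
proof -
  have "det P \<noteq> 0"
    using ker det_0_iff_vec_prod_zero_field[OF P] by blast
  from det_non_zero_imp_unit[OF P this, of "()"] show ?thesis
    using that by (auto simp: Units_def ring_mat_def)
qed

text \<open>
  A maximality argument: among the invertible matrices, take one with as many leading columns in
  \<^term>\<open>U\<close> as possible. A vector of \<^term>\<open>U\<close> with a nonzero coordinate beyond these columns could
  be exchanged for a column, which would give one more.
\<close>

lemma adapted_basis:
  fixes U :: "complex vec set"
  assumes U: "U \<subseteq> carrier_vec n" "0\<^sub>v n \<in> U"
    and add: "\<And>u v. u \<in> U \<Longrightarrow> v \<in> U \<Longrightarrow> u + v \<in> U"
    and smult: "\<And>c u. u \<in> U \<Longrightarrow> c \<cdot>\<^sub>v u \<in> U"
  obtains P Q k where "P \<in> carrier_mat n n" "Q \<in> carrier_mat n n" "Q * P = 1\<^sub>m n" "P * Q = 1\<^sub>m n"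
    "k \<le> n" "\<forall>x\<in>carrier_vec n. P *\<^sub>v x \<in> U \<longleftrightarrow> (\<forall>i. k \<le> i \<and> i < n \<longrightarrow> x $ i = 0)"
proof -
  define good where "good k \<longleftrightarrow> k \<le> n \<and> (\<exists>P\<in>carrier_mat n n.
    (\<forall>x\<in>carrier_vec n. P *\<^sub>v x = 0\<^sub>v n \<longrightarrow> x = 0\<^sub>v n) \<and> (\<forall>j<k. col P j \<in> U))" for k
  have "good 0"
    unfolding good_def by (auto intro!: bexI[of _ "1\<^sub>m n"])
  moreover have bound: "k \<le> n" if "good k" for k
    using that by (simp add: good_def)
  ultimately obtain k where k: "good k" and max: "\<And>l. good l \<Longrightarrow> l \<le> k"
    using GreatestI_nat[of good 0 n] Greatest_le_nat[of good _ n] by blast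
  from k obtain P where P: "P \<in> carrier_mat n n" "k \<le> n"
    and ker: "\<And>x. x \<in> carrier_vec n \<Longrightarrow> P *\<^sub>v x = 0\<^sub>v n \<Longrightarrow> x = 0\<^sub>v n"
    and cols: "\<And>j. j < k \<Longrightarrow> col P j \<in> U"
    by (auto simp: good_def)
  obtain Q where Q: "Q \<in> carrier_mat n n" "Q * P = 1\<^sub>m n" "P * Q = 1\<^sub>m n"
    using trivial_kernel_invertible[OF P(1) ker] by blast
  have leading: "P *\<^sub>v x \<in> U" if x: "x \<in> carrier_vec n" and x0: "\<forall>i. k \<le> i \<and> i < n \<longrightarrow> x $ i = 0" for x
  proof -
    have "vec n (\<lambda>i. \<Sum>j<l. x $ j * P $$ (i, j)) \<in> U" if "l \<le> k" for l
      using that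
    proof (induction l)
      case 0
      have "vec n (\<lambda>i. 0) = (0\<^sub>v n :: complex vec)" by auto
      then show ?case using U(2) by simp
    next
      case (Suc l)
      have "vec n (\<lambda>i. \<Sum>j<Suc l. x $ j * P $$ (i, j)) =
          vec n (\<lambda>i. \<Sum>j<l. x $ j * P $$ (i, j)) + x $ l \<cdot>\<^sub>v col P l"
        using Suc.prems P by (intro eq_vecI) auto
      then show ?case
        using Suc cols add smult by simp
    qed
    then have "vec n (\<lambda>i. \<Sum>j<k. x $ j * P $$ (i, j)) \<in> U" by simp
    moreover have "P *\<^sub>v x = vec n (\<lambda>i. \<Sum>j<k. x $ j * P $$ (i, j))"
    proof (intro eq_vecI)
      fix i assume "i < dim_vec (vec n (\<lambda>i. \<Sum>j<k. x $ j * P $$ (i, j)))"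
      then have i: "i < n" by simp
      have "(\<Sum>j<n. P $$ (i, j) * x $ j) = (\<Sum>j<k. P $$ (i, j) * x $ j)"
        using x0 P(2) by (intro sum.mono_neutral_right) auto
      then show "(P *\<^sub>v x) $ i = vec n (\<lambda>i. \<Sum>j<k. x $ j * P $$ (i, j)) $ i"
        using i by (simp add: index_mult_mat_vec_sum[OF P(1) x i] mult.commute del: index_mult_mat_vec)
    qed (use P in simp)
    ultimately show ?thesis by simp
  qed
  have "c $ i = 0" if c: "c \<in> carrier_vec n" "P *\<^sub>v c \<in> U" and i: "k \<le> i" "i < n" for c i
  proof (rule ccontr)
    assume ci: "c $ i \<noteq> 0"
    \<comment> \<open>In the coordinates of \<^term>\<open>P\<close>: put \<^term>\<open>c\<close> into column \<^term>\<open>k\<close> and move the old column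
      \<^term>\<open>k\<close> to place \<^term>\<open>i\<close>.\<close>
    define E where "E = mat n n (\<lambda>(r, j). if j = k then c $ r
      else if j = i then (if r = k then 1 else 0) else (if r = j then 1 else 0))"
    have E: "E \<in> carrier_mat n n" by (simp add: E_def)
    have kn: "k < n" using i by simp
    have Ex: "(E *\<^sub>v x) $ r = c $ r * x $ k +
        (if r = k then (if i = k then 0 else x $ i) else if r = i then 0 else x $ r)"
      if x: "x \<in> carrier_vec n" and r: "r < n" for x r
    proof -
      have "(E *\<^sub>v x) $ r = (\<Sum>j<n. E $$ (r, j) * x $ j)"
        by (rule index_mult_mat_vec_sum[OF E x r])
      also have "\<dots> = c $ r * x $ k + (\<Sum>j\<in>{..<n} - {k}. E $$ (r, j) * x $ j)"
        using kn r by (subst sum.remove[of _ k]) (auto simp: E_def)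
      also have "(\<Sum>j\<in>{..<n} - {k}. E $$ (r, j) * x $ j) =
          (\<Sum>j\<in>{..<n} - {k}. if j = (if r = k then i else if r = i then n else r) then x $ j else 0)"
        using r kn i by (intro sum.cong) (auto simp: E_def)
      also have "\<dots> = (if r = k then (if i = k then 0 else x $ i) else if r = i then 0 else x $ r)"
        using r kn i by (subst sum.delta) auto
      finally show ?thesis .
    qed
    have kerE: "x = 0\<^sub>v n" if x: "x \<in> carrier_vec n" and z: "E *\<^sub>v x = 0\<^sub>v n" for x
    proof -
      have eq: "c $ r * x $ k +
        (if r = k then (if i = k then 0 else x $ i) else if r = i then 0 else x $ r) = 0" if "r < n" for r
        using Ex[OF x that] z that by simp
      have xk: "x $ k = 0" using eq[OF i(2)] ci by (auto split: if_splits)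
      have "x $ r = 0" if "r < n" for r
        using eq[OF that] eq[OF kn] xk by (auto split: if_splits)
      then show ?thesis using x by auto
    qed
    have "good (Suc k)"
      unfolding good_def
    proof (intro conjI bexI[of _ "P * E"] ballI allI impI)
      fix x assume x: "x \<in> carrier_vec n" "P * E *\<^sub>v x = 0\<^sub>v n"
      then have "P *\<^sub>v (E *\<^sub>v x) = 0\<^sub>v n" using P E by simp
      then show "x = 0\<^sub>v n" using ker kerE x(1) E by simp
    next
      fix j assume j: "j < Suc k"
      have colE: "col (P * E) j = P *\<^sub>v col E j"
        using j kn by (intro col_mult2[OF P(1) E]) simp
      show "col (P * E) j \<in> U"
      proof (cases "j = k")
        case True
        then have "col E j = c" using c kn by (auto simp: E_def)
        then show ?thesis using colE c by simp
      next
        case False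
        then have "col E j = unit_vec n j" using j kn i by (auto simp: E_def)
        then show ?thesis
          using colE mult_unit_vec[OF P(1), of j] cols[of j] j kn False by simp
      qed
    qed (use P E kn in auto)
    then show False using max by fastforce
  qed
  then show ?thesis
    using that[OF P(1) Q P(2)] leading by blast
qed

text \<open>
  The families form an \<^term>\<open>S\<close>-by-\<^term>\<open>X\<close> matrix and an \<^term>\<open>X\<close>-by-\<^term>\<open>S\<close> matrix whose
  product is the identity. If \<^term>\<open>S\<close> were the larger set, padding with zeros would make both
  square, and the product in the other order would have a zero row.
\<close>

lemma card_le_of_biorthogonal:
  fixes u v :: "'s \<Rightarrow> 'x \<Rightarrow> complex"
  assumes fin: "finite S" "finite X"
    and orth: "\<And>s t. s \<in> S \<Longrightarrow> t \<in> S \<Longrightarrow> (\<Sum>x\<in>X. u s x * v t x) = (if s = t then 1 else 0)"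
  shows "card S \<le> card X"
proof (rule ccontr)
  assume "\<not> card S \<le> card X"
  define m where "m = card S"
  define N where "N = card X"
  have Nm: "N < m" using \<open>\<not> card S \<le> card X\<close> by (simp add: m_def N_def)
  obtain es where es: "bij_betw es {..<m} S"
    using fin(1) ex_bij_betw_nat_finite[of S] by (auto simp: m_def atLeast0LessThan)
  obtain ex where ex: "bij_betw ex {..<N} X"
    using fin(2) ex_bij_betw_nat_finite[of X] by (auto simp: N_def atLeast0LessThan)
  define A where "A = mat m m (\<lambda>(s, x). if x < N then u (es s) (ex x) else 0)"
  define B where "B = mat m m (\<lambda>(x, t). if x < N then v (es t) (ex x) else 0)"
  have A: "A \<in> carrier_mat m m" and B: "B \<in> carrier_mat m m" by (auto simp: A_def B_def)
  have "A * B = 1\<^sub>m m"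
  proof (intro eq_matI)
    fix s t assume "s < dim_row (1\<^sub>m m :: complex mat)" "t < dim_col (1\<^sub>m m :: complex mat)"
    then have st: "s < m" "t < m" by auto
    then have es_in: "es s \<in> S" "es t \<in> S" using es by (auto simp: bij_betw_def)
    have inj: "es s = es t \<longleftrightarrow> s = t"
      using es st by (auto simp: bij_betw_def inj_on_def)
    have "(A * B) $$ (s, t) = (\<Sum>x<m. A $$ (s, x) * B $$ (x, t))"
      by (rule index_mult_mat_sum[OF A B st])
    also have "\<dots> = (\<Sum>x<N. u (es s) (ex x) * v (es t) (ex x))"
      using st Nm by (intro sum.mono_neutral_cong_right) (auto simp: A_def B_def)
    also have "\<dots> = (\<Sum>x\<in>X. u (es s) x * v (es t) x)"
      by (rule sum.reindex_bij_betw[OF ex])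
    finally show "(A * B) $$ (s, t) = 1\<^sub>m m $$ (s, t)"
      using orth[OF es_in] inj st by simp
  qed (auto simp: A_def B_def)
  then have BA: "B * A = 1\<^sub>m m" by (rule mat_mult_left_right_inverse[OF A B])
  have "(B * A) $$ (N, N) = (\<Sum>x<m. B $$ (N, x) * A $$ (x, N))"
    by (rule index_mult_mat_sum[OF B A Nm Nm])
  also have "\<dots> = 0" using Nm by (auto simp: B_def)
  finally show False using BA Nm by simp
qed

section \<open>Characters and the regular representation\<close>

lemma rep_mult:
  assumes "is_rep G \<pi>" "g \<in> carrier G" "h \<in> carrier G"
  shows "\<pi> (g \<otimes>\<^bsub>G\<^esub> h) = \<pi> g * \<pi> h"
  using assms by (auto simp: is_rep_def hom_def units_of_def ring_mat_def)

lemma rep_one: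
  assumes "group G" "is_rep G \<pi>"
  shows "\<pi> \<one>\<^bsub>G\<^esub> = 1\<^sub>m (rep_dim G \<pi>)"
proof -
  interpret group G by fact
  define n where "n = rep_dim G \<pi>"
  have "\<pi> \<one>\<^bsub>G\<^esub> \<in> Units (ring_mat TYPE(complex) n ())"
    using assms(2) by (auto simp: is_rep_def hom_def units_of_def n_def)
  then obtain B where B: "B \<in> carrier_mat n n" "B * \<pi> \<one>\<^bsub>G\<^esub> = 1\<^sub>m n"
    by (auto simp: Units_def ring_mat_def)
  have c: "\<pi> \<one>\<^bsub>G\<^esub> \<in> carrier_mat n n"
    using is_rep_carrier[OF assms(2) one_closed] by (simp add: n_def)
  have "\<pi> \<one>\<^bsub>G\<^esub> * \<pi> \<one>\<^bsub>G\<^esub> = \<pi> \<one>\<^bsub>G\<^esub>"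
    using rep_mult[OF assms(2) one_closed one_closed] by simp
  then have "B * \<pi> \<one>\<^bsub>G\<^esub> * \<pi> \<one>\<^bsub>G\<^esub> = B * \<pi> \<one>\<^bsub>G\<^esub>"
    using B(1) c by simp
  then show ?thesis using B(2) c by (simp add: n_def)
qed

lemma rep_inv:
  assumes "group G" "is_rep G \<pi>" "g \<in> carrier G"
  shows "\<pi> (inv\<^bsub>G\<^esub> g) * \<pi> g = 1\<^sub>m (rep_dim G \<pi>)" "\<pi> g * \<pi> (inv\<^bsub>G\<^esub> g) = 1\<^sub>m (rep_dim G \<pi>)"
proof -
  interpret group G by fact
  show "\<pi> (inv\<^bsub>G\<^esub> g) * \<pi> g = 1\<^sub>m (rep_dim G \<pi>)" "\<pi> g * \<pi> (inv\<^bsub>G\<^esub> g) = 1\<^sub>m (rep_dim G \<pi>)"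
    using rep_mult[OF assms(2), of g "inv\<^bsub>G\<^esub> g"] rep_mult[OF assms(2), of "inv\<^bsub>G\<^esub> g" g]
      rep_one[OF assms(1,2)] assms(3) by simp_all
qed

lemma is_repI:
  assumes "group G" and c: "\<And>g. g \<in> carrier G \<Longrightarrow> \<pi> g \<in> carrier_mat n n"
    and m: "\<And>g h. g \<in> carrier G \<Longrightarrow> h \<in> carrier G \<Longrightarrow> \<pi> (g \<otimes>\<^bsub>G\<^esub> h) = \<pi> g * \<pi> h"
    and o: "\<pi> \<one>\<^bsub>G\<^esub> = 1\<^sub>m n" and "\<pi> \<in> extensional (carrier G)"
  shows "is_rep G \<pi> \<and> rep_dim G \<pi> = n"
proof -
  interpret group G by fact
  have n: "rep_dim G \<pi> = n" using o by (simp add: rep_dim_def)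
  have "\<pi> g \<in> Units (ring_mat TYPE(complex) n ())" if "g \<in> carrier G" for g
    using c m[of g "inv\<^bsub>G\<^esub> g"] m[of "inv\<^bsub>G\<^esub> g" g] o that
    by (auto simp: Units_def ring_mat_def intro!: bexI[of _ "\<pi> (inv\<^bsub>G\<^esub> g)"])
  then have "is_rep G \<pi>"
    using m assms(5) by (auto simp: is_rep_def n hom_def units_of_def ring_mat_def)
  then show ?thesis using n by simp
qed

lemma subspace_vec_iff:
  "VectorSpace.subspace class_ring U (module_vec TYPE(complex) n) \<longleftrightarrow>
    U \<subseteq> carrier_vec n \<and> 0\<^sub>v n \<in> U \<and> (\<forall>u\<in>U. \<forall>v\<in>U. u + v \<in> U) \<and> (\<forall>c. \<forall>u\<in>U. c \<cdot>\<^sub>v u \<in> U)"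
proof -
  interpret vec_space "TYPE(complex)" n .
  show ?thesis
    unfolding VectorSpace.subspace_def submodule_def module_vec_simps
    using vectorspace_axioms module_axioms by auto
qed

text \<open>
  The operator by which \<^term>\<open>f\<close>, regarded as the element \<open>\<Sum>g. f g \<cdot> g\<close> of the group algebra,
  acts in the representation.
\<close>

definition fourier ::
  "('g, 'b) monoid_scheme \<Rightarrow> ('g \<Rightarrow> complex) \<Rightarrow> ('g \<Rightarrow> complex mat) \<Rightarrow> complex mat" where
  "fourier G f \<pi> = mat (rep_dim G \<pi>) (rep_dim G \<pi>) (\<lambda>(i, j). \<Sum>g\<in>carrier G. f g * \<pi> g $$ (i, j))"

lemma fourier_carrier [simp]: "fourier G f \<pi> \<in> carrier_mat (rep_dim G \<pi>) (rep_dim G \<pi>)"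
  by (simp add: fourier_def)

lemma fourier_index:
  "i < rep_dim G \<pi> \<Longrightarrow> j < rep_dim G \<pi> \<Longrightarrow>
    fourier G f \<pi> $$ (i, j) = (\<Sum>g\<in>carrier G. f g * \<pi> g $$ (i, j))"
  by (simp add: fourier_def)

lemma sum_lessThan_split:
  fixes k n :: nat and f :: "nat \<Rightarrow> 'a :: comm_monoid_add"
  assumes "k \<le> n"
  shows "(\<Sum>l<n. f l) = (\<Sum>l<k. f l) + (\<Sum>l<n - k. f (l + k))"
proof -
  have "(\<Sum>l<n. f l) = (\<Sum>l<k. f l) + (\<Sum>l=k..<n. f l)"
    using assms by (metis atLeast0LessThan le0 sum.atLeastLessThan_concat)
  also have "(\<Sum>l=k..<n. f l) = (\<Sum>l<n - k. f (l + k))"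
    using sum.shift_bounds_nat_ivl[of f 0 k "n - k"] assms by (simp add: atLeast0LessThan)
  finally show ?thesis .
qed

text \<open>
  In a basis adapted to an invariant subspace the representation is block triangular. Its character
  is therefore the sum of the characters of the diagonal blocks, the subspace and the quotient.
\<close>

lemma character_of_reducible:
  fixes G (structure)
  assumes "group G" and rep: "is_rep G \<rho>" and n: "rep_dim G \<rho> = n"
    and U: "VectorSpace.subspace class_ring U (module_vec TYPE(complex) n)"
    and inv: "\<And>g u. g \<in> carrier G \<Longrightarrow> u \<in> U \<Longrightarrow> \<rho> g *\<^sub>v u \<in> U"
    and proper: "U \<noteq> {0\<^sub>v n}" "U \<noteq> carrier_vec n"
  obtains \<rho>1 \<rho>2 where "is_rep G \<rho>1" "is_rep G \<rho>2" "rep_dim G \<rho>1 < n" "rep_dim G \<rho>2 < n"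
    "\<And>g. g \<in> carrier G \<Longrightarrow> trace (\<rho> g) = trace (\<rho>1 g) + trace (\<rho>2 g)"
proof -
  interpret group G by fact
  have U': "U \<subseteq> carrier_vec n" "0\<^sub>v n \<in> U" "\<And>u v. u \<in> U \<Longrightarrow> v \<in> U \<Longrightarrow> u + v \<in> U"
    "\<And>c u. u \<in> U \<Longrightarrow> c \<cdot>\<^sub>v u \<in> U"
    using U by (auto simp: subspace_vec_iff)
  obtain P Q k where P: "P \<in> carrier_mat n n" and Q: "Q \<in> carrier_mat n n"
    and QP: "Q * P = 1\<^sub>m n" and PQ: "P * Q = 1\<^sub>m n" and k: "k \<le> n"
    and inU: "\<forall>x\<in>carrier_vec n. P *\<^sub>v x \<in> U \<longleftrightarrow> (\<forall>i. k \<le> i \<and> i < n \<longrightarrow> x $ i = 0)"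
    by (rule adapted_basis[OF U'])
  have c: "\<rho> g \<in> carrier_mat n n" if "g \<in> carrier G" for g
    using is_rep_carrier[OF rep that] n by simp
  have coord: "P *\<^sub>v (Q *\<^sub>v u) = u" if "u \<in> carrier_vec n" for u
    using that P Q PQ by (metis assoc_mult_mat_vec one_mult_mat_vec)
  have "k \<noteq> 0"
  proof
    assume "k = 0"
    have "u = 0\<^sub>v n" if "u \<in> U" for u
    proof -
      have u: "u \<in> carrier_vec n" using that U' by blast
      then have "Q *\<^sub>v u = 0\<^sub>v n"
        using inU[rule_format, of "Q *\<^sub>v u"] coord[OF u] Q \<open>k = 0\<close> that by (intro eq_vecI) auto
      moreover have "P *\<^sub>v 0\<^sub>v n = 0\<^sub>v n"
        using P by (intro eq_vecI) auto
      ultimately show ?thesis using coord[OF u] by simp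
    qed
    then show False using proper(1) U'(2) by blast
  qed
  have "k \<noteq> n"
  proof
    assume "k = n"
    have "u \<in> U" if u: "u \<in> carrier_vec n" for u
      using inU[rule_format, of "Q *\<^sub>v u"] coord[OF u] Q u \<open>k = n\<close> by auto
    then show False using proper(2) U'(1) by blast
  qed
  define \<rho>' where "\<rho>' g = Q * \<rho> g * P" for g
  have c': "\<rho>' g \<in> carrier_mat n n" if "g \<in> carrier G" for g
    using P Q c[OF that] by (simp add: \<rho>'_def)
  have mult': "\<rho>' (g \<otimes> h) = \<rho>' g * \<rho>' h" if "g \<in> carrier G" "h \<in> carrier G" for g h
  proof -
    have "\<rho>' g * \<rho>' h = Q * \<rho> g * (P * Q) * \<rho> h * P"
      unfolding \<rho>'_def using P Q c[OF that(1)] c[OF that(2)] by (simp add: assoc_mult_mat[of _ n n _ n _ n])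
    also have "\<dots> = Q * (\<rho> g * \<rho> h) * P"
      unfolding PQ using P Q c[OF that(1)] c[OF that(2)] by (simp add: assoc_mult_mat[of _ n n _ n _ n])
    finally show ?thesis
      unfolding \<rho>'_def using rep_mult[OF rep that] by simp
  qed
  have one': "\<rho>' \<one> = 1\<^sub>m n"
    unfolding \<rho>'_def using rep_one[OF assms(1) rep] n P Q QP by simp
  have trace': "trace (\<rho>' g) = trace (\<rho> g)" if "g \<in> carrier G" for g
  proof -
    have "trace (Q * \<rho> g * P) = trace (P * (Q * \<rho> g))"
      by (rule trace_mult_comm[of _ n n]) (use P Q c[OF that] in auto)
    also have "P * (Q * \<rho> g) = P * Q * \<rho> g"
      using P Q c[OF that] by (simp add: assoc_mult_mat[of _ n n _ n _ n])
    finally show ?thesis using PQ c[OF that] by (simp add: \<rho>'_def)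
  qed
  have block: "\<rho>' g $$ (i, j) = 0" if g: "g \<in> carrier G" and ij: "k \<le> i" "i < n" "j < k" for g i j
  proof -
    have j: "j < n" using ij k by simp
    have "P *\<^sub>v unit_vec n j \<in> U" using inU[rule_format, of "unit_vec n j"] ij by auto
    then have "\<rho> g *\<^sub>v (P *\<^sub>v unit_vec n j) \<in> U" by (rule inv[OF g])
    moreover have "P *\<^sub>v col (\<rho>' g) j = \<rho> g *\<^sub>v (P *\<^sub>v unit_vec n j)"
    proof -
      have "P *\<^sub>v (\<rho>' g *\<^sub>v unit_vec n j) = P *\<^sub>v (Q *\<^sub>v (\<rho> g *\<^sub>v (P *\<^sub>v unit_vec n j)))"
        unfolding \<rho>'_def using P Q c[OF g] by (simp add: assoc_mult_mat_vec[of _ n n _ n])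
      then show ?thesis
        using mult_unit_vec[OF c'[OF g] j] coord P c[OF g] by simp
    qed
    ultimately have "P *\<^sub>v col (\<rho>' g) j \<in> U" by simp
    then have "col (\<rho>' g) j $ i = 0"
      using inU[rule_format, of "col (\<rho>' g) j"] c'[OF g] ij by auto
    then show ?thesis using c'[OF g] ij j by simp
  qed
  have entry: "\<rho>' (g \<otimes> h) $$ (i, j) =
      (\<Sum>l<k. \<rho>' g $$ (i, l) * \<rho>' h $$ (l, j)) + (\<Sum>l<n - k. \<rho>' g $$ (i, l + k) * \<rho>' h $$ (l + k, j))"
    if "g \<in> carrier G" "h \<in> carrier G" "i < n" "j < n" for g h i j
    using index_mult_mat_sum[OF c'[OF that(1)] c'[OF that(2)] that(3,4)] mult'[OF that(1,2)]
      sum_lessThan_split[OF k, of "\<lambda>l. \<rho>' g $$ (i, l) * \<rho>' h $$ (l, j)"] by simp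
  define \<rho>1 where "\<rho>1 = (\<lambda>g\<in>carrier G. mat k k (\<lambda>(i, j). \<rho>' g $$ (i, j)))"
  define \<rho>2 where "\<rho>2 = (\<lambda>g\<in>carrier G. mat (n - k) (n - k) (\<lambda>(i, j). \<rho>' g $$ (i + k, j + k)))"
  have 1: "is_rep G \<rho>1 \<and> rep_dim G \<rho>1 = k"
  proof (rule is_repI[OF assms(1)])
    fix g h assume gh: "g \<in> carrier G" "h \<in> carrier G"
    show "\<rho>1 (g \<otimes> h) = \<rho>1 g * \<rho>1 h"
    proof (rule eq_matI)
      fix i j assume "i < dim_row (\<rho>1 g * \<rho>1 h)" "j < dim_col (\<rho>1 g * \<rho>1 h)"
      then have ij: "i < k" "j < k" using gh by (auto simp: \<rho>1_def)
      have "(\<Sum>l<n - k. \<rho>' g $$ (i, l + k) * \<rho>' h $$ (l + k, j)) = 0"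
        using block[OF gh(2)] ij by (intro sum.neutral) auto
      then show "\<rho>1 (g \<otimes> h) $$ (i, j) = (\<rho>1 g * \<rho>1 h) $$ (i, j)"
        using gh ij entry[OF gh, of i j] k
        by (subst index_mult_mat_sum[of _ k k _ k]) (auto simp: \<rho>1_def)
    qed (use gh in \<open>auto simp: \<rho>1_def\<close>)
  qed (use one' k in \<open>auto simp: \<rho>1_def\<close>)
  have 2: "is_rep G \<rho>2 \<and> rep_dim G \<rho>2 = n - k"
  proof (rule is_repI[OF assms(1)])
    fix g h assume gh: "g \<in> carrier G" "h \<in> carrier G"
    show "\<rho>2 (g \<otimes> h) = \<rho>2 g * \<rho>2 h"
    proof (rule eq_matI)
      fix i j assume "i < dim_row (\<rho>2 g * \<rho>2 h)" "j < dim_col (\<rho>2 g * \<rho>2 h)"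
      then have ij: "i < n - k" "j < n - k" using gh by (auto simp: \<rho>2_def)
      have "(\<Sum>l<k. \<rho>' g $$ (i + k, l) * \<rho>' h $$ (l, j + k)) = 0"
        using block[OF gh(1)] ij by (intro sum.neutral) auto
      then show "\<rho>2 (g \<otimes> h) $$ (i, j) = (\<rho>2 g * \<rho>2 h) $$ (i, j)"
        using gh ij entry[OF gh, of "i + k" "j + k"] k
        by (subst index_mult_mat_sum[of _ "n - k" "n - k" _ "n - k"]) (auto simp: \<rho>2_def)
    qed (use gh in \<open>auto simp: \<rho>2_def\<close>)
  qed (use one' k in \<open>auto simp: \<rho>2_def\<close>)
  have "trace (\<rho> g) = trace (\<rho>1 g) + trace (\<rho>2 g)" if g: "g \<in> carrier G" for g
    using trace'[OF g] c'[OF g] g sum_lessThan_split[OF k, of "\<lambda>l. \<rho>' g $$ (l, l)"]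
    by (simp add: trace_def \<rho>1_def \<rho>2_def)
  then show ?thesis
    using that[of \<rho>1 \<rho>2] 1 2 \<open>k \<noteq> 0\<close> \<open>k \<noteq> n\<close> k by simp
qed

text \<open>
  Vanishing passes from the irreducible characters to all of them by induction on the dimension,
  splitting off an invariant subspace whenever there is one.
\<close>

lemma character_sum_zero:
  assumes "group G"
    and irr: "\<And>\<pi>. irreducible_rep G \<pi> \<Longrightarrow> (\<Sum>g\<in>carrier G. f g * trace (\<pi> g)) = 0"
    and "is_rep G \<rho>"
  shows "(\<Sum>g\<in>carrier G. f g * trace (\<rho> g)) = 0"
  using assms(3)
proof (induction "rep_dim G \<rho>" arbitrary: \<rho> rule: less_induct)
  case less
  note rep = less.prems
  show ?case
  proof (cases "irreducible_rep G \<rho> \<or> rep_dim G \<rho> = 0")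
    case True
    moreover have "trace (\<rho> g) = 0" if "rep_dim G \<rho> = 0" "g \<in> carrier G" for g
      using is_rep_carrier[OF rep that(2)] that(1) by (simp add: trace_def)
    ultimately show ?thesis using irr by auto
  next
    case False
    then obtain U where U: "VectorSpace.subspace class_ring U (module_vec TYPE(complex) (rep_dim G \<rho>))"
      "\<And>g u. g \<in> carrier G \<Longrightarrow> u \<in> U \<Longrightarrow> \<rho> g *\<^sub>v u \<in> U"
      "U \<noteq> {0\<^sub>v (rep_dim G \<rho>)}" "U \<noteq> carrier_vec (rep_dim G \<rho>)"
      using rep unfolding irreducible_rep_def by blast
    from character_of_reducible[OF assms(1) rep refl U]
    obtain \<rho>1 \<rho>2 where r: "is_rep G \<rho>1" "is_rep G \<rho>2"
      "rep_dim G \<rho>1 < rep_dim G \<rho>" "rep_dim G \<rho>2 < rep_dim G \<rho>"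
      and tr: "\<And>g. g \<in> carrier G \<Longrightarrow> trace (\<rho> g) = trace (\<rho>1 g) + trace (\<rho>2 g)"
      by metis
    have "(\<Sum>g\<in>carrier G. f g * trace (\<rho> g)) =
        (\<Sum>g\<in>carrier G. f g * trace (\<rho>1 g)) + (\<Sum>g\<in>carrier G. f g * trace (\<rho>2 g))"
      by (simp add: tr distrib_left sum.distrib)
    then show ?thesis
      using less.hyps r by simp
  qed
qed

text \<open>
  The permutation matrices of left multiplication. A left multiplication other than the identity
  has no fixed points, so its trace is zero.
\<close>

lemma regular_rep:
  fixes G (structure)
  assumes "group G" "finite (carrier G)"
  obtains \<rho> where "is_rep G \<rho>"
    "\<And>g. g \<in> carrier G \<Longrightarrow> trace (\<rho> g) = (if g = \<one>\<^bsub>G\<^esub> then of_nat (card (carrier G)) else 0)"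
proof -
  interpret group G by fact
  define N where "N = card (carrier G)"
  obtain e where e: "bij_betw e {..<N} (carrier G)"
    using assms(2) ex_bij_betw_nat_finite[of "carrier G"] by (auto simp: N_def atLeast0LessThan)
  have e_in: "e i \<in> carrier G" if "i < N" for i using e that by (auto simp: bij_betw_def)
  have e_inj: "e i = e j \<longleftrightarrow> i = j" if "i < N" "j < N" for i j
    using e that by (auto simp: bij_betw_def inj_on_def)
  define \<rho> where "\<rho> = (\<lambda>g\<in>carrier G. mat N N (\<lambda>(i, j). if e i = g \<otimes> e j then 1 else 0 :: complex))"
  have "is_rep G \<rho> \<and> rep_dim G \<rho> = N"
  proof (rule is_repI[OF assms(1)])
    fix g h assume gh: "g \<in> carrier G" "h \<in> carrier G"
    show "\<rho> (g \<otimes> h) = \<rho> g * \<rho> h"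
    proof (rule eq_matI)
      fix i j assume "i < dim_row (\<rho> g * \<rho> h)" "j < dim_col (\<rho> g * \<rho> h)"
      then have ij: "i < N" "j < N" using gh by (auto simp: \<rho>_def)
      have "(\<rho> g * \<rho> h) $$ (i, j) = (\<Sum>l<N. \<rho> g $$ (i, l) * \<rho> h $$ (l, j))"
        by (rule index_mult_mat_sum) (use gh ij in \<open>auto simp: \<rho>_def\<close>)
      also have "\<dots> = (\<Sum>l<N. (if e i = g \<otimes> e l then 1 else 0) * (if e l = h \<otimes> e j then 1 else 0))"
        using gh ij by (intro sum.cong) (auto simp: \<rho>_def)
      also have "\<dots> = (\<Sum>x\<in>carrier G. (if e i = g \<otimes> x then 1 else 0) * (if x = h \<otimes> e j then 1 else 0))"
        by (rule sum.reindex_bij_betw[OF e])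
      also have "\<dots> = (\<Sum>x\<in>carrier G. if x = h \<otimes> e j then (if e i = g \<otimes> x then 1 else 0) else 0)"
        by (intro sum.cong) auto
      also have "\<dots> = (if e i = g \<otimes> (h \<otimes> e j) then 1 else 0)"
        using gh e_in[OF ij(2)] assms(2) by (subst sum.delta) auto
      finally show "\<rho> (g \<otimes> h) $$ (i, j) = (\<rho> g * \<rho> h) $$ (i, j)"
        using gh ij e_in[OF ij(2)] by (simp add: \<rho>_def m_assoc)
    qed (use gh in \<open>auto simp: \<rho>_def\<close>)
  next
    show "\<rho> \<one> = 1\<^sub>m N" using e_in e_inj by (auto simp: \<rho>_def)
  qed (auto simp: \<rho>_def)
  moreover have "trace (\<rho> g) = (if g = \<one> then of_nat (card (carrier G)) else 0)" if g: "g \<in> carrier G" for g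
  proof -
    have "e i = g \<otimes> e i \<longleftrightarrow> g = \<one>" if "i < N" for i
      using e_in[OF that] g by (metis l_one one_closed right_cancel)
    then have "trace (\<rho> g) = (\<Sum>i<N. if g = \<one> then 1 else 0)"
      using g by (auto simp: trace_def \<rho>_def intro!: sum.cong)
    then show ?thesis by (simp add: N_def)
  qed
  ultimately show ?thesis using that by blast
qed

text \<open>
  If all Fourier coefficients of \<^term>\<open>f\<close> vanish then so do those of each left translate. Hence each
  translate pairs to zero with every irreducible character, and then with the character of the
  regular representation, which reads off the value at the unit.
\<close>

lemma fourier_eq_zero:
  fixes G (structure)
  assumes "group G" "finite (carrier G)"
    and irr: "\<And>\<pi>. irreducible_rep G \<pi> \<Longrightarrow> fourier G f \<pi> = 0\<^sub>m (rep_dim G \<pi>) (rep_dim G \<pi>)"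
    and x: "x \<in> carrier G"
  shows "f x = 0"
proof -
  interpret group G by fact
  define h where "h g = f (x \<otimes> g)" for g
  have irr_zero: "(\<Sum>g\<in>carrier G. h g * trace (\<pi> g)) = 0" if \<pi>: "irreducible_rep G \<pi>" for \<pi>
  proof -
    define n where "n = rep_dim G \<pi>"
    have rep: "is_rep G \<pi>" using \<pi> by (simp add: irreducible_rep_def)
    have c: "\<pi> g \<in> carrier_mat n n" if "g \<in> carrier G" for g
      using is_rep_carrier[OF rep that] by (simp add: n_def)
    have tr: "trace (\<pi> g) = (\<Sum>i<n. \<Sum>l<n. \<pi> (inv x) $$ (i, l) * \<pi> (x \<otimes> g) $$ (l, i))"
      if g: "g \<in> carrier G" for g
    proof -
      have "\<pi> g = \<pi> (inv x) * \<pi> (x \<otimes> g)"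
        using rep_mult[OF rep, of "inv x" "x \<otimes> g"] g x by (simp add: m_assoc[symmetric])
      then show ?thesis
        using index_mult_mat_sum[OF c[of "inv x"] c[of "x \<otimes> g"]] c[of "inv x"] x g by (simp add: trace_def)
    qed
    have coeff: "(\<Sum>g\<in>carrier G. f (x \<otimes> g) * \<pi> (x \<otimes> g) $$ (l, i)) = 0" if "l < n" "i < n" for l i
    proof -
      have "bij_betw (\<lambda>g. x \<otimes> g) (carrier G) (carrier G)"
        by (rule bij_betw_byWitness[of _ "\<lambda>g. inv x \<otimes> g"]) (use x in \<open>auto simp: m_assoc[symmetric]\<close>)
      then have "(\<Sum>g\<in>carrier G. f (x \<otimes> g) * \<pi> (x \<otimes> g) $$ (l, i)) = (\<Sum>g\<in>carrier G. f g * \<pi> g $$ (l, i))"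
        by (rule sum.reindex_bij_betw)
      also have "\<dots> = fourier G f \<pi> $$ (l, i)" using that by (simp add: fourier_index n_def)
      finally show ?thesis using irr[OF \<pi>] that by (simp add: n_def)
    qed
    have "(\<Sum>g\<in>carrier G. h g * trace (\<pi> g)) =
        (\<Sum>g\<in>carrier G. \<Sum>i<n. \<Sum>l<n. \<pi> (inv x) $$ (i, l) * (f (x \<otimes> g) * \<pi> (x \<otimes> g) $$ (l, i)))"
      by (intro sum.cong refl) (simp add: tr h_def sum_distrib_left mult.left_commute)
    also have "\<dots> = (\<Sum>i<n. \<Sum>l<n. \<pi> (inv x) $$ (i, l) * (\<Sum>g\<in>carrier G. f (x \<otimes> g) * \<pi> (x \<otimes> g) $$ (l, i)))"
      by (subst sum.swap, intro sum.cong refl, subst sum.swap) (simp add: sum_distrib_left)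
    also have "\<dots> = 0" using coeff by simp
    finally show ?thesis .
  qed
  have zero: "(\<Sum>g\<in>carrier G. h g * trace (\<rho> g)) = 0" if "is_rep G \<rho>" for \<rho>
    by (rule character_sum_zero[OF assms(1) irr_zero that])
  obtain \<rho> where \<rho>: "is_rep G \<rho>"
    "\<And>g. g \<in> carrier G \<Longrightarrow> trace (\<rho> g) = (if g = \<one> then of_nat (card (carrier G)) else 0)"
    using regular_rep[OF assms(1,2)] by blast
  have "(\<Sum>g\<in>carrier G. h g * trace (\<rho> g)) =
      (\<Sum>g\<in>carrier G. if g = \<one> then h g * of_nat (card (carrier G)) else 0)"
    by (intro sum.cong) (auto simp: \<rho>(2))
  also have "\<dots> = h \<one> * of_nat (card (carrier G))"
    using assms(2) by simp
  finally have "h \<one> * of_nat (card (carrier G)) = 0" using zero[OF \<rho>(1)] by simp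
  then show ?thesis using x assms(2) by (auto simp: h_def card_eq_0_iff)
qed

section \<open>Schur's lemma and the Fourier transform\<close>

lemma carrier_GL_iff:
  "P \<in> carrier (GL n) \<longleftrightarrow> P \<in> carrier_mat n n \<and> (\<exists>Q\<in>carrier_mat n n. Q * P = 1\<^sub>m n \<and> P * Q = 1\<^sub>m n)"
  by (simp add: units_of_def Units_def ring_mat_def)

lemma rep_isoI:
  assumes dim: "rep_dim G \<pi> = n" "rep_dim G \<rho> = n"
    and P: "P \<in> carrier_mat n n" "Q \<in> carrier_mat n n" "Q * P = 1\<^sub>m n" "P * Q = 1\<^sub>m n"
    and tw: "\<And>g. g \<in> carrier G \<Longrightarrow> P * \<pi> g = \<rho> g * P"
  shows "rep_iso G \<pi> \<rho>"
  unfolding rep_iso_def dim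
proof (intro conjI refl bexI ballI)
  show "P \<in> carrier (GL n)" unfolding carrier_GL_iff using P by blast
qed (rule tw)

lemma rep_isoE:
  assumes "rep_iso G \<pi> \<rho>"
  obtains P Q where "P \<in> carrier_mat (rep_dim G \<pi>) (rep_dim G \<pi>)" "Q \<in> carrier_mat (rep_dim G \<pi>) (rep_dim G \<pi>)"
    "Q * P = 1\<^sub>m (rep_dim G \<pi>)" "P * Q = 1\<^sub>m (rep_dim G \<pi>)" "\<forall>g\<in>carrier G. P * \<pi> g = \<rho> g * P"
    "rep_dim G \<rho> = rep_dim G \<pi>"
proof -
  obtain P where "P \<in> carrier (GL (rep_dim G \<pi>))" and tw: "\<forall>g\<in>carrier G. P * \<pi> g = \<rho> g * P"
    and d: "rep_dim G \<rho> = rep_dim G \<pi>"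
    using assms unfolding rep_iso_def by metis
  then obtain Q where "P \<in> carrier_mat (rep_dim G \<pi>) (rep_dim G \<pi>)"
    "Q \<in> carrier_mat (rep_dim G \<pi>) (rep_dim G \<pi>)"
    "Q * P = 1\<^sub>m (rep_dim G \<pi>)" "P * Q = 1\<^sub>m (rep_dim G \<pi>)"
    unfolding carrier_GL_iff by blast
  then show ?thesis by (rule that) (rule tw, rule d)
qed

lemma rep_iso_refl:
  assumes "is_rep G \<pi>"
  shows "rep_iso G \<pi> \<pi>"
proof (rule rep_isoI[OF refl refl one_carrier_mat one_carrier_mat])
  fix g assume g: "g \<in> carrier G"
  show "1\<^sub>m (rep_dim G \<pi>) * \<pi> g = \<pi> g * 1\<^sub>m (rep_dim G \<pi>)"
    using is_rep_carrier[OF assms g] by simp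
qed auto

lemma rep_iso_sym:
  assumes "is_rep G \<pi>" "is_rep G \<rho>" "rep_iso G \<pi> \<rho>"
  shows "rep_iso G \<rho> \<pi>"
  using assms(3)
proof (rule rep_isoE)
  fix P Q
  define n where "n = rep_dim G \<pi>"
  assume "P \<in> carrier_mat (rep_dim G \<pi>) (rep_dim G \<pi>)" "Q \<in> carrier_mat (rep_dim G \<pi>) (rep_dim G \<pi>)"
    "Q * P = 1\<^sub>m (rep_dim G \<pi>)" "P * Q = 1\<^sub>m (rep_dim G \<pi>)"
    and tw: "\<forall>g\<in>carrier G. P * \<pi> g = \<rho> g * P" and d: "rep_dim G \<rho> = rep_dim G \<pi>"
  then have P: "P \<in> carrier_mat n n" "Q \<in> carrier_mat n n" "Q * P = 1\<^sub>m n" "P * Q = 1\<^sub>m n"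
    by (auto simp: n_def)
  show ?thesis
  proof (rule rep_isoI[OF _ _ P(2,1,4,3)])
    fix g assume g: "g \<in> carrier G"
    have c: "\<pi> g \<in> carrier_mat n n" "\<rho> g \<in> carrier_mat n n"
      using is_rep_carrier[OF assms(1) g] is_rep_carrier[OF assms(2) g] d by (auto simp: n_def)
    have "Q * \<rho> g = Q * \<rho> g * (P * Q)" using c P by simp
    also have "\<dots> = Q * (\<rho> g * P) * Q" using c P(1,2) by (simp add: assoc_mult_mat[of _ n n _ n _ n])
    also have "\<dots> = Q * (P * \<pi> g) * Q" using tw g by simp
    also have "\<dots> = Q * P * \<pi> g * Q" using c P(1,2) by (simp add: assoc_mult_mat[of _ n n _ n _ n])
    also have "\<dots> = \<pi> g * Q" using c P by simp
    finally show "Q * \<rho> g = \<pi> g * Q" .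
  qed (auto simp: n_def d)
qed

lemma irreducible_repD:
  assumes "irreducible_rep G \<pi>"
  shows "is_rep G \<pi>" "rep_dim G \<pi> > 0"
  using assms by (auto simp: irreducible_rep_def)

text \<open>
  Schur's lemma. An intertwiner out of an irreducible representation is zero or injective, because
  its kernel is invariant.
\<close>

lemma schur_kernel:
  assumes \<pi>: "irreducible_rep G \<pi>" and n: "rep_dim G \<pi> = n" and X: "X \<in> carrier_mat m n"
    and \<rho>: "\<And>g. g \<in> carrier G \<Longrightarrow> \<rho> g \<in> carrier_mat m m"
    and tw: "\<And>g. g \<in> carrier G \<Longrightarrow> X * \<pi> g = \<rho> g * X"
    and nz: "X \<noteq> 0\<^sub>m m n" and x: "x \<in> carrier_vec n" "X *\<^sub>v x = 0\<^sub>v m"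
  shows "x = 0\<^sub>v n"
proof -
  define U where "U = {x \<in> carrier_vec n. X *\<^sub>v x = 0\<^sub>v m}"
  have c: "\<pi> g \<in> carrier_mat n n" if "g \<in> carrier G" for g
    using is_rep_carrier[OF irreducible_repD(1)[OF \<pi>] that] n by simp
  have X0: "X *\<^sub>v 0\<^sub>v n = 0\<^sub>v m"
    using X by (intro eq_vecI) auto
  have "VectorSpace.subspace class_ring U (module_vec TYPE(complex) n)"
    unfolding subspace_vec_iff U_def
    using X X0 by (auto simp: mult_add_distrib_mat_vec[OF X] mult_mat_vec[OF X])
  moreover have "\<pi> g *\<^sub>v u \<in> U" if g: "g \<in> carrier G" and u: "u \<in> U" for g u
  proof -
    have "X *\<^sub>v (\<pi> g *\<^sub>v u) = X * \<pi> g *\<^sub>v u"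
      using X c[OF g] u by (simp add: U_def assoc_mult_mat_vec[of _ m n _ n])
    also have "\<dots> = \<rho> g *\<^sub>v (X *\<^sub>v u)"
      unfolding tw[OF g] using X \<rho>[OF g] u by (simp add: U_def assoc_mult_mat_vec[of _ m m _ n])
    also have "\<dots> = 0\<^sub>v m" using u \<rho>[OF g] by (auto simp: U_def intro!: eq_vecI)
    finally show ?thesis using c[OF g] u by (simp add: U_def)
  qed
  ultimately have "U = {0\<^sub>v n} \<or> U = carrier_vec n"
    using \<pi> n unfolding irreducible_rep_def by blast
  moreover have "U \<noteq> carrier_vec n"
  proof
    assume all: "U = carrier_vec n"
    have "X $$ (i, j) = 0" if "i < m" "j < n" for i j
    proof -
      have "unit_vec n j \<in> U" using all by simp
      then have "col X j = 0\<^sub>v m" using mult_unit_vec[OF X that(2)] by (simp add: U_def)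
      then show ?thesis using that X by (metis carrier_matD index_col index_zero_vec(1))
    qed
    then have "X = 0\<^sub>m m n" using X by (intro eq_matI) auto
    then show False using nz by simp
  qed
  ultimately show ?thesis using x by (auto simp: U_def)
qed

text \<open>
  If the target is irreducible too, the image, being invariant, is everything. The coordinate
  vectors then have preimages, which make up the columns of an inverse.
\<close>

lemma schur_iso:
  assumes "group G" and \<pi>: "irreducible_rep G \<pi>" and \<rho>: "irreducible_rep G \<rho>"
    and n: "rep_dim G \<pi> = n" and m: "rep_dim G \<rho> = m" and X: "X \<in> carrier_mat m n"
    and tw: "\<And>g. g \<in> carrier G \<Longrightarrow> X * \<pi> g = \<rho> g * X"
    and nz: "X \<noteq> 0\<^sub>m m n"
  shows "rep_iso G \<pi> \<rho>"
proof -
  have c: "\<pi> g \<in> carrier_mat n n" "\<rho> g \<in> carrier_mat m m" if "g \<in> carrier G" for g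
    using is_rep_carrier[OF irreducible_repD(1)[OF \<pi>] that]
      is_rep_carrier[OF irreducible_repD(1)[OF \<rho>] that] n m by auto
  have inj: "x = 0\<^sub>v n" if "x \<in> carrier_vec n" "X *\<^sub>v x = 0\<^sub>v m" for x
    by (rule schur_kernel[OF \<pi> n X c(2) tw nz that])
  define W where "W = {X *\<^sub>v x | x. x \<in> carrier_vec n}"
  have WI: "X *\<^sub>v x \<in> W" if "x \<in> carrier_vec n" for x using that by (auto simp: W_def)
  have "VectorSpace.subspace class_ring W (module_vec TYPE(complex) m)"
    unfolding subspace_vec_iff
  proof (intro conjI ballI allI)
    show "W \<subseteq> carrier_vec m" using X by (auto simp: W_def)
    have "X *\<^sub>v 0\<^sub>v n = 0\<^sub>v m" using X by (intro eq_vecI) auto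
    then show "0\<^sub>v m \<in> W" using WI[of "0\<^sub>v n"] by simp
  next
    fix u v assume "u \<in> W" "v \<in> W"
    then obtain x y where "x \<in> carrier_vec n" "y \<in> carrier_vec n" "u = X *\<^sub>v x" "v = X *\<^sub>v y"
      by (auto simp: W_def)
    then show "u + v \<in> W"
      using WI[of "x + y"] X by (simp add: mult_add_distrib_mat_vec[OF X])
  next
    fix a u assume "u \<in> W"
    then obtain x where "x \<in> carrier_vec n" "u = X *\<^sub>v x" by (auto simp: W_def)
    then show "a \<cdot>\<^sub>v u \<in> W"
      using WI[of "a \<cdot>\<^sub>v x"] by (simp add: mult_mat_vec[OF X])
  qed
  moreover have "\<rho> g *\<^sub>v u \<in> W" if g: "g \<in> carrier G" and u: "u \<in> W" for g u
  proof -
    obtain x where x: "x \<in> carrier_vec n" "u = X *\<^sub>v x" using u by (auto simp: W_def)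
    have "\<rho> g *\<^sub>v u = \<rho> g * X *\<^sub>v x"
      using c(2)[OF g] X x by (simp add: assoc_mult_mat_vec[of _ m m _ n])
    also have "\<dots> = X *\<^sub>v (\<pi> g *\<^sub>v x)"
      unfolding tw[OF g, symmetric] using c(1)[OF g] X x by (simp add: assoc_mult_mat_vec[of _ m n _ n])
    finally show ?thesis using WI[of "\<pi> g *\<^sub>v x"] c(1)[OF g] x by simp
  qed
  ultimately have "W = {0\<^sub>v m} \<or> W = carrier_vec m"
    using \<rho> m unfolding irreducible_rep_def by blast
  moreover have "W \<noteq> {0\<^sub>v m}"
  proof
    assume "W = {0\<^sub>v m}"
    then have "X *\<^sub>v unit_vec n 0 = 0\<^sub>v m" using WI[of "unit_vec n 0"] by simp
    then have "unit_vec n 0 = (0\<^sub>v n :: complex vec)" using inj[of "unit_vec n 0"] by simp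
    moreover have "n > 0" using irreducible_repD(2)[OF \<pi>] n by simp
    ultimately show False by simp
  qed
  ultimately have W: "W = carrier_vec m" by simp
  have "\<exists>y. y \<in> carrier_vec n \<and> X *\<^sub>v y = unit_vec m j" for j
  proof -
    have "unit_vec m j \<in> W" using W by simp
    then show ?thesis by (auto simp: W_def)
  qed
  then obtain y where y: "\<And>j. y j \<in> carrier_vec n" "\<And>j. X *\<^sub>v y j = unit_vec m j" by metis
  define Y where "Y = mat n m (\<lambda>(i, j). y j $ i)"
  have Y: "Y \<in> carrier_mat n m" by (simp add: Y_def)
  have colY: "col Y j = y j" if "j < m" for j
    using y(1)[of j] that by (auto simp: Y_def)
  have XY: "X * Y = 1\<^sub>m m"
  proof (rule mat_col_eqI)
    fix j assume "j < dim_col (1\<^sub>m m :: complex mat)"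
    then have j: "j < m" by simp
    then show "col (X * Y) j = col (1\<^sub>m m) j"
      using col_mult2[OF X Y j] colY[OF j] y(2)[of j] by simp
  qed (use X Y in auto)
  have YX: "Y * X = 1\<^sub>m n"
  proof (rule mat_col_eqI)
    fix j assume "j < dim_col (1\<^sub>m n :: complex mat)"
    then have j: "j < n" by simp
    have v: "Y *\<^sub>v col X j \<in> carrier_vec n" "col X j \<in> carrier_vec m" using Y X j by auto
    have "X *\<^sub>v (Y *\<^sub>v col X j) = X * Y *\<^sub>v col X j"
      using X Y v by (simp add: assoc_mult_mat_vec[of _ m n _ m])
    also have "\<dots> = X *\<^sub>v unit_vec n j"
      unfolding XY mult_unit_vec[OF X j] using v by simp
    finally have "X *\<^sub>v (Y *\<^sub>v col X j - unit_vec n j) = 0\<^sub>v m"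
      using X v by (simp add: mult_minus_distrib_mat_vec[of _ m n])
    then have "Y *\<^sub>v col X j - unit_vec n j = 0\<^sub>v n" using v by (intro inj) auto
    then have "Y *\<^sub>v col X j = unit_vec n j"
      using v(1) Y by (simp add: vec_eq_iff)
    then show "col (Y * X) j = col (1\<^sub>m n) j"
      using col_mult2[OF Y X j] j by simp
  qed (use X Y in auto)
  have "m = n" by (rule two_sided_inverse_dim[OF X Y XY YX])
  then show ?thesis
    using rep_isoI[OF n, of \<rho> X Y] m X Y XY YX tw by simp
qed

text \<open>Subtracting an eigenvalue leaves an intertwiner with a kernel.\<close>

lemma schur_scalar:
  assumes \<pi>: "irreducible_rep G \<pi>" and n: "rep_dim G \<pi> = n" and X: "X \<in> carrier_mat n n"
    and tw: "\<And>g. g \<in> carrier G \<Longrightarrow> X * \<pi> g = \<pi> g * X"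
  obtains c where "X = c \<cdot>\<^sub>m 1\<^sub>m n"
proof -
  have "n > 0" using irreducible_repD(2)[OF \<pi>] n by simp
  then obtain c v where v: "v \<in> carrier_vec n" "v \<noteq> 0\<^sub>v n" "X *\<^sub>v v = c \<cdot>\<^sub>v v"
    using spectrum_non_empty[OF X] X by (auto simp: spectrum_def eigenvalue_def eigenvector_def)
  define Y where "Y = X - c \<cdot>\<^sub>m 1\<^sub>m n"
  have Y: "Y \<in> carrier_mat n n" using X by (auto simp: Y_def)
  have \<pi>c: "\<pi> g \<in> carrier_mat n n" if "g \<in> carrier G" for g
    using is_rep_carrier[OF irreducible_repD(1)[OF \<pi>] that] n by simp
  have Ytw: "Y * \<pi> g = \<pi> g * Y" if g: "g \<in> carrier G" for g
    unfolding Y_def using tw[OF g] X \<pi>c[OF g]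
    by (simp add: minus_mult_distrib_mat[of _ n n _ _ n] mult_minus_distrib_mat[of _ n n _ n]
        mult_smult_assoc_mat[of _ n n _ n] mult_smult_distrib[of _ n n _ n])
  have Yv: "Y *\<^sub>v v = 0\<^sub>v n"
  proof -
    have "Y *\<^sub>v v = X *\<^sub>v v - (c \<cdot>\<^sub>m 1\<^sub>m n) *\<^sub>v v"
      unfolding Y_def by (rule minus_mult_distrib_mat_vec[OF X _ v(1)]) simp
    also have "(c \<cdot>\<^sub>m 1\<^sub>m n) *\<^sub>v v = c \<cdot>\<^sub>v v"
      using v(1) by (intro eq_vecI) auto
    finally show ?thesis using v by simp
  qed
  have "Y = 0\<^sub>m n n"
    using schur_kernel[OF \<pi> n Y \<pi>c Ytw _ v(1) Yv] v(2) by blast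
  have "X = c \<cdot>\<^sub>m 1\<^sub>m n"
  proof (rule eq_matI)
    fix i j assume ij: "i < dim_row (c \<cdot>\<^sub>m 1\<^sub>m n)" "j < dim_col (c \<cdot>\<^sub>m 1\<^sub>m n)"
    then have "Y $$ (i, j) = 0" using \<open>Y = 0\<^sub>m n n\<close> by simp
    then show "X $$ (i, j) = (c \<cdot>\<^sub>m 1\<^sub>m n) $$ (i, j)" using ij X by (simp add: Y_def)
  qed (use X in auto)
  then show ?thesis by (rule that)
qed

text \<open>
  For each elementary matrix \<open>E\<close> the average \<open>\<Sum>g. \<rho> g * E * \<pi> (inv g)\<close> is an intertwiner, by
  translating the variable of summation. Its entries are the sums in the orthogonality relations.
\<close>

lemma averaged_intertwiner:
  fixes G (structure)
  assumes "group G" and \<pi>: "is_rep G \<pi>" and \<rho>: "is_rep G \<rho>"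
    and n: "rep_dim G \<pi> = n" and m: "rep_dim G \<rho> = m" and ij: "i < m" "j < n"
    and h: "h \<in> carrier G"
  defines "X \<equiv> mat m n (\<lambda>(a, b). \<Sum>g\<in>carrier G. \<rho> g $$ (a, i) * \<pi> (inv g) $$ (j, b))"
  shows "X * \<pi> h = \<rho> h * X"
proof -
  interpret group G by fact
  have c: "\<pi> g \<in> carrier_mat n n" "\<rho> g \<in> carrier_mat m m" if "g \<in> carrier G" for g
    using is_rep_carrier[OF \<pi> that] is_rep_carrier[OF \<rho> that] n m by auto
  have X: "X \<in> carrier_mat m n" by (simp add: X_def)
  show ?thesis
  proof (rule eq_matI)
    fix a b assume "a < dim_row (\<rho> h * X)" "b < dim_col (\<rho> h * X)"
    then have ab: "a < m" "b < n" using c[OF h] X by auto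
    have prod\<pi>: "\<pi> (inv g \<otimes> h) $$ (j, b) = (\<Sum>k<n. \<pi> (inv g) $$ (j, k) * \<pi> h $$ (k, b))"
      if g: "g \<in> carrier G" for g
      using rep_mult[OF \<pi>, of "inv g" h] index_mult_mat_sum[OF c(1)[of "inv g"] c(1)[OF h] ij(2) ab(2)] g h by simp
    have prod\<rho>: "\<rho> (h \<otimes> g) $$ (a, i) = (\<Sum>k<m. \<rho> h $$ (a, k) * \<rho> g $$ (k, i))"
      if g: "g \<in> carrier G" for g
      using rep_mult[OF \<rho>, of h g] index_mult_mat_sum[OF c(2)[OF h] c(2)[OF g] ab(1) ij(1)] g h by simp
    have bij: "bij_betw (\<lambda>g. h \<otimes> g) (carrier G) (carrier G)"
      by (rule bij_betw_byWitness[of _ "\<lambda>g. inv h \<otimes> g"]) (use h in \<open>auto simp: m_assoc[symmetric]\<close>)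
    have "(X * \<pi> h) $$ (a, b) = (\<Sum>k<n. (\<Sum>g\<in>carrier G. \<rho> g $$ (a, i) * \<pi> (inv g) $$ (j, k)) * \<pi> h $$ (k, b))"
      using index_mult_mat_sum[OF X c(1)[OF h] ab] ab by (simp add: X_def)
    also have "\<dots> = (\<Sum>g\<in>carrier G. \<rho> g $$ (a, i) * \<pi> (inv g \<otimes> h) $$ (j, b))"
      unfolding sum_distrib_right
      by (subst sum.swap) (intro sum.cong refl, simp add: prod\<pi> sum_distrib_left mult.assoc)
    also have "\<dots> = (\<Sum>g\<in>carrier G. \<rho> (h \<otimes> g) $$ (a, i) * \<pi> (inv (h \<otimes> g) \<otimes> h) $$ (j, b))"
      by (rule sum.reindex_bij_betw[OF bij, symmetric])
    also have "\<dots> = (\<Sum>g\<in>carrier G. \<rho> (h \<otimes> g) $$ (a, i) * \<pi> (inv g) $$ (j, b))"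
      using h by (intro sum.cong refl) (simp add: inv_mult_group m_assoc)
    also have "\<dots> = (\<Sum>k<m. \<rho> h $$ (a, k) * (\<Sum>g\<in>carrier G. \<rho> g $$ (k, i) * \<pi> (inv g) $$ (j, b)))"
      unfolding sum_distrib_left
      by (subst sum.swap) (intro sum.cong refl, simp add: prod\<rho> sum_distrib_right mult.assoc)
    also have "\<dots> = (\<rho> h * X) $$ (a, b)"
      using index_mult_mat_sum[OF c(2)[OF h] X ab] ab by (simp add: X_def)
    finally show "(X * \<pi> h) $$ (a, b) = (\<rho> h * X) $$ (a, b)" .
  qed (use c[OF h] X in auto)
qed

lemma schur_orthogonality_distinct:
  fixes G (structure)
  assumes "group G" and \<pi>: "irreducible_rep G \<pi>" and \<rho>: "irreducible_rep G \<rho>"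
    and "\<not> rep_iso G \<pi> \<rho>"
    and ij: "a < rep_dim G \<rho>" "i < rep_dim G \<rho>" "j < rep_dim G \<pi>" "b < rep_dim G \<pi>"
  shows "(\<Sum>g\<in>carrier G. \<rho> g $$ (a, i) * \<pi> (inv g) $$ (j, b)) = 0"
proof -
  let ?X = "mat (rep_dim G \<rho>) (rep_dim G \<pi>) (\<lambda>(a, b). \<Sum>g\<in>carrier G. \<rho> g $$ (a, i) * \<pi> (inv g) $$ (j, b))"
  have "?X = 0\<^sub>m (rep_dim G \<rho>) (rep_dim G \<pi>)"
    using schur_iso[OF assms(1) \<pi> \<rho> refl refl, of ?X] assms(4)
      averaged_intertwiner[OF assms(1) irreducible_repD(1)[OF \<pi>] irreducible_repD(1)[OF \<rho>] refl refl ij(2,3)]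
    by auto
  then have "?X $$ (a, b) = 0" using ij by simp
  then show ?thesis using ij by simp
qed

text \<open>
  Here the averaged intertwiner is a scalar, and its trace determines which: moving a factor around
  turns each summand into the entry \<open>(j, i)\<close> of the identity.
\<close>

lemma schur_orthogonality_same:
  fixes G (structure)
  assumes "group G" and \<pi>: "irreducible_rep G \<pi>" and n: "rep_dim G \<pi> = n"
    and ij: "a < n" "i < n" "j < n" "b < n"
  shows "(\<Sum>g\<in>carrier G. \<pi> g $$ (a, i) * \<pi> (inv g) $$ (j, b)) =
    (if a = b \<and> i = j then of_nat (card (carrier G)) / of_nat n else 0)"
proof -
  interpret group G by fact
  define X where "X = mat n n (\<lambda>(a, b). \<Sum>g\<in>carrier G. \<pi> g $$ (a, i) * \<pi> (inv g) $$ (j, b))"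
  note rep = irreducible_repD(1)[OF \<pi>]
  have c: "\<pi> g \<in> carrier_mat n n" if "g \<in> carrier G" for g
    using is_rep_carrier[OF rep that] n by simp
  have X: "X \<in> carrier_mat n n" by (simp add: X_def)
  have tw: "X * \<pi> h = \<pi> h * X" if "h \<in> carrier G" for h
    using averaged_intertwiner[OF assms(1) rep rep n n ij(2,3) that] by (simp add: X_def)
  obtain z where z: "X = z \<cdot>\<^sub>m 1\<^sub>m n"
    by (rule schur_scalar[OF \<pi> n X tw])
  have "of_nat n * z = (\<Sum>a<n. X $$ (a, a))"
    unfolding z by simp
  also have "\<dots> = (\<Sum>g\<in>carrier G. \<Sum>a<n. \<pi> (inv g) $$ (j, a) * \<pi> g $$ (a, i))"
    by (subst sum.swap) (simp add: X_def mult.commute)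
  also have "\<dots> = (\<Sum>g\<in>carrier G. if i = j then 1 else 0)"
  proof (intro sum.cong refl)
    fix g assume g: "g \<in> carrier G"
    show "(\<Sum>a<n. \<pi> (inv g) $$ (j, a) * \<pi> g $$ (a, i)) = (if i = j then 1 else 0)"
      using index_mult_mat_sum[OF c[of "inv g"] c[OF g] ij(3,2)] rep_inv(1)[OF assms(1) rep g] n g ij by auto
  qed
  finally have "of_nat n * z = (if i = j then of_nat (card (carrier G)) else 0)" by simp
  moreover have "n \<noteq> 0" using ij by simp
  ultimately have zv: "z = (if i = j then of_nat (card (carrier G)) / of_nat n else 0)"
    by (auto simp: field_simps split: if_splits)
  have "X $$ (a, b) = (if a = b then z else 0)" unfolding z using ij by simp
  then show ?thesis using zv ij by (simp add: X_def)
qed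

lemma representatives_inequivalent:
  assumes "irr_representatives G \<theta> R" "\<pi> \<in> R" "\<rho> \<in> R" "rep_iso G \<pi> \<rho>"
  shows "\<pi> = \<rho>"
  using assms rep_iso_refl[OF irreducible_repD(1)] unfolding irr_representatives_def by blast

text \<open>
  One matrix coefficient for each representative: by the orthogonality relations these are linearly
  independent functions on \<^term>\<open>G\<close>.
\<close>

lemma finite_representatives:
  fixes G (structure)
  assumes "group G" "finite (carrier G)" and R: "irr_representatives G \<theta> R"
  shows "finite R"
proof (rule ccontr)
  assume "infinite R"
  then obtain S where S: "S \<subseteq> R" "finite S" "card S = Suc (card (carrier G))"
    using infinite_arbitrarily_large by blast
  have irr: "irreducible_rep G \<pi>" if "\<pi> \<in> S" for \<pi>
    using that S R by (auto simp: irr_representatives_def)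
  interpret group G by fact
  have N: "card (carrier G) \<noteq> 0" using assms(2) by (auto simp: card_eq_0_iff)
  have "card S \<le> card (carrier G)"
  proof (rule card_le_of_biorthogonal[OF S(2) assms(2)])
    fix \<pi> \<rho> assume \<pi>\<rho>: "\<pi> \<in> S" "\<rho> \<in> S"
    show "(\<Sum>g\<in>carrier G. \<pi> g $$ (0, 0) * (of_nat (rep_dim G \<rho>) / of_nat (card (carrier G)) * \<rho> (inv g) $$ (0, 0)))
        = (if \<pi> = \<rho> then 1 else 0)" (is "?l = _")
    proof -
      have "?l = of_nat (rep_dim G \<rho>) / of_nat (card (carrier G)) *
          (\<Sum>g\<in>carrier G. \<pi> g $$ (0, 0) * \<rho> (inv g) $$ (0, 0))"
        by (simp add: sum_distrib_left mult.left_commute)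
      also have "\<dots> = (if \<pi> = \<rho> then 1 else 0)"
      proof (cases "\<pi> = \<rho>")
        case True
        then show ?thesis
          using schur_orthogonality_same[OF assms(1) irr[OF \<pi>\<rho>(1)] refl, of 0 0 0 0]
            irreducible_repD(2)[OF irr[OF \<pi>\<rho>(1)]] N by simp
      next
        case False
        then have "\<not> rep_iso G \<rho> \<pi>"
          using representatives_inequivalent[OF R, of \<rho> \<pi>] \<pi>\<rho> S by blast
        then show ?thesis
          using schur_orthogonality_distinct[OF assms(1) irr[OF \<pi>\<rho>(2)] irr[OF \<pi>\<rho>(1)], of 0 0 0 0]
            irreducible_repD(2)[OF irr[OF \<pi>\<rho>(1)]] irreducible_repD(2)[OF irr[OF \<pi>\<rho>(2)]] False by simp
      qed
      finally show ?thesis .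
    qed
  qed
  then show False using S by simp
qed

text \<open>
  The function is given by Fourier inversion,
  \<open>f g = \<Sum>\<pi>. (dim \<pi> / |G|) \<cdot> tr (A \<pi> * \<pi> (inv g))\<close>, and the orthogonality relations pick out one
  entry of one coefficient.
\<close>

lemma fourier_surjective:
  fixes G (structure)
  assumes "group G" "finite (carrier G)" and R: "irr_representatives G \<theta> R"
    and A: "\<And>\<pi>. \<pi> \<in> R \<Longrightarrow> A \<pi> \<in> carrier_mat (rep_dim G \<pi>) (rep_dim G \<pi>)"
  obtains f where "f \<in> carrier G \<rightarrow>\<^sub>E UNIV" "\<And>\<pi>. \<pi> \<in> R \<Longrightarrow> fourier G f \<pi> = A \<pi>"
proof -
  interpret group G by fact
  have finR: "finite R" by (rule finite_representatives[OF assms(1-3)])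
  have irr: "irreducible_rep G \<pi>" if "\<pi> \<in> R" for \<pi>
    using that R by (auto simp: irr_representatives_def)
  define N where "N = card (carrier G)"
  have N: "N \<noteq> 0" using assms(2) by (auto simp: card_eq_0_iff N_def)
  define w where "w \<pi> = (of_nat (rep_dim G \<pi>) / of_nat N :: complex)" for \<pi>
  define f where "f = (\<lambda>g\<in>carrier G. \<Sum>\<pi>\<in>R. \<Sum>b<rep_dim G \<pi>. \<Sum>j<rep_dim G \<pi>.
    w \<pi> * A \<pi> $$ (b, j) * \<pi> (inv g) $$ (j, b))"
  have "fourier G f \<rho> = A \<rho>" if \<rho>: "\<rho> \<in> R" for \<rho>
  proof (rule eq_matI)
    fix a i assume "a < dim_row (A \<rho>)" "i < dim_col (A \<rho>)"
    then have ai: "a < rep_dim G \<rho>" "i < rep_dim G \<rho>" using A[OF \<rho>] by auto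
    have orth: "(\<Sum>g\<in>carrier G. \<rho> g $$ (a, i) * \<pi> (inv g) $$ (j, b)) =
        (if \<pi> = \<rho> then if b = a then if j = i then 1 / w \<rho> else 0 else 0 else 0)"
      if \<pi>: "\<pi> \<in> R" and jb: "j < rep_dim G \<pi>" "b < rep_dim G \<pi>" for \<pi> j b
    proof (cases "\<pi> = \<rho>")
      case True
      then show ?thesis
        using schur_orthogonality_same[OF assms(1) irr[OF \<rho>] refl ai, of j b] jb
        by (simp add: w_def N_def)
    next
      case False
      then have "\<not> rep_iso G \<pi> \<rho>" using representatives_inequivalent[OF R \<pi> \<rho>] by blast
      then show ?thesis
        using schur_orthogonality_distinct[OF assms(1) irr[OF \<pi>] irr[OF \<rho>] _ ai jb] False by simp
    qed
    have w0: "w \<rho> \<noteq> 0" using ai N by (simp add: w_def)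
    have "fourier G f \<rho> $$ (a, i) = (\<Sum>g\<in>carrier G. \<Sum>\<pi>\<in>R. \<Sum>b<rep_dim G \<pi>. \<Sum>j<rep_dim G \<pi>.
        w \<pi> * A \<pi> $$ (b, j) * (\<rho> g $$ (a, i) * \<pi> (inv g) $$ (j, b)))"
      using ai by (simp add: fourier_index f_def sum_distrib_left sum_distrib_right mult_ac)
    also have "\<dots> = (\<Sum>\<pi>\<in>R. \<Sum>b<rep_dim G \<pi>. \<Sum>j<rep_dim G \<pi>. \<Sum>g\<in>carrier G.
        w \<pi> * A \<pi> $$ (b, j) * (\<rho> g $$ (a, i) * \<pi> (inv g) $$ (j, b)))"
      by (subst sum.swap, rule sum.cong[OF refl], subst sum.swap, rule sum.cong[OF refl], rule sum.swap)
    also have "\<dots> = (\<Sum>\<pi>\<in>R. \<Sum>b<rep_dim G \<pi>. \<Sum>j<rep_dim G \<pi>. if \<pi> = \<rho> then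
        if b = a then if j = i then A \<pi> $$ (b, j) else 0 else 0 else 0)"
      using w0 by (intro sum.cong refl) (auto simp: sum_distrib_left[symmetric] orth)
    also have "\<dots> = (\<Sum>\<pi>\<in>R. if \<pi> = \<rho> then A \<rho> $$ (a, i) else 0)"
    proof (intro sum.cong refl)
      fix \<pi> assume "\<pi> \<in> R"
      have "(\<Sum>b<rep_dim G \<rho>. \<Sum>j<rep_dim G \<rho>. if b = a then if j = i then A \<rho> $$ (b, j) else 0 else 0) =
          (\<Sum>b<rep_dim G \<rho>. if b = a then A \<rho> $$ (b, i) else 0)"
        using ai by (intro sum.cong refl) auto
      then show "(\<Sum>b<rep_dim G \<pi>. \<Sum>j<rep_dim G \<pi>. if \<pi> = \<rho> then
          if b = a then if j = i then A \<pi> $$ (b, j) else 0 else 0 else 0) = (if \<pi> = \<rho> then A \<rho> $$ (a, i) else 0)"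
        using ai by auto
    qed
    also have "\<dots> = A \<rho> $$ (a, i)" using finR \<rho> by simp
    finally show "fourier G f \<rho> $$ (a, i) = A \<rho> $$ (a, i)" .
  qed (use A[OF \<rho>] in \<open>auto simp: fourier_def\<close>)
  moreover have "f \<in> carrier G \<rightarrow>\<^sub>E UNIV" by (simp add: f_def)
  ultimately show ?thesis using that by blast
qed

text \<open>The transform is natural in the representation, as the action of the group algebra is.\<close>

lemma fourier_intertwine:
  assumes \<pi>: "is_rep G \<pi>" and \<rho>: "is_rep G \<rho>" and P: "P \<in> carrier_mat (rep_dim G \<rho>) (rep_dim G \<pi>)"
    and tw: "\<And>g. g \<in> carrier G \<Longrightarrow> P * \<pi> g = \<rho> g * P"
  shows "P * fourier G f \<pi> = fourier G f \<rho> * P"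
proof -
  define n where "n = rep_dim G \<pi>"
  define m where "m = rep_dim G \<rho>"
  have P': "P \<in> carrier_mat m n" using P by (simp add: n_def m_def)
  have c: "\<pi> g \<in> carrier_mat n n" "\<rho> g \<in> carrier_mat m m" if "g \<in> carrier G" for g
    using is_rep_carrier[OF \<pi> that] is_rep_carrier[OF \<rho> that] by (auto simp: n_def m_def)
  have F: "fourier G f \<pi> \<in> carrier_mat n n" "fourier G f \<rho> \<in> carrier_mat m m"
    by (auto simp: n_def m_def)
  show ?thesis
  proof (rule eq_matI)
    fix i j assume "i < dim_row (fourier G f \<rho> * P)" "j < dim_col (fourier G f \<rho> * P)"
    then have ij: "i < m" "j < n" using F P' by auto
    have "(P * fourier G f \<pi>) $$ (i, j) = (\<Sum>k<n. P $$ (i, k) * (\<Sum>g\<in>carrier G. f g * \<pi> g $$ (k, j)))"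
      using index_mult_mat_sum[OF P' F(1) ij] ij by (simp add: fourier_index n_def)
    also have "\<dots> = (\<Sum>g\<in>carrier G. f g * (P * \<pi> g) $$ (i, j))"
      unfolding sum_distrib_left
      by (subst sum.swap, rule sum.cong[OF refl], subst index_mult_mat_sum[OF P' c(1) ij])
        (auto simp: sum_distrib_left mult.left_commute)
    also have "\<dots> = (\<Sum>g\<in>carrier G. f g * (\<rho> g * P) $$ (i, j))"
      by (simp add: tw)
    also have "\<dots> = (\<Sum>k<m. (\<Sum>g\<in>carrier G. f g * \<rho> g $$ (i, k)) * P $$ (k, j))"
      unfolding sum_distrib_right
      by (subst sum.swap, rule sum.cong[OF refl], subst index_mult_mat_sum[OF c(2) P' ij])
        (auto simp: sum_distrib_left mult.assoc)
    also have "\<dots> = (fourier G f \<rho> * P) $$ (i, j)"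
      using index_mult_mat_sum[OF F(2) P' ij] ij by (simp add: fourier_index m_def)
    finally show "(P * fourier G f \<pi>) $$ (i, j) = (fourier G f \<rho> * P) $$ (i, j)" .
  qed (use F P' in auto)
qed

lemma fourier_injective:
  assumes "group G" "finite (carrier G)" and R: "irr_representatives G \<theta> R"
    and f: "f \<in> carrier G \<rightarrow>\<^sub>E UNIV" "f' \<in> carrier G \<rightarrow>\<^sub>E UNIV"
    and eq: "\<And>\<pi>. \<pi> \<in> R \<Longrightarrow> fourier G f \<pi> = fourier G f' \<pi>"
  shows "f = f'"
proof (rule PiE_ext[OF f])
  fix x assume x: "x \<in> carrier G"
  define d where "d g = f g - f' g" for g
  have zeroR: "fourier G d \<pi> = 0\<^sub>m (rep_dim G \<pi>) (rep_dim G \<pi>)" if "\<pi> \<in> R" for \<pi>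
  proof (rule eq_matI)
    fix i j assume "i < dim_row (0\<^sub>m (rep_dim G \<pi>) (rep_dim G \<pi>) :: complex mat)"
      "j < dim_col (0\<^sub>m (rep_dim G \<pi>) (rep_dim G \<pi>) :: complex mat)"
    then have ij: "i < rep_dim G \<pi>" "j < rep_dim G \<pi>" by auto
    have "fourier G f \<pi> $$ (i, j) = fourier G f' \<pi> $$ (i, j)" using eq[OF that] by simp
    then show "fourier G d \<pi> $$ (i, j) = 0\<^sub>m (rep_dim G \<pi>) (rep_dim G \<pi>) $$ (i, j)"
      using ij by (simp add: fourier_index d_def left_diff_distrib sum_subtractf)
  qed (auto simp: fourier_def)
  have "d x = 0"
  proof (rule fourier_eq_zero[OF assms(1,2) _ x])
    fix \<rho> assume \<rho>: "irreducible_rep G \<rho>"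
    define n where "n = rep_dim G \<rho>"
    obtain \<pi> where \<pi>: "\<pi> \<in> R" "rep_iso G \<rho> \<pi>" using R \<rho> by (auto simp: irr_representatives_def)
    have rep\<pi>: "is_rep G \<pi>" using \<pi>(1) R by (auto simp: irr_representatives_def irreducible_rep_def)
    obtain P Q where P: "P \<in> carrier_mat n n" "Q \<in> carrier_mat n n" "Q * P = 1\<^sub>m n"
      and tw: "\<forall>g\<in>carrier G. P * \<rho> g = \<pi> g * P" and d: "rep_dim G \<pi> = n"
      by (rule rep_isoE[OF \<pi>(2)]) (auto simp: n_def)
    have F: "fourier G d \<rho> \<in> carrier_mat n n" by (simp add: n_def)
    have "P * fourier G d \<rho> = fourier G d \<pi> * P"
      by (rule fourier_intertwine[OF irreducible_repD(1)[OF \<rho>] rep\<pi>]) (use P tw d in \<open>auto simp: n_def\<close>)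
    also have "\<dots> = 0\<^sub>m n n" using zeroR[OF \<pi>(1)] d P by simp
    finally have PF: "P * fourier G d \<rho> = 0\<^sub>m n n" .
    have "fourier G d \<rho> = Q * P * fourier G d \<rho>" using P F by simp
    also have "\<dots> = Q * (P * fourier G d \<rho>)" by (rule assoc_mult_mat[OF P(2,1) F])
    also have "\<dots> = 0\<^sub>m n n" unfolding PF using P by simp
    finally show "fourier G d \<rho> = 0\<^sub>m (rep_dim G \<rho>) (rep_dim G \<rho>)" by (simp add: n_def)
  qed
  then show "f x = f' x" by (simp add: d_def)
qed

section \<open>The indicator as the sign of an intertwiner\<close>

locale twisted_group = group G for G :: "('g, 'b) monoid_scheme" (structure) +
  fixes \<theta> :: "'g \<Rightarrow> 'g"
  assumes finite_carrier: "finite (carrier G)"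
    and theta_hom: "\<theta> \<in> hom G G"
    and theta_theta: "g \<in> carrier G \<Longrightarrow> \<theta> (\<theta> g) = g"
begin

lemma theta_closed [simp, intro]: "g \<in> carrier G \<Longrightarrow> \<theta> g \<in> carrier G"
  using theta_hom by (auto simp: hom_def)

lemma theta_mult: "g \<in> carrier G \<Longrightarrow> h \<in> carrier G \<Longrightarrow> \<theta> (g \<otimes> h) = \<theta> g \<otimes> \<theta> h"
  using theta_hom by (auto simp: hom_def)

lemma theta_one: "\<theta> \<one> = \<one>"
proof -
  interpret t: group_hom G G \<theta>
    using theta_hom by unfold_locales
  show ?thesis by (rule t.hom_one)
qed

lemma theta_inv: "g \<in> carrier G \<Longrightarrow> \<theta> (inv g) = inv (\<theta> g)"
proof -
  interpret t: group_hom G G \<theta>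
    using theta_hom by unfold_locales
  show "g \<in> carrier G \<Longrightarrow> \<theta> (inv g) = inv (\<theta> g)" by (rule t.hom_inv)
qed

lemma twisted_dual_apply: "g \<in> carrier G \<Longrightarrow> twisted_dual G \<theta> \<pi> g = transpose_mat (\<pi> (inv (\<theta> g)))"
  by (simp add: twisted_dual_def dual_rep_def compose_def)

lemma twisted_dual_inv_theta:
  "g \<in> carrier G \<Longrightarrow> twisted_dual G \<theta> \<pi> (inv (\<theta> g)) = transpose_mat (\<pi> g)"
  by (simp add: twisted_dual_apply theta_inv theta_theta)

lemma twisted_dual_rep:
  assumes "is_rep G \<pi>"
  shows "is_rep G (twisted_dual G \<theta> \<pi>) \<and> rep_dim G (twisted_dual G \<theta> \<pi>) = rep_dim G \<pi>"
proof (rule is_repI[OF is_group])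
  fix g assume g: "g \<in> carrier G"
  show "twisted_dual G \<theta> \<pi> g \<in> carrier_mat (rep_dim G \<pi>) (rep_dim G \<pi>)"
    using is_rep_carrier[OF assms, of "inv (\<theta> g)"] g by (simp add: twisted_dual_apply)
next
  fix g h assume gh: "g \<in> carrier G" "h \<in> carrier G"
  have "\<pi> (inv (\<theta> (g \<otimes> h))) = \<pi> (inv (\<theta> h)) * \<pi> (inv (\<theta> g))"
    using gh rep_mult[OF assms, of "inv (\<theta> h)" "inv (\<theta> g)"] by (simp add: theta_mult inv_mult_group)
  then show "twisted_dual G \<theta> \<pi> (g \<otimes> h) = twisted_dual G \<theta> \<pi> g * twisted_dual G \<theta> \<pi> h"
    using gh transpose_mult[OF is_rep_carrier[OF assms, of "inv (\<theta> h)"] is_rep_carrier[OF assms, of "inv (\<theta> g)"]]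
    by (simp add: twisted_dual_apply)
next
  show "twisted_dual G \<theta> \<pi> \<one> = 1\<^sub>m (rep_dim G \<pi>)"
    using rep_one[OF is_group assms] by (simp add: twisted_dual_apply theta_one)
qed (simp add: twisted_dual_def)

text \<open>Transposing the intertwining relation at \<open>inv (\<theta> h)\<close> gives the relation at \<open>h\<close>.\<close>

lemma transpose_intertwiner:
  assumes rep: "is_rep G \<pi>" and n: "rep_dim G \<pi> = n" and M: "M \<in> carrier_mat n n"
    and tw: "\<And>g. g \<in> carrier G \<Longrightarrow> M * \<pi> g = twisted_dual G \<theta> \<pi> g * M"
    and h: "h \<in> carrier G"
  shows "transpose_mat M * \<pi> h = twisted_dual G \<theta> \<pi> h * transpose_mat M"
proof -
  have c: "\<pi> g \<in> carrier_mat n n" if "g \<in> carrier G" for g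
    using is_rep_carrier[OF rep that] n by simp
  let ?g = "inv (\<theta> h)"
  have g: "?g \<in> carrier G" using h by simp
  have "transpose_mat (M * \<pi> ?g) = transpose_mat (twisted_dual G \<theta> \<pi> ?g * M)"
    using tw[OF g] by simp
  also have "twisted_dual G \<theta> \<pi> ?g = transpose_mat (\<pi> h)"
    by (rule twisted_dual_inv_theta[OF h])
  finally have "transpose_mat (\<pi> ?g) * transpose_mat M = transpose_mat M * \<pi> h"
    using transpose_mult[OF M c[OF g]] transpose_mult[of "transpose_mat (\<pi> h)" n n M n] c[OF h] M by simp
  then show ?thesis by (simp add: twisted_dual_apply h)
qed

text \<open>The composite of one intertwiner with the inverse of another commutes with \<^term>\<open>\<pi>\<close>.\<close>

lemma intertwiner_unique:
  assumes \<pi>: "irreducible_rep G \<pi>" and n: "rep_dim G \<pi> = n"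
    and P: "P \<in> carrier_mat n n" "Q \<in> carrier_mat n n" "Q * P = 1\<^sub>m n" "P * Q = 1\<^sub>m n"
    and twP: "\<And>g. g \<in> carrier G \<Longrightarrow> P * \<pi> g = twisted_dual G \<theta> \<pi> g * P"
    and M: "M \<in> carrier_mat n n" and twM: "\<And>g. g \<in> carrier G \<Longrightarrow> M * \<pi> g = twisted_dual G \<theta> \<pi> g * M"
  obtains a where "M = a \<cdot>\<^sub>m P"
proof -
  note rep = irreducible_repD(1)[OF \<pi>]
  have c: "\<pi> g \<in> carrier_mat n n" "twisted_dual G \<theta> \<pi> g \<in> carrier_mat n n" if "g \<in> carrier G" for g
    using is_rep_carrier[OF rep that] is_rep_carrier[OF conjunct1[OF twisted_dual_rep[OF rep]] that]
      twisted_dual_rep[OF rep] n by auto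
  have QM: "Q * M \<in> carrier_mat n n" using P M by simp
  have tw: "Q * M * \<pi> g = \<pi> g * (Q * M)" if g: "g \<in> carrier G" for g
  proof -
    note c = c[OF g]
    let ?\<tau> = "twisted_dual G \<theta> \<pi> g"
    have "Q * ?\<tau> = Q * ?\<tau> * (P * Q)" using P c by simp
    also have "\<dots> = Q * (?\<tau> * P) * Q" using P(1,2) c by (simp add: assoc_mult_mat[of _ n n _ n _ n])
    also have "\<dots> = Q * P * \<pi> g * Q"
      using P(1,2) c twP[OF g, symmetric] by (simp add: assoc_mult_mat[of _ n n _ n _ n])
    also have "\<dots> = \<pi> g * Q" using P c by simp
    finally have Q\<tau>: "Q * ?\<tau> = \<pi> g * Q" .
    have "Q * M * \<pi> g = Q * (M * \<pi> g)" using P(2) M c by (simp add: assoc_mult_mat[of _ n n _ n _ n])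
    also have "\<dots> = Q * ?\<tau> * M"
      unfolding twM[OF g] using P(2) M c by (simp add: assoc_mult_mat[of _ n n _ n _ n])
    also have "\<dots> = \<pi> g * (Q * M)"
      unfolding Q\<tau> using P(2) M c by (simp add: assoc_mult_mat[of _ n n _ n _ n])
    finally show ?thesis .
  qed
  obtain a where a: "Q * M = a \<cdot>\<^sub>m 1\<^sub>m n"
    by (rule schur_scalar[OF \<pi> n QM tw])
  have "M = P * Q * M" using P M by simp
  also have "\<dots> = P * (Q * M)" using P(1,2) M by (rule assoc_mult_mat)
  also have "\<dots> = a \<cdot>\<^sub>m P" unfolding a using P(1) by (simp add: mult_smult_distrib[of _ n n _ n])
  finally show ?thesis by (rule that)
qed

end

lemma linear_functional_expansion:
  fixes f :: "complex vec \<Rightarrow> complex"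
  assumes add: "\<And>u v. u \<in> carrier_vec n \<Longrightarrow> v \<in> carrier_vec n \<Longrightarrow> f (u + v) = f u + f v"
    and smult: "\<And>c v. v \<in> carrier_vec n \<Longrightarrow> f (c \<cdot>\<^sub>v v) = c * f v"
    and v: "v \<in> carrier_vec n"
  shows "f v = (\<Sum>i<n. v $ i * f (unit_vec n i))"
proof -
  have "f (vec n (\<lambda>i. if i < k then v $ i else 0)) = (\<Sum>i<k. v $ i * f (unit_vec n i))" if "k \<le> n" for k
    using that
  proof (induction k)
    case 0
    have "vec n (\<lambda>i. 0) = (0 :: complex) \<cdot>\<^sub>v 0\<^sub>v n" by auto
    then show ?case using smult[of "0\<^sub>v n" 0] by simp
  next
    case (Suc k)
    have "vec n (\<lambda>i. if i < Suc k then v $ i else 0) =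
        vec n (\<lambda>i. if i < k then v $ i else 0) + v $ k \<cdot>\<^sub>v unit_vec n k"
      using Suc.prems by (intro eq_vecI) (auto simp: less_Suc_eq)
    then show ?case using Suc add smult by simp
  qed
  moreover have "vec n (\<lambda>i. if i < n then v $ i else 0) = v" using v by auto
  ultimately show ?thesis by force
qed

lemma bilinear_form_matrix:
  assumes B: "bilinear_form n B" and vw: "v \<in> carrier_vec n" "w \<in> carrier_vec n"
  shows "B v w = (\<Sum>i<n. \<Sum>j<n. v $ i * w $ j * B (unit_vec n i) (unit_vec n j))"
proof -
  have "B v w = (\<Sum>i<n. v $ i * B (unit_vec n i) w)"
    by (rule linear_functional_expansion[where f = "\<lambda>v. B v w"])
      (use B vw in \<open>auto simp: bilinear_form_def\<close>)
  also have "\<dots> = (\<Sum>i<n. v $ i * (\<Sum>j<n. w $ j * B (unit_vec n i) (unit_vec n j)))"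
  proof (intro sum.cong refl)
    fix i
    have "B (unit_vec n i) w = (\<Sum>j<n. w $ j * B (unit_vec n i) (unit_vec n j))"
      by (rule linear_functional_expansion[where f = "\<lambda>w. B (unit_vec n i) w"])
        (use B vw in \<open>auto simp: bilinear_form_def\<close>)
    then show "v $ i * B (unit_vec n i) w = v $ i * (\<Sum>j<n. w $ j * B (unit_vec n i) (unit_vec n j))"
      by simp
  qed
  finally show ?thesis by (simp add: sum_distrib_left mult.assoc)
qed

lemma bilinear_form_of_matrix:
  assumes P: "P \<in> carrier_mat n n"
  shows "bilinear_form n (\<lambda>v w. v \<bullet> (P *\<^sub>v w))"
  unfolding bilinear_form_def
  using P by (auto simp: add_scalar_prod_distrib[of _ n] mult_add_distrib_mat_vec[OF P]
      scalar_prod_add_distrib[of _ n] mult_mat_vec[OF P] smult_scalar_prod_distrib[of _ n])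

context twisted_group
begin

text \<open>
  Invariant forms and intertwiners are the same matrices: invariance of \<open>B\<close> under \<open>g\<close> is
  \<open>(\<pi> g)\<^sup>T * M = M * \<pi> (\<theta> (inv g))\<close> for the matrix \<open>M\<close> of \<open>B\<close>.
\<close>

lemma form_intertwiner:
  assumes rep: "is_rep G \<pi>" and n: "rep_dim G \<pi> = n" and B: "twisted_invariant_form G \<theta> \<pi> B"
  defines "M \<equiv> mat n n (\<lambda>(i, j). B (unit_vec n i) (unit_vec n j))"
  shows "M \<noteq> 0\<^sub>m n n" "g \<in> carrier G \<Longrightarrow> M * \<pi> g = twisted_dual G \<theta> \<pi> g * M"
proof -
  have bil: "bilinear_form n B" and inv: "\<And>g v w. g \<in> carrier G \<Longrightarrow> v \<in> carrier_vec n \<Longrightarrow>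
      w \<in> carrier_vec n \<Longrightarrow> B (\<pi> g *\<^sub>v v) w = B v (\<pi> (\<theta> (inv g)) *\<^sub>v w)"
    and nz: "\<exists>v\<in>carrier_vec n. \<exists>w\<in>carrier_vec n. B v w \<noteq> 0"
    using B n by (auto simp: twisted_invariant_form_def)
  show "M \<noteq> 0\<^sub>m n n"
  proof
    assume "M = 0\<^sub>m n n"
    then have "B (unit_vec n i) (unit_vec n j) = 0" if "i < n" "j < n" for i j
      using that by (metis (mono_tags, lifting) M_def index_mat(1) index_zero_mat(1) old.prod.case)
    then have "B v w = 0" if "v \<in> carrier_vec n" "w \<in> carrier_vec n" for v w
      unfolding bilinear_form_matrix[OF bil that] by simp
    then show False using nz by blast
  qed
  have c: "\<pi> g \<in> carrier_mat n n" if "g \<in> carrier G" for g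
    using is_rep_carrier[OF rep that] n by simp
  have M: "M \<in> carrier_mat n n" by (simp add: M_def)
  assume g: "g \<in> carrier G"
  let ?h = "inv (\<theta> g)"
  have h: "?h \<in> carrier G" "\<theta> (inv ?h) = g" using g by (simp_all add: theta_theta)
  show "M * \<pi> g = twisted_dual G \<theta> \<pi> g * M"
  proof (rule eq_matI)
    fix i j assume "i < dim_row (twisted_dual G \<theta> \<pi> g * M)" "j < dim_col (twisted_dual G \<theta> \<pi> g * M)"
    then have ij: "i < n" "j < n" using M c[OF h(1)] g by (auto simp: twisted_dual_apply)
    have colE: "\<pi> ?h *\<^sub>v unit_vec n i = col (\<pi> ?h) i" "\<pi> g *\<^sub>v unit_vec n j = col (\<pi> g) j"
      using mult_unit_vec[OF c[OF h(1)] ij(1)] mult_unit_vec[OF c[OF g] ij(2)] by auto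
    have "B (col (\<pi> ?h) i) (unit_vec n j) = B (unit_vec n i) (col (\<pi> g) j)"
      using inv[OF h(1), of "unit_vec n i" "unit_vec n j"] h(2) colE by simp
    moreover have "B (col (\<pi> ?h) i) (unit_vec n j) = (\<Sum>k<n. \<pi> ?h $$ (k, i) * B (unit_vec n k) (unit_vec n j))"
    proof -
      have "B (col (\<pi> ?h) i) (unit_vec n j) = (\<Sum>k<n. col (\<pi> ?h) i $ k * B (unit_vec n k) (unit_vec n j))"
        by (rule linear_functional_expansion[where f = "\<lambda>v. B v (unit_vec n j)"])
          (use bil c[OF h(1)] ij in \<open>auto simp: bilinear_form_def\<close>)
      then show ?thesis using c[OF h(1)] ij by simp
    qed
    moreover have "B (unit_vec n i) (col (\<pi> g) j) = (\<Sum>k<n. \<pi> g $$ (k, j) * B (unit_vec n i) (unit_vec n k))"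
    proof -
      have "B (unit_vec n i) (col (\<pi> g) j) = (\<Sum>k<n. col (\<pi> g) j $ k * B (unit_vec n i) (unit_vec n k))"
        by (rule linear_functional_expansion[where f = "\<lambda>w. B (unit_vec n i) w"])
          (use bil c[OF g] ij in \<open>auto simp: bilinear_form_def\<close>)
      then show ?thesis using c[OF g] ij by simp
    qed
    moreover have "(M * \<pi> g) $$ (i, j) = (\<Sum>k<n. \<pi> g $$ (k, j) * B (unit_vec n i) (unit_vec n k))"
      using index_mult_mat_sum[OF M c[OF g] ij] ij by (simp add: M_def mult.commute)
    moreover have "(twisted_dual G \<theta> \<pi> g * M) $$ (i, j) = (\<Sum>k<n. \<pi> ?h $$ (k, i) * B (unit_vec n k) (unit_vec n j))"
    proof -
      have t: "transpose_mat (\<pi> ?h) \<in> carrier_mat n n" using c[OF h(1)] by simp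
      show ?thesis
        using index_mult_mat_sum[OF t M ij] ij c[OF h(1)] g by (simp add: M_def twisted_dual_apply)
    qed
    ultimately show "(M * \<pi> g) $$ (i, j) = (twisted_dual G \<theta> \<pi> g * M) $$ (i, j)" by simp
  qed (use M c[OF g] c[OF h(1)] g in \<open>auto simp: twisted_dual_apply\<close>)
qed

lemma intertwiner_form:
  assumes rep: "is_rep G \<pi>" and n: "rep_dim G \<pi> = n" and P: "P \<in> carrier_mat n n" "P \<noteq> 0\<^sub>m n n"
    and tw: "\<And>g. g \<in> carrier G \<Longrightarrow> P * \<pi> g = twisted_dual G \<theta> \<pi> g * P"
  shows "twisted_invariant_form G \<theta> \<pi> (\<lambda>v w. v \<bullet> (P *\<^sub>v w))"
proof -
  have c: "\<pi> g \<in> carrier_mat n n" if "g \<in> carrier G" for g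
    using is_rep_carrier[OF rep that] n by simp
  have "\<exists>i<n. \<exists>j<n. P $$ (i, j) \<noteq> 0"
  proof (rule ccontr)
    assume "\<not> (\<exists>i<n. \<exists>j<n. P $$ (i, j) \<noteq> 0)"
    then have "P = 0\<^sub>m n n" using P(1) by (intro eq_matI) auto
    then show False using P(2) by simp
  qed
  then obtain i j where ij: "i < n" "j < n" "P $$ (i, j) \<noteq> 0" by blast
  then have "unit_vec n i \<bullet> (P *\<^sub>v unit_vec n j) \<noteq> 0"
    using P(1) mult_unit_vec[OF P(1) ij(2)] by simp
  then have "\<exists>v\<in>carrier_vec n. \<exists>w\<in>carrier_vec n. v \<bullet> (P *\<^sub>v w) \<noteq> 0"
    by (meson unit_vec_carrier)
  moreover have "(\<pi> g *\<^sub>v v) \<bullet> (P *\<^sub>v w) = v \<bullet> (P *\<^sub>v (\<pi> (\<theta> (inv g)) *\<^sub>v w))"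
    if g: "g \<in> carrier G" and vw: "v \<in> carrier_vec n" "w \<in> carrier_vec n" for g v w
  proof -
    let ?h = "inv (\<theta> g)"
    have h: "?h \<in> carrier G" using g by simp
    have "P *\<^sub>v (\<pi> ?h *\<^sub>v w) = P * \<pi> ?h *\<^sub>v w"
      using P c[OF h] vw by (simp add: assoc_mult_mat_vec[of _ n n _ n])
    also have "\<dots> = transpose_mat (\<pi> g) *\<^sub>v (P *\<^sub>v w)"
      unfolding tw[OF h] twisted_dual_inv_theta[OF g]
      using P c[OF g] vw by (simp add: assoc_mult_mat_vec[of _ n n _ n])
    finally have "P *\<^sub>v (\<pi> ?h *\<^sub>v w) = transpose_mat (\<pi> g) *\<^sub>v (P *\<^sub>v w)" .
    moreover have "(\<pi> g *\<^sub>v v) \<bullet> (P *\<^sub>v w) = v \<bullet> (transpose_mat (\<pi> g) *\<^sub>v (P *\<^sub>v w))"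
    proof -
      have Pw: "P *\<^sub>v w \<in> carrier_vec n" using P vw by simp
      have "(\<pi> g *\<^sub>v v) \<bullet> (P *\<^sub>v w) = (P *\<^sub>v w) \<bullet> (\<pi> g *\<^sub>v v)"
        by (rule comm_scalar_prod[of _ n]) (use Pw c[OF g] vw in auto)
      also have "\<dots> = (transpose_mat (\<pi> g) *\<^sub>v (P *\<^sub>v w)) \<bullet> v"
        using transpose_vec_mult_scalar[OF c[OF g] vw(1) Pw] by simp
      also have "\<dots> = v \<bullet> (transpose_mat (\<pi> g) *\<^sub>v (P *\<^sub>v w))"
        by (rule comm_scalar_prod[of _ n]) (use Pw c[OF g] vw in auto)
      finally show ?thesis .
    qed
    ultimately show ?thesis by (simp add: theta_inv g)
  qed
  ultimately show ?thesis
    unfolding twisted_invariant_form_def n using bilinear_form_of_matrix[OF P(1)] by blast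
qed

text \<open>
  The matrix of an invariant form would be an intertwiner with trivial kernel, hence an isomorphism.
\<close>

lemma fs_indicator_not_iso:
  assumes \<pi>: "irreducible_rep G \<pi>" and not_iso: "\<not> rep_iso G \<pi> (twisted_dual G \<theta> \<pi>)"
  shows "fs_indicator G \<theta> \<pi> = 0"
proof -
  define n where "n = rep_dim G \<pi>"
  note rep = irreducible_repD(1)[OF \<pi>]
  have \<tau>: "rep_dim G (twisted_dual G \<theta> \<pi>) = n" "\<And>g. g \<in> carrier G \<Longrightarrow> twisted_dual G \<theta> \<pi> g \<in> carrier_mat n n"
    using twisted_dual_rep[OF rep] is_rep_carrier[OF conjunct1[OF twisted_dual_rep[OF rep]]] by (auto simp: n_def)
  have no_form: "\<not> twisted_invariant_form G \<theta> \<pi> B" for B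
  proof
    assume B: "twisted_invariant_form G \<theta> \<pi> B"
    define M where "M = mat n n (\<lambda>(i, j). B (unit_vec n i) (unit_vec n j))"
    have M: "M \<in> carrier_mat n n" by (simp add: M_def)
    note MB = form_intertwiner[OF rep n_def[symmetric] B, folded M_def]
    have ker: "x = 0\<^sub>v n" if "x \<in> carrier_vec n" "M *\<^sub>v x = 0\<^sub>v n" for x
      by (rule schur_kernel[OF \<pi> n_def[symmetric] M \<tau>(2) MB(2) MB(1) that])
    obtain Q where "Q \<in> carrier_mat n n" "Q * M = 1\<^sub>m n" "M * Q = 1\<^sub>m n"
      by (rule trivial_kernel_invertible[OF M ker])
    then have "rep_iso G \<pi> (twisted_dual G \<theta> \<pi>)"
      using rep_isoI[OF n_def[symmetric] \<tau>(1) M _ _ _ MB(2)] by blast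
    then show False using not_iso by simp
  qed
  show ?thesis
    unfolding fs_indicator_def by (rule the_equality) (use no_form not_iso in auto)
qed

text \<open>
  The intertwiners from \<^term>\<open>\<pi>\<close> to its twisted dual, which are the matrices of the invariant forms,
  make up a line. Transposition acts on this line, and its eigenvalue is the indicator.
\<close>

lemma fs_indicator_iso:
  assumes \<pi>: "irreducible_rep G \<pi>" and iso: "rep_iso G \<pi> (twisted_dual G \<theta> \<pi>)" and n: "rep_dim G \<pi> = n"
  obtains P Q where "P \<in> carrier_mat n n" "Q \<in> carrier_mat n n" "Q * P = 1\<^sub>m n" "P * Q = 1\<^sub>m n"
    "\<forall>g\<in>carrier G. P * \<pi> g = twisted_dual G \<theta> \<pi> g * P"
    "transpose_mat P = of_int (fs_indicator G \<theta> \<pi>) \<cdot>\<^sub>m P" "fs_indicator G \<theta> \<pi> \<in> {1, -1}"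
proof -
  note rep = irreducible_repD(1)[OF \<pi>]
  obtain P Q where P: "P \<in> carrier_mat n n" "Q \<in> carrier_mat n n" "Q * P = 1\<^sub>m n" "P * Q = 1\<^sub>m n"
    and tw: "\<forall>g\<in>carrier G. P * \<pi> g = twisted_dual G \<theta> \<pi> g * P"
    by (rule rep_isoE[OF iso]) (simp add: n)
  have tw': "P * \<pi> g = twisted_dual G \<theta> \<pi> g * P" if "g \<in> carrier G" for g using tw that by blast
  have "n > 0" using irreducible_repD(2)[OF \<pi>] n by simp
  have P0: "P \<noteq> 0\<^sub>m n n"
  proof
    assume "P = 0\<^sub>m n n"
    then have "(0\<^sub>m n n :: complex mat) = 1\<^sub>m n" using P(2,3) by simp
    then have "(0\<^sub>m n n :: complex mat) $$ (0, 0) = 1\<^sub>m n $$ (0, 0)" by simp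
    then show False using \<open>n > 0\<close> by simp
  qed
  then have "\<exists>i<n. \<exists>j<n. P $$ (i, j) \<noteq> 0"
    using P(1) by (metis eq_matI carrier_matD index_zero_mat)
  then obtain i j where ij: "i < n" "j < n" and Pij: "P $$ (i, j) \<noteq> 0" by blast
  have PT: "transpose_mat P \<in> carrier_mat n n" using P(1) by simp
  obtain c where c: "transpose_mat P = c \<cdot>\<^sub>m P"
    by (rule intertwiner_unique[OF \<pi> n P tw' PT transpose_intertwiner[OF rep n P(1) tw']])
  have Pji: "P $$ (b, a) = c * P $$ (a, b)" if "a < n" "b < n" for a b
  proof -
    have "transpose_mat P $$ (a, b) = (c \<cdot>\<^sub>m P) $$ (a, b)" using c by simp
    then show ?thesis using that P(1) by simp
  qed
  have "P $$ (i, j) = c * c * P $$ (i, j)"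
    using Pji[OF ij] Pji[OF ij(2,1)] by simp
  then have "c * c = 1" using Pij by simp
  then have c_cases: "c = 1 \<or> c = -1" by (metis mult_cancel_left1 square_eq_1_iff)
  have form_iff: "(\<exists>B. twisted_invariant_form G \<theta> \<pi> B \<and>
      (\<forall>v\<in>carrier_vec n. \<forall>w\<in>carrier_vec n. B v w = s * B w v)) \<longleftrightarrow> c = s" (is "?l \<longleftrightarrow> _")
    if s: "s * s = 1" for s :: complex
  proof
    assume ?l
    then obtain B where B: "twisted_invariant_form G \<theta> \<pi> B"
      and sym: "\<And>v w. v \<in> carrier_vec n \<Longrightarrow> w \<in> carrier_vec n \<Longrightarrow> B v w = s * B w v" by blast
    define M where "M = mat n n (\<lambda>(i, j). B (unit_vec n i) (unit_vec n j))"
    have M: "M \<in> carrier_mat n n" by (simp add: M_def)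
    note MB = form_intertwiner[OF rep n B, folded M_def]
    obtain a where a: "M = a \<cdot>\<^sub>m P"
      by (rule intertwiner_unique[OF \<pi> n P tw' M MB(2)])
    have "a \<noteq> 0"
    proof
      assume "a = 0"
      then have "M = 0\<^sub>m n n" using a P(1) by auto
      then show False using MB(1) by simp
    qed
    have "M $$ (i, j) = s * M $$ (j, i)"
      using sym[of "unit_vec n i" "unit_vec n j"] ij by (simp add: M_def)
    then have "a * P $$ (i, j) = s * (a * (c * P $$ (i, j)))"
      using a P(1) ij Pji[OF ij] by simp
    then have "1 = s * c" using \<open>a \<noteq> 0\<close> Pij by simp
    then have "s * (s * c) = s" by simp
    then show "c = s" using s by (simp add: mult.assoc[symmetric])
  next
    assume cs: "c = s"
    have "v \<bullet> (P *\<^sub>v w) = s * (w \<bullet> (P *\<^sub>v v))" if vw: "v \<in> carrier_vec n" "w \<in> carrier_vec n" for v w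
    proof -
      have "v \<bullet> (P *\<^sub>v w) = (transpose_mat P *\<^sub>v v) \<bullet> w"
        using transpose_vec_mult_scalar[OF P(1) vw(2,1)] by simp
      also have "transpose_mat P *\<^sub>v v = s \<cdot>\<^sub>v (P *\<^sub>v v)"
        unfolding c cs using P(1) vw(1) by (intro eq_vecI) auto
      also have "\<dots> \<bullet> w = s * (w \<bullet> (P *\<^sub>v v))"
        using P(1) vw comm_scalar_prod[of "P *\<^sub>v v" n w] by (simp add: smult_scalar_prod_distrib[of _ n])
      finally show ?thesis .
    qed
    then show ?l using intertwiner_form[OF rep n P(1) P0 tw'] by blast
  qed
  have sym: "(\<exists>B. twisted_invariant_form G \<theta> \<pi> B \<and>
      (\<forall>v\<in>carrier_vec n. \<forall>w\<in>carrier_vec n. B v w = B w v)) \<longleftrightarrow> c = 1"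
    using form_iff[of 1] by simp
  have anti: "(\<exists>B. twisted_invariant_form G \<theta> \<pi> B \<and>
      (\<forall>v\<in>carrier_vec n. \<forall>w\<in>carrier_vec n. B v w = - B w v)) \<longleftrightarrow> c = -1"
    using form_iff[of "-1"] by simp
  have fs: "fs_indicator G \<theta> \<pi> = (THE e. (e = 1 \<and> c = 1) \<or> (e = -1 \<and> c = -1))"
    unfolding fs_indicator_def n sym anti using iso by simp
  have "fs_indicator G \<theta> \<pi> = (if c = 1 then 1 else -1)"
    unfolding fs using c_cases by (intro the_equality) auto
  then have "of_int (fs_indicator G \<theta> \<pi>) = c" "fs_indicator G \<theta> \<pi> \<in> {1, -1}"
    using c_cases by auto
  then show ?thesis using that[OF P tw] c by simp
qed

end

section \<open>Invariants in tensor products\<close>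

text \<open>
  Averaging over the subgroup. This is what makes the invariants in a tensor product computable: the
  projections onto the two factors act on the two sides of a matrix.
\<close>

lemma projection_onto_invariants:
  fixes G (structure)
  assumes "group G" "finite (carrier G)" and rep: "is_rep G \<pi>" and n: "rep_dim G \<pi> = n"
    and K: "subgroup K G"
  obtains p where "p \<in> carrier_mat n n" "\<And>x. x \<in> carrier_vec n \<Longrightarrow> p *\<^sub>v x \<in> invariants G \<pi> K"
    "\<And>x. x \<in> invariants G \<pi> K \<Longrightarrow> p *\<^sub>v x = x"
proof -
  interpret group G by fact
  interpret K: subgroup K G by fact
  have fin: "finite K" using K.subset assms(2) finite_subset by blast
  define N where "N = card K"
  have "K \<noteq> {}" using K.one_closed by blast
  then have N: "N \<noteq> 0" using fin by (simp add: N_def)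
  have c: "\<pi> k \<in> carrier_mat n n" if "k \<in> K" for k
    using is_rep_carrier[OF rep K.mem_carrier[OF that]] n by simp
  define p where "p = mat n n (\<lambda>(i, j). (\<Sum>k\<in>K. \<pi> k $$ (i, j)) / of_nat N)"
  have p: "p \<in> carrier_mat n n" by (simp add: p_def)
  have px: "(p *\<^sub>v x) $ i = (\<Sum>k\<in>K. (\<pi> k *\<^sub>v x) $ i) / of_nat N" if x: "x \<in> carrier_vec n" and i: "i < n" for x i
  proof -
    have "(p *\<^sub>v x) $ i = (\<Sum>j<n. (\<Sum>k\<in>K. \<pi> k $$ (i, j) * x $ j)) / of_nat N"
      using index_mult_mat_vec_sum[OF p x i] i by (simp add: p_def sum_distrib_right sum_divide_distrib)
    also have "(\<Sum>j<n. (\<Sum>k\<in>K. \<pi> k $$ (i, j) * x $ j)) = (\<Sum>k\<in>K. (\<pi> k *\<^sub>v x) $ i)"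
      by (subst sum.swap) (intro sum.cong refl, simp add: index_mult_mat_vec_sum[OF c x i] del: index_mult_mat_vec)
    finally show ?thesis .
  qed
  have "p *\<^sub>v x \<in> invariants G \<pi> K" if x: "x \<in> carrier_vec n" for x
  proof -
    have px_c: "p *\<^sub>v x \<in> carrier_vec n" using p x by simp
    have "\<pi> h *\<^sub>v (p *\<^sub>v x) = p *\<^sub>v x" if h: "h \<in> K" for h
    proof (rule eq_vecI)
      fix i assume "i < dim_vec (p *\<^sub>v x)"
      then have i: "i < n" using p by simp
      have bij: "bij_betw (\<lambda>k. h \<otimes> k) K K"
        by (rule bij_betw_byWitness[of _ "\<lambda>k. inv h \<otimes> k"])
          (use h in \<open>auto simp: m_assoc[symmetric] K.mem_carrier\<close>)
      have step: "(\<Sum>j<n. \<pi> h $$ (i, j) * (\<pi> k *\<^sub>v x) $ j) = (\<pi> (h \<otimes> k) *\<^sub>v x) $ i" if k: "k \<in> K" for k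
      proof -
        have "\<pi> (h \<otimes> k) *\<^sub>v x = \<pi> h *\<^sub>v (\<pi> k *\<^sub>v x)"
          using rep_mult[OF rep K.mem_carrier[OF h] K.mem_carrier[OF k]] c[OF h] c[OF k] x
          by (simp add: assoc_mult_mat_vec[of _ n n _ n])
        then show ?thesis
          using index_mult_mat_vec_sum[OF c[OF h] _ i, of "\<pi> k *\<^sub>v x"] c[OF k] x by simp
      qed
      have "(\<pi> h *\<^sub>v (p *\<^sub>v x)) $ i = (\<Sum>j<n. \<pi> h $$ (i, j) * (p *\<^sub>v x) $ j)"
        by (rule index_mult_mat_vec_sum[OF c[OF h] px_c i])
      also have "\<dots> = (\<Sum>j<n. \<Sum>k\<in>K. \<pi> h $$ (i, j) * (\<pi> k *\<^sub>v x) $ j) / of_nat N"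
        by (simp add: px[OF x] sum_distrib_left sum_divide_distrib del: index_mult_mat_vec)
      also have "(\<Sum>j<n. \<Sum>k\<in>K. \<pi> h $$ (i, j) * (\<pi> k *\<^sub>v x) $ j) = (\<Sum>k\<in>K. (\<pi> (h \<otimes> k) *\<^sub>v x) $ i)"
        by (subst sum.swap) (intro sum.cong refl step)
      also have "\<dots> = (\<Sum>k\<in>K. (\<pi> k *\<^sub>v x) $ i)"
        by (rule sum.reindex_bij_betw[OF bij])
      finally show "(\<pi> h *\<^sub>v (p *\<^sub>v x)) $ i = (p *\<^sub>v x) $ i" using px[OF x i] by simp
    qed (use p c[OF h] in simp)
    then show ?thesis using px_c n by (simp add: invariants_def)
  qed
  moreover have "p *\<^sub>v x = x" if x: "x \<in> invariants G \<pi> K" for x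
  proof -
    have xc: "x \<in> carrier_vec n" and fixed: "\<And>k. k \<in> K \<Longrightarrow> \<pi> k *\<^sub>v x = x"
      using x n by (auto simp: invariants_def)
    show ?thesis
    proof (rule eq_vecI)
      fix i assume "i < dim_vec x"
      then have i: "i < n" using xc by simp
      have "(p *\<^sub>v x) $ i = (\<Sum>k\<in>K. x $ i) / of_nat N"
        unfolding px[OF xc i] by (simp add: fixed)
      then show "(p *\<^sub>v x) $ i = x $ i" using N by (simp add: N_def)
    qed (use p xc in simp)
  qed
  ultimately show ?thesis using that[OF p] by blast
qed

lemma pure_tensor_carrier [simp]:
  "v \<in> carrier_vec n \<Longrightarrow> w \<in> carrier_vec m \<Longrightarrow> pure_tensor v w \<in> carrier_mat n m"
  by (simp add: pure_tensor_def)

lemma mult_pure_tensor: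
  assumes p: "p \<in> carrier_mat n n" and vw: "v \<in> carrier_vec n" "w \<in> carrier_vec m"
  shows "p * pure_tensor v w = pure_tensor (p *\<^sub>v v) w"
proof (rule eq_matI)
  fix i j assume "i < dim_row (pure_tensor (p *\<^sub>v v) w)" "j < dim_col (pure_tensor (p *\<^sub>v v) w)"
  then have ij: "i < n" "j < m" using p vw by (auto simp: pure_tensor_def)
  have "(p * pure_tensor v w) $$ (i, j) = (\<Sum>k<n. p $$ (i, k) * v $ k) * w $ j"
    using index_mult_mat_sum[OF p pure_tensor_carrier[OF vw] ij] ij vw
    by (simp add: pure_tensor_def sum_distrib_right mult.assoc)
  also have "(\<Sum>k<n. p $$ (i, k) * v $ k) = (p *\<^sub>v v) $ i"
    by (rule index_mult_mat_vec_sum[OF p vw(1) ij(1), symmetric])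
  finally show "(p * pure_tensor v w) $$ (i, j) = pure_tensor (p *\<^sub>v v) w $$ (i, j)"
    using ij p vw by (simp add: pure_tensor_def)
qed (use p vw in \<open>auto simp: pure_tensor_def\<close>)

lemma transpose_pure_tensor: "transpose_mat (pure_tensor v w) = pure_tensor w v"
  by (auto simp: pure_tensor_def)

lemma pure_tensor_mult_transpose:
  assumes q: "q \<in> carrier_mat m m" and vw: "v \<in> carrier_vec n" "w \<in> carrier_vec m"
  shows "pure_tensor v w * transpose_mat q = pure_tensor v (q *\<^sub>v w)"
proof -
  have "transpose_mat (q * pure_tensor w v) = pure_tensor v w * transpose_mat q"
    using transpose_mult[OF q pure_tensor_carrier[OF vw(2,1)]] by (simp add: transpose_pure_tensor)
  then show ?thesis
    by (simp add: mult_pure_tensor[OF q vw(2,1)] transpose_pure_tensor)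
qed

lemma submodule_mat_iff:
  "submodule class_ring S (module_mat TYPE(complex) n m) \<longleftrightarrow>
    S \<subseteq> carrier_mat n m \<and> 0\<^sub>m n m \<in> S \<and> (\<forall>A\<in>S. \<forall>B\<in>S. A + B \<in> S) \<and> (\<forall>c. \<forall>A\<in>S. c \<cdot>\<^sub>m A \<in> S)"
proof -
  interpret vectorspace class_ring "module_mat TYPE(complex) n m" by (rule matrix_vs)
  show ?thesis
    unfolding submodule_def module_mat_simps using module_axioms by auto
qed

lemma subspace_mat_iff:
  "VectorSpace.subspace class_ring S (module_mat TYPE(complex) n m) \<longleftrightarrow>
    submodule class_ring S (module_mat TYPE(complex) n m)"
  unfolding VectorSpace.subspace_def using matrix_vs by blast

text \<open>
  Writing \<open>T = p * T * q\<^sup>T\<close> and expanding the middle factor in elementary matrices \<open>e\<^sub>i \<otimes> e\<^sub>j\<close>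
  exhibits \<open>T\<close> as a combination of the pure tensors \<open>p e\<^sub>i \<otimes> q e\<^sub>j\<close>.
\<close>

lemma carrier_tensor_space:
  assumes p: "p \<in> carrier_mat n n" "\<And>x. x \<in> carrier_vec n \<Longrightarrow> p *\<^sub>v x \<in> U" "\<And>x. x \<in> U \<Longrightarrow> p *\<^sub>v x = x"
    and q: "q \<in> carrier_mat m m" "\<And>x. x \<in> carrier_vec m \<Longrightarrow> q *\<^sub>v x \<in> W" "\<And>x. x \<in> W \<Longrightarrow> q *\<^sub>v x = x"
    and UW: "U \<subseteq> carrier_vec n" "W \<subseteq> carrier_vec m"
  shows "carrier (tensor_space n m U W) = {T \<in> carrier_mat n m. p * T = T \<and> T * transpose_mat q = T}"
    (is "_ = ?S")
proof -
  interpret vectorspace class_ring "module_mat TYPE(complex) n m" by (rule matrix_vs)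
  define B where "B = {pure_tensor u w | u w. u \<in> U \<and> w \<in> W}"
  have carrier_eq: "carrier (tensor_space n m U W) = span B"
    by (simp add: tensor_space_def B_def)
  have BC: "B \<subseteq> carrier (module_mat TYPE(complex) n m)"
    using UW pure_tensor_carrier unfolding B_def module_mat_simps by blast
  have qT: "transpose_mat q \<in> carrier_mat m m" using q(1) by simp
  have "submodule class_ring ?S (module_mat TYPE(complex) n m)"
    unfolding submodule_mat_iff
    using p(1) qT by (auto simp: mult_add_distrib_mat[of _ n n _ m] add_mult_distrib_mat[of _ n m _ _ m]
        mult_smult_distrib[of _ n n _ m] mult_smult_assoc_mat[of _ n m _ m])
  moreover have "B \<subseteq> ?S"
  proof
    fix T assume "T \<in> B"
    then obtain u w where uw: "u \<in> U" "w \<in> W" and T: "T = pure_tensor u w" by (auto simp: B_def)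
    have c: "u \<in> carrier_vec n" "w \<in> carrier_vec m" using uw UW by auto
    then show "T \<in> ?S"
      unfolding T by (simp add: mult_pure_tensor[OF p(1)] pure_tensor_mult_transpose[OF q(1)] p(3) q(3) uw)
  qed
  ultimately have "span B \<subseteq> ?S" by (intro span_is_subset)
  moreover have "T \<in> span B" if T: "T \<in> ?S" for T
  proof -
    have sub: "submodule class_ring (span B) (module_mat TYPE(complex) n m)"
      by (rule span_is_submodule[OF BC])
    then have closed: "0\<^sub>m n m \<in> span B" "\<And>A C. A \<in> span B \<Longrightarrow> C \<in> span B \<Longrightarrow> A + C \<in> span B"
      "\<And>c A. A \<in> span B \<Longrightarrow> c \<cdot>\<^sub>m A \<in> span B"
      by (auto simp: submodule_mat_iff)
    have in_span: "A \<in> span B" if "A \<in> B" for A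
      using in_own_span[OF BC] that by blast
    define part where "part I = mat n m (\<lambda>x. if x \<in> I then T $$ x else 0)" for I
    have part: "part I \<in> carrier_mat n m" for I by (simp add: part_def)
    have "p * part I * transpose_mat q \<in> span B" if "finite I" "I \<subseteq> {..<n} \<times> {..<m}" for I
      using that
    proof (induction I)
      case empty
      have "part {} = 0\<^sub>m n m" by (auto simp: part_def)
      then show ?case using p(1) qT closed(1) by simp
    next
      case (insert x I)
      obtain i j where x: "x = (i, j)" by force
      have ij: "i < n" "j < m" using insert.prems x by auto
      let ?E = "pure_tensor (unit_vec n i) (unit_vec m j)"
      have E: "?E \<in> carrier_mat n m" by simp
      have "part (insert x I) = part I + T $$ x \<cdot>\<^sub>m ?E"
        using insert.hyps(2) ij x by (intro eq_matI) (auto simp: part_def pure_tensor_def)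
      then have "p * part (insert x I) * transpose_mat q =
          p * part I * transpose_mat q + T $$ x \<cdot>\<^sub>m (p * ?E * transpose_mat q)"
        using p(1) qT part[of I] E
        by (simp add: mult_add_distrib_mat[of _ n n _ m] add_mult_distrib_mat[of _ n m _ _ m]
            mult_smult_distrib[of _ n n _ m] mult_smult_assoc_mat[of _ n m _ m])
      moreover have "p * ?E * transpose_mat q = pure_tensor (p *\<^sub>v unit_vec n i) (q *\<^sub>v unit_vec m j)"
        using p(1) q(1) by (simp add: mult_pure_tensor[of _ n _ _ m] pure_tensor_mult_transpose[of _ m _ n])
      moreover have "pure_tensor (p *\<^sub>v unit_vec n i) (q *\<^sub>v unit_vec m j) \<in> B"
        unfolding B_def using p(2)[OF unit_vec_carrier] q(2)[OF unit_vec_carrier] by blast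
      ultimately show ?case
        using insert closed in_span by simp
    qed
    from this[of "{..<n} \<times> {..<m}"] have "p * part ({..<n} \<times> {..<m}) * transpose_mat q \<in> span B" by simp
    moreover have "part ({..<n} \<times> {..<m}) = T" using T by (intro eq_matI) (auto simp: part_def)
    ultimately show ?thesis using T by auto
  qed
  ultimately show ?thesis unfolding carrier_eq by blast
qed

lemma projection_fixes_iff_invariant:
  assumes rep: "is_rep G \<pi>" and n: "rep_dim G \<pi> = n" and K: "K \<subseteq> carrier G"
    and p: "p \<in> carrier_mat n n" "\<And>x. x \<in> carrier_vec n \<Longrightarrow> p *\<^sub>v x \<in> invariants G \<pi> K"
      "\<And>x. x \<in> invariants G \<pi> K \<Longrightarrow> p *\<^sub>v x = x"
    and T: "T \<in> carrier_mat n m"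
  shows "p * T = T \<longleftrightarrow> (\<forall>k\<in>K. \<pi> k * T = T)"
proof -
  have mult_eq_iff: "A * T = T \<longleftrightarrow> (\<forall>j<m. A *\<^sub>v col T j = col T j)" if A: "A \<in> carrier_mat n n" for A
  proof
    assume AT: "A * T = T"
    show "\<forall>j<m. A *\<^sub>v col T j = col T j"
      using col_mult2[OF A T] AT by simp
  next
    assume *: "\<forall>j<m. A *\<^sub>v col T j = col T j"
    show "A * T = T"
    proof (rule mat_col_eqI)
      fix j assume "j < dim_col T"
      then have "j < m" using T by simp
      then show "col (A * T) j = col T j" using * by (simp only: col_mult2[OF A T])
    qed (use A T in auto)
  qed
  have c: "\<pi> k \<in> carrier_mat n n" if "k \<in> K" for k
    using is_rep_carrier[OF rep] K that n by blast
  have fix_iff: "p *\<^sub>v x = x \<longleftrightarrow> (\<forall>k\<in>K. \<pi> k *\<^sub>v x = x)" if x: "x \<in> carrier_vec n" for x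
  proof
    assume "p *\<^sub>v x = x"
    then have "x \<in> invariants G \<pi> K" using p(2)[OF x] by simp
    then show "\<forall>k\<in>K. \<pi> k *\<^sub>v x = x" by (simp add: invariants_def)
  next
    assume "\<forall>k\<in>K. \<pi> k *\<^sub>v x = x"
    then show "p *\<^sub>v x = x" using x n by (intro p(3)) (simp add: invariants_def)
  qed
  have "p * T = T \<longleftrightarrow> (\<forall>j<m. \<forall>k\<in>K. \<pi> k *\<^sub>v col T j = col T j)"
    unfolding mult_eq_iff[OF p(1)] using fix_iff T by auto
  also have "\<dots> \<longleftrightarrow> (\<forall>k\<in>K. \<pi> k * T = T)"
    using mult_eq_iff[OF c] by blast
  finally show ?thesis .
qed

lemma tensor_space_invariants:
  fixes G (structure)
  assumes "group G" "finite (carrier G)" and \<pi>: "is_rep G \<pi>" and \<rho>: "is_rep G \<rho>"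
    and n: "rep_dim G \<pi> = n" and m: "rep_dim G \<rho> = m"
    and H: "subgroup H G" and K: "subgroup K G"
  shows "T \<in> carrier (tensor_space n m (invariants G \<pi> H) (invariants G \<rho> K)) \<longleftrightarrow>
    T \<in> carrier_mat n m \<and> (\<forall>h\<in>H. \<pi> h * T = T) \<and> (\<forall>k\<in>K. \<rho> k * transpose_mat T = transpose_mat T)"
proof -
  obtain p where p: "p \<in> carrier_mat n n" "\<And>x. x \<in> carrier_vec n \<Longrightarrow> p *\<^sub>v x \<in> invariants G \<pi> H"
    "\<And>x. x \<in> invariants G \<pi> H \<Longrightarrow> p *\<^sub>v x = x"
    using projection_onto_invariants[OF assms(1,2) \<pi> n H] by metis
  obtain q where q: "q \<in> carrier_mat m m" "\<And>x. x \<in> carrier_vec m \<Longrightarrow> q *\<^sub>v x \<in> invariants G \<rho> K"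
    "\<And>x. x \<in> invariants G \<rho> K \<Longrightarrow> q *\<^sub>v x = x"
    using projection_onto_invariants[OF assms(1,2) \<rho> m K] by metis
  have HK: "H \<subseteq> carrier G" "K \<subseteq> carrier G" using H K by (auto simp: subgroup_def)
  have UW: "invariants G \<pi> H \<subseteq> carrier_vec n" "invariants G \<rho> K \<subseteq> carrier_vec m"
    using n m by (auto simp: invariants_def)
  have right: "T * transpose_mat q = T \<longleftrightarrow> q * transpose_mat T = transpose_mat T" if "T \<in> carrier_mat n m"
  proof -
    have "transpose_mat (q * transpose_mat T) = T * transpose_mat q"
      using transpose_mult[OF q(1), of "transpose_mat T" n] that by simp
    then show ?thesis by (metis transpose_transpose)
  qed
  have "carrier (tensor_space n m (invariants G \<pi> H) (invariants G \<rho> K)) =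
      {T \<in> carrier_mat n m. p * T = T \<and> T * transpose_mat q = T}"
    by (rule carrier_tensor_space[OF p q UW])
  then show ?thesis
    using right projection_fixes_iff_invariant[OF \<pi> n HK(1) p, of T m]
      projection_fixes_iff_invariant[OF \<rho> m HK(2) q, of "transpose_mat T" n] by auto
qed

lemma tensor_space_submodule:
  assumes "U \<subseteq> carrier_vec n" "W \<subseteq> carrier_vec m"
  shows "submodule class_ring (carrier (tensor_space n m U W)) (module_mat TYPE(complex) n m)"
proof -
  interpret vectorspace class_ring "module_mat TYPE(complex) n m" by (rule matrix_vs)
  have "{pure_tensor u w | u w. u \<in> U \<and> w \<in> W} \<subseteq> carrier (module_mat TYPE(complex) n m)"
    using assms pure_tensor_carrier unfolding module_mat_simps by blast
  from span_is_submodule[OF this] show ?thesis by (simp add: tensor_space_def)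
qed

lemma submodule_mat_vs:
  assumes "submodule class_ring S (module_mat TYPE(complex) n m)"
  shows "vectorspace class_ring ((module_mat TYPE(complex) n m)\<lparr>carrier := S\<rparr>)"
  by (rule vectorspace.subspace_is_vs[OF matrix_vs]) (simp add: subspace_mat_iff assms)

lemma tensor_space_record:
  "tensor_space n m U W = (module_mat TYPE(complex) n m)\<lparr>carrier := carrier (tensor_space n m U W)\<rparr>"
  by (simp add: tensor_space_def)

lemma tensor_space_simps:
  "\<zero>\<^bsub>tensor_space n m U W\<^esub> = 0\<^sub>m n m" "A \<oplus>\<^bsub>tensor_space n m U W\<^esub> B = A + B"
  "c \<odot>\<^bsub>tensor_space n m U W\<^esub> A = c \<cdot>\<^sub>m A"
  by (simp_all add: tensor_space_def module_mat_simps)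

lemma tensor_space_vs:
  assumes "U \<subseteq> carrier_vec n" "W \<subseteq> carrier_vec m"
  shows "vectorspace class_ring (tensor_space n m U W)"
  by (subst tensor_space_record) (rule submodule_mat_vs[OF tensor_space_submodule[OF assms]])

lemma transpose_smult: "transpose_mat (c \<cdot>\<^sub>m A) = c \<cdot>\<^sub>m transpose_mat A"
  by auto

lemma one_smult_mat: "1 \<cdot>\<^sub>m A = (A :: complex mat)"
  by (rule eq_matI) auto

lemma smult_smult_mat: "a \<cdot>\<^sub>m (b \<cdot>\<^sub>m A) = (a * b) \<cdot>\<^sub>m (A :: complex mat)"
  by (rule eq_matI) auto

lemma square_eigenspace_vs:
  assumes U: "U \<subseteq> carrier_vec n"
  shows "vectorspace class_ring ((tensor_space n n U U)
    \<lparr>carrier := {T \<in> carrier (tensor_space n n U U). transpose_mat T = c \<cdot>\<^sub>m T}\<rparr>)"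
proof -
  have "submodule class_ring {T \<in> carrier (tensor_space n n U U). transpose_mat T = c \<cdot>\<^sub>m T}
      (module_mat TYPE(complex) n n)"
    using tensor_space_submodule[OF U U] unfolding submodule_mat_iff
    by (auto simp: transpose_add[of _ n n] transpose_smult add_smult_distrib_left_mat[of _ n n] smult_smult_mat mult.commute
        subset_iff)
  from submodule_mat_vs[OF this] show ?thesis
    by (simp add: tensor_space_def)
qed

lemma uminus_mat_eq_smult: "- (A :: complex mat) = (-1) \<cdot>\<^sub>m A"
  by (rule eq_matI) auto

lemma ext_square_vs: "U \<subseteq> carrier_vec n \<Longrightarrow> vectorspace class_ring (ext_square n U)"
  unfolding ext_square_def uminus_mat_eq_smult by (rule square_eigenspace_vs)

lemma sym_square_vs:
  assumes "U \<subseteq> carrier_vec n"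
  shows "vectorspace class_ring (sym_square n U)"
  using square_eigenspace_vs[OF assms, of 1] by (simp add: sym_square_def one_smult_mat)

lemma direct_sum_family_simps:
  "carrier (direct_sum_family I M) = {x \<in> Pi\<^sub>E I (\<lambda>i. carrier (M i)). finite {i \<in> I. x i \<noteq> \<zero>\<^bsub>M i\<^esub>}}"
  "\<zero>\<^bsub>direct_sum_family I M\<^esub> = (\<lambda>i\<in>I. \<zero>\<^bsub>M i\<^esub>)"
  "x \<oplus>\<^bsub>direct_sum_family I M\<^esub> y = (\<lambda>i\<in>I. x i \<oplus>\<^bsub>M i\<^esub> y i)"
  "c \<odot>\<^bsub>direct_sum_family I M\<^esub> x = (\<lambda>i\<in>I. c \<odot>\<^bsub>M i\<^esub> x i)"
  by (simp_all add: direct_sum_family_def)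

lemma direct_sum_family_vs:
  assumes fld: "field K" and M: "\<And>i. i \<in> I \<Longrightarrow> vectorspace K (M i)"
  shows "vectorspace K (direct_sum_family I M)"
proof -
  have mod: "Module.module K (M i)" if "i \<in> I" for i
    using M[OF that] by (simp add: vectorspace_def)
  have ab: "abelian_group (M i)" if "i \<in> I" for i
    by (rule Module.module.axioms(2)[OF mod[OF that]])
  have ag: "abelian_monoid (M i)" if "i \<in> I" for i
    using ab[OF that] by (simp add: abelian_group_def)
  have minus_zero: "\<ominus>\<^bsub>M i\<^esub> \<zero>\<^bsub>M i\<^esub> = \<zero>\<^bsub>M i\<^esub>" if "i \<in> I" for i
    using abelian_group.minus_equality[OF ab[OF that], of "\<zero>\<^bsub>M i\<^esub>" "\<zero>\<^bsub>M i\<^esub>"] ag[OF that]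
    by (simp add: abelian_monoid.l_zero abelian_monoid.zero_closed)
  let ?D = "direct_sum_family I M"
  have elem: "x i \<in> carrier (M i)" if "x \<in> carrier ?D" "i \<in> I" for x i
    using that by (auto simp: direct_sum_family_simps)
  have ext: "x = (\<lambda>i\<in>I. x i)" if "x \<in> carrier ?D" for x
    using that by (auto simp: direct_sum_family_simps)
  have closed: "(\<lambda>i\<in>I. f i) \<in> carrier ?D"
    if "\<And>i. i \<in> I \<Longrightarrow> f i \<in> carrier (M i)" "finite F" "\<And>i. i \<in> I \<Longrightarrow> i \<notin> F \<Longrightarrow> f i = \<zero>\<^bsub>M i\<^esub>" for f F
  proof -
    have "{i \<in> I. (\<lambda>i\<in>I. f i) i \<noteq> \<zero>\<^bsub>M i\<^esub>} \<subseteq> F" using that(3) by auto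
    then have "finite {i \<in> I. (\<lambda>i\<in>I. f i) i \<noteq> \<zero>\<^bsub>M i\<^esub>}" by (rule finite_subset) (rule that(2))
    moreover have "(\<lambda>i\<in>I. f i) \<in> Pi\<^sub>E I (\<lambda>i. carrier (M i))" using that(1) by simp
    ultimately show ?thesis unfolding direct_sum_family_simps(1) by blast
  qed
  have fin: "finite {i \<in> I. x i \<noteq> \<zero>\<^bsub>M i\<^esub>}" if "x \<in> carrier ?D" for x
    using that by (simp add: direct_sum_family_simps)
  show ?thesis
  proof (rule vs_criteria[OF fld])
    show "\<zero>\<^bsub>?D\<^esub> \<in> carrier ?D"
      unfolding direct_sum_family_simps(2) by (rule closed[of _ "{}"]) (auto intro: abelian_monoid.zero_closed ag)
    show "\<forall>v w. v \<in> carrier ?D \<and> w \<in> carrier ?D \<longrightarrow> v \<oplus>\<^bsub>?D\<^esub> w \<in> carrier ?D"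
    proof (intro allI impI)
      fix v w assume vw: "v \<in> carrier ?D \<and> w \<in> carrier ?D"
      show "v \<oplus>\<^bsub>?D\<^esub> w \<in> carrier ?D"
        unfolding direct_sum_family_simps(3)
        by (rule closed[of _ "{i \<in> I. v i \<noteq> \<zero>\<^bsub>M i\<^esub>} \<union> {i \<in> I. w i \<noteq> \<zero>\<^bsub>M i\<^esub>}"])
          (use vw elem fin in \<open>auto intro: abelian_monoid.a_closed ag simp: abelian_monoid.l_zero abelian_monoid.zero_closed ag\<close>)
    qed
    show "\<forall>c v. c \<in> carrier K \<and> v \<in> carrier ?D \<longrightarrow> c \<odot>\<^bsub>?D\<^esub> v \<in> carrier ?D"
    proof (intro allI impI)
      fix c v assume cv: "c \<in> carrier K \<and> v \<in> carrier ?D"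
      show "c \<odot>\<^bsub>?D\<^esub> v \<in> carrier ?D"
        unfolding direct_sum_family_simps(4)
        by (rule closed[of _ "{i \<in> I. v i \<noteq> \<zero>\<^bsub>M i\<^esub>}"])
          (use cv elem fin in \<open>auto intro: module.smult_closed mod simp: module.rmult_0[OF mod]\<close>)
    qed
    show "\<forall>v\<in>carrier ?D. \<exists>w\<in>carrier ?D. v \<oplus>\<^bsub>?D\<^esub> w = \<zero>\<^bsub>?D\<^esub>"
    proof
      fix v assume v: "v \<in> carrier ?D"
      have "(\<lambda>i\<in>I. \<ominus>\<^bsub>M i\<^esub> v i) \<in> carrier ?D"
        by (rule closed[of _ "{i \<in> I. v i \<noteq> \<zero>\<^bsub>M i\<^esub>}"])
          (use v elem fin in \<open>auto intro: abelian_group.a_inv_closed ab simp: minus_zero\<close>)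
      moreover have "v \<oplus>\<^bsub>?D\<^esub> (\<lambda>i\<in>I. \<ominus>\<^bsub>M i\<^esub> v i) = \<zero>\<^bsub>?D\<^esub>"
        unfolding direct_sum_family_simps
        by (rule restrict_ext) (use elem[OF v] in \<open>auto simp: abelian_group.r_neg ab\<close>)
      ultimately show "\<exists>w\<in>carrier ?D. v \<oplus>\<^bsub>?D\<^esub> w = \<zero>\<^bsub>?D\<^esub>" by blast
    qed
    show "\<forall>v w. v \<in> carrier ?D \<and> w \<in> carrier ?D \<longrightarrow> v \<oplus>\<^bsub>?D\<^esub> w = w \<oplus>\<^bsub>?D\<^esub> v"
      unfolding direct_sum_family_simps(3) using elem
      by (intro allI impI restrict_ext) (auto intro: abelian_monoid.a_comm ag)
    show "\<forall>v w x. v \<in> carrier ?D \<and> w \<in> carrier ?D \<and> x \<in> carrier ?D \<longrightarrow>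
        v \<oplus>\<^bsub>?D\<^esub> w \<oplus>\<^bsub>?D\<^esub> x = v \<oplus>\<^bsub>?D\<^esub> (w \<oplus>\<^bsub>?D\<^esub> x)"
      unfolding direct_sum_family_simps(3) using elem
      by (intro allI impI restrict_ext) (auto intro: abelian_monoid.a_assoc ag)
    show "\<forall>v\<in>carrier ?D. v \<oplus>\<^bsub>?D\<^esub> \<zero>\<^bsub>?D\<^esub> = v"
    proof
      fix v assume v: "v \<in> carrier ?D"
      have "v \<oplus>\<^bsub>?D\<^esub> \<zero>\<^bsub>?D\<^esub> = (\<lambda>i\<in>I. v i)"
        unfolding direct_sum_family_simps using elem[OF v]
        by (intro restrict_ext) (auto intro: abelian_monoid.r_zero ag)
      then show "v \<oplus>\<^bsub>?D\<^esub> \<zero>\<^bsub>?D\<^esub> = v" using ext[OF v] by simp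
    qed
    show "\<forall>a b v. a \<in> carrier K \<and> b \<in> carrier K \<and> v \<in> carrier ?D \<longrightarrow>
        (a \<otimes>\<^bsub>K\<^esub> b) \<odot>\<^bsub>?D\<^esub> v = a \<odot>\<^bsub>?D\<^esub> (b \<odot>\<^bsub>?D\<^esub> v)"
      unfolding direct_sum_family_simps(4) using elem
      by (intro allI impI restrict_ext) (auto intro: module.smult_assoc1[OF mod])
    show "\<forall>v\<in>carrier ?D. \<one>\<^bsub>K\<^esub> \<odot>\<^bsub>?D\<^esub> v = v"
    proof
      fix v assume v: "v \<in> carrier ?D"
      have "\<one>\<^bsub>K\<^esub> \<odot>\<^bsub>?D\<^esub> v = (\<lambda>i\<in>I. v i)"
        unfolding direct_sum_family_simps using elem[OF v]
        by (intro restrict_ext) (auto intro: module.smult_one[OF mod])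
      then show "\<one>\<^bsub>K\<^esub> \<odot>\<^bsub>?D\<^esub> v = v" using ext[OF v] by simp
    qed
    show "\<forall>a b v. a \<in> carrier K \<and> b \<in> carrier K \<and> v \<in> carrier ?D \<longrightarrow>
        (a \<oplus>\<^bsub>K\<^esub> b) \<odot>\<^bsub>?D\<^esub> v = a \<odot>\<^bsub>?D\<^esub> v \<oplus>\<^bsub>?D\<^esub> b \<odot>\<^bsub>?D\<^esub> v"
      unfolding direct_sum_family_simps(3,4) using elem
      by (intro allI impI restrict_ext) (auto intro: module.smult_l_distr[OF mod])
    show "\<forall>a v w. a \<in> carrier K \<and> v \<in> carrier ?D \<and> w \<in> carrier ?D \<longrightarrow>
        a \<odot>\<^bsub>?D\<^esub> (v \<oplus>\<^bsub>?D\<^esub> w) = a \<odot>\<^bsub>?D\<^esub> v \<oplus>\<^bsub>?D\<^esub> a \<odot>\<^bsub>?D\<^esub> w"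
      unfolding direct_sum_family_simps(3,4) using elem
      by (intro allI impI restrict_ext) (auto intro: module.smult_r_distr[OF mod])
  qed
qed

section \<open>Invariance of functions and of Fourier coefficients\<close>

lemma fourier_cong:
  assumes "\<And>g. g \<in> carrier G \<Longrightarrow> f g = f' g"
  shows "fourier G f \<pi> = fourier G f' \<pi>"
proof -
  have "(\<Sum>g\<in>carrier G. f g * \<pi> g $$ (i, j)) = (\<Sum>g\<in>carrier G. f' g * \<pi> g $$ (i, j))" for i j
    by (rule sum.cong) (auto simp: assms)
  then show ?thesis by (simp add: fourier_def)
qed

lemma fourier_add: "fourier G (\<lambda>g. f g + f' g) \<pi> = fourier G f \<pi> + fourier G f' \<pi>"
  by (rule eq_matI) (auto simp: fourier_def distrib_right sum.distrib)

lemma fourier_smult: "fourier G (\<lambda>g. c * f g) \<pi> = c \<cdot>\<^sub>m fourier G f \<pi>"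
  by (rule eq_matI) (auto simp: fourier_def sum_distrib_left mult.assoc)

lemma fourier_uminus: "fourier G (\<lambda>g. - f g) \<pi> = - fourier G f \<pi>"
  by (rule eq_matI) (auto simp: fourier_def sum_negf)

lemma fourier_left_translate:
  fixes G (structure)
  assumes "group G" and rep: "is_rep G \<pi>" and x: "x \<in> carrier G"
  shows "\<pi> x * fourier G (\<lambda>g. f (x \<otimes> g)) \<pi> = fourier G f \<pi>"
proof -
  interpret group G by fact
  define n where "n = rep_dim G \<pi>"
  have c: "\<pi> g \<in> carrier_mat n n" if "g \<in> carrier G" for g
    using is_rep_carrier[OF rep that] by (simp add: n_def)
  have F: "fourier G f \<pi> \<in> carrier_mat n n" for f by (simp add: n_def)
  have bij: "bij_betw (\<lambda>g. x \<otimes> g) (carrier G) (carrier G)"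
    by (rule bij_betw_byWitness[of _ "\<lambda>g. inv x \<otimes> g"]) (use x in \<open>auto simp: m_assoc[symmetric]\<close>)
  show ?thesis
  proof (rule eq_matI)
    fix i j assume "i < dim_row (fourier G f \<pi>)" "j < dim_col (fourier G f \<pi>)"
    then have ij: "i < n" "j < n" using F[of f] by auto
    have prod: "\<pi> (x \<otimes> g) $$ (i, j) = (\<Sum>k<n. \<pi> x $$ (i, k) * \<pi> g $$ (k, j))" if g: "g \<in> carrier G" for g
      using index_mult_mat_sum[OF c[OF x] c[OF g] ij] rep_mult[OF rep x g] by simp
    have "(\<pi> x * fourier G (\<lambda>g. f (x \<otimes> g)) \<pi>) $$ (i, j) =
        (\<Sum>k<n. \<pi> x $$ (i, k) * (\<Sum>g\<in>carrier G. f (x \<otimes> g) * \<pi> g $$ (k, j)))"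
      using index_mult_mat_sum[OF c[OF x] F ij] ij by (simp add: fourier_index n_def)
    also have "\<dots> = (\<Sum>g\<in>carrier G. f (x \<otimes> g) * \<pi> (x \<otimes> g) $$ (i, j))"
      unfolding sum_distrib_left
      by (subst sum.swap) (intro sum.cong refl, simp add: prod sum_distrib_left mult.left_commute)
    also have "\<dots> = (\<Sum>g\<in>carrier G. f g * \<pi> g $$ (i, j))"
      by (rule sum.reindex_bij_betw[OF bij])
    finally show "(\<pi> x * fourier G (\<lambda>g. f (x \<otimes> g)) \<pi>) $$ (i, j) = fourier G f \<pi> $$ (i, j)"
      using ij by (simp add: fourier_index n_def)
  qed (use c[OF x] in \<open>auto simp: fourier_def n_def\<close>)
qed

lemma fourier_right_translate:
  fixes G (structure)
  assumes "group G" and rep: "is_rep G \<pi>" and x: "x \<in> carrier G"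
  shows "fourier G (\<lambda>g. f (g \<otimes> x)) \<pi> * \<pi> x = fourier G f \<pi>"
proof -
  interpret group G by fact
  define n where "n = rep_dim G \<pi>"
  have c: "\<pi> g \<in> carrier_mat n n" if "g \<in> carrier G" for g
    using is_rep_carrier[OF rep that] by (simp add: n_def)
  have F: "fourier G f \<pi> \<in> carrier_mat n n" for f by (simp add: n_def)
  have bij: "bij_betw (\<lambda>g. g \<otimes> x) (carrier G) (carrier G)"
    by (rule bij_betw_byWitness[of _ "\<lambda>g. g \<otimes> inv x"]) (use x in \<open>auto simp: m_assoc\<close>)
  show ?thesis
  proof (rule eq_matI)
    fix i j assume "i < dim_row (fourier G f \<pi>)" "j < dim_col (fourier G f \<pi>)"
    then have ij: "i < n" "j < n" using F[of f] by auto
    have prod: "\<pi> (g \<otimes> x) $$ (i, j) = (\<Sum>k<n. \<pi> g $$ (i, k) * \<pi> x $$ (k, j))" if g: "g \<in> carrier G" for g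
      using index_mult_mat_sum[OF c[OF g] c[OF x] ij] rep_mult[OF rep g x] by simp
    have "(fourier G (\<lambda>g. f (g \<otimes> x)) \<pi> * \<pi> x) $$ (i, j) =
        (\<Sum>k<n. (\<Sum>g\<in>carrier G. f (g \<otimes> x) * \<pi> g $$ (i, k)) * \<pi> x $$ (k, j))"
      using index_mult_mat_sum[OF F c[OF x] ij] ij by (simp add: fourier_index n_def)
    also have "\<dots> = (\<Sum>g\<in>carrier G. f (g \<otimes> x) * \<pi> (g \<otimes> x) $$ (i, j))"
      unfolding sum_distrib_right
      by (subst sum.swap) (intro sum.cong refl, simp add: prod sum_distrib_left mult.assoc)
    also have "\<dots> = (\<Sum>g\<in>carrier G. f g * \<pi> g $$ (i, j))"
      by (rule sum.reindex_bij_betw[OF bij])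
    finally show "(fourier G (\<lambda>g. f (g \<otimes> x)) \<pi> * \<pi> x) $$ (i, j) = fourier G f \<pi> $$ (i, j)"
      using ij by (simp add: fourier_index n_def)
  qed (use c[OF x] in \<open>auto simp: fourier_def n_def\<close>)
qed

lemma mult_left_cancel_mat:
  fixes A B :: "complex mat"
  assumes "P \<in> carrier_mat n n" "Q \<in> carrier_mat n n" "Q * P = 1\<^sub>m n"
    and "A \<in> carrier_mat n m" "B \<in> carrier_mat n m" "P * A = P * B"
  shows "A = B"
proof -
  have "A = Q * P * A" using assms by simp
  also have "\<dots> = Q * (P * A)" by (rule assoc_mult_mat[OF assms(2,1,4)])
  also have "\<dots> = Q * (P * B)" using assms(6) by simp
  also have "\<dots> = Q * P * B" by (rule assoc_mult_mat[OF assms(2,1,5), symmetric])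
  also have "\<dots> = B" using assms by simp
  finally show ?thesis .
qed

lemma mult_right_cancel_mat:
  fixes A B :: "complex mat"
  assumes "P \<in> carrier_mat n n" "Q \<in> carrier_mat n n" "P * Q = 1\<^sub>m n"
    and "A \<in> carrier_mat m n" "B \<in> carrier_mat m n" "A * P = B * P"
  shows "A = B"
proof -
  have "A = A * (P * Q)" using assms by simp
  also have "\<dots> = A * P * Q" by (rule assoc_mult_mat[OF assms(4,1,2), symmetric])
  also have "\<dots> = B * P * Q" using assms(6) by simp
  also have "\<dots> = B * (P * Q)" by (rule assoc_mult_mat[OF assms(5,1,2)])
  also have "\<dots> = B" using assms by simp
  finally show ?thesis .
qed

lemma rep_inv_fixes:
  assumes "group G" and rep: "is_rep G \<pi>" and n: "rep_dim G \<pi> = n" and g: "g \<in> carrier G"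
    and T: "T \<in> carrier_mat n m" and fixed: "\<pi> g * T = T"
  shows "\<pi> (inv\<^bsub>G\<^esub> g) * T = T"
proof -
  interpret group G by fact
  have c: "\<pi> g \<in> carrier_mat n n" "\<pi> (inv\<^bsub>G\<^esub> g) \<in> carrier_mat n n"
    using is_rep_carrier[OF rep] g n by auto
  have "\<pi> (inv\<^bsub>G\<^esub> g) * T = \<pi> (inv\<^bsub>G\<^esub> g) * (\<pi> g * T)" using fixed by simp
  also have "\<dots> = \<pi> (inv\<^bsub>G\<^esub> g) * \<pi> g * T" by (rule assoc_mult_mat[OF c(2,1) T, symmetric])
  also have "\<dots> = T" using rep_inv(1)[OF assms(1) rep g] T n by simp
  finally show ?thesis .
qed

context twisted_group
begin

text \<open>
  Substituting \<open>\<theta> (inv g)\<close> for \<open>g\<close> moves the anti-automorphism from the function to the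
  representation, where it gives the transpose of the twisted dual.
\<close>

lemma fourier_twist:
  assumes rep: "is_rep G \<pi>"
  shows "fourier G (\<lambda>g. f (\<theta> (inv g))) \<pi> = transpose_mat (fourier G f (twisted_dual G \<theta> \<pi>))"
proof -
  define n where "n = rep_dim G \<pi>"
  have d: "rep_dim G (twisted_dual G \<theta> \<pi>) = n" using twisted_dual_rep[OF rep] by (simp add: n_def)
  have c: "\<pi> g \<in> carrier_mat n n" if "g \<in> carrier G" for g
    using is_rep_carrier[OF rep that] by (simp add: n_def)
  have bij: "bij_betw (\<lambda>g. \<theta> (inv g)) (carrier G) (carrier G)"
    by (rule bij_betw_byWitness[of _ "\<lambda>g. \<theta> (inv g)"]) (auto simp: theta_inv theta_theta)
  show ?thesis
  proof (rule eq_matI)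
    fix i j assume "i < dim_row (transpose_mat (fourier G f (twisted_dual G \<theta> \<pi>)))"
      "j < dim_col (transpose_mat (fourier G f (twisted_dual G \<theta> \<pi>)))"
    then have ij: "i < n" "j < n" by (auto simp: fourier_def d)
    have "transpose_mat (fourier G f (twisted_dual G \<theta> \<pi>)) $$ (i, j) =
        (\<Sum>g\<in>carrier G. f g * twisted_dual G \<theta> \<pi> g $$ (j, i))"
      using ij by (simp add: fourier_def d)
    also have "\<dots> = (\<Sum>g\<in>carrier G. f g * \<pi> (inv (\<theta> g)) $$ (i, j))"
    proof (intro sum.cong refl)
      fix g assume g: "g \<in> carrier G"
      then show "f g * twisted_dual G \<theta> \<pi> g $$ (j, i) = f g * \<pi> (inv (\<theta> g)) $$ (i, j)"
        using ij c[of "inv (\<theta> g)"] by (simp add: twisted_dual_apply)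
    qed
    also have "\<dots> = (\<Sum>g\<in>carrier G. f (\<theta> (inv g)) * \<pi> (inv (\<theta> (\<theta> (inv g)))) $$ (i, j))"
      by (rule sum.reindex_bij_betw[OF bij, symmetric])
    also have "\<dots> = fourier G (\<lambda>g. f (\<theta> (inv g))) \<pi> $$ (i, j)"
      using ij by (simp add: fourier_def n_def theta_theta)
    finally show "fourier G (\<lambda>g. f (\<theta> (inv g))) \<pi> $$ (i, j) =
        transpose_mat (fourier G f (twisted_dual G \<theta> \<pi>)) $$ (i, j)" by simp
  qed (auto simp: fourier_def d n_def)
qed

end

text \<open>
  Functions on the group and families of Fourier coefficients correspond bijectively, so each of
  the three invariance conditions can be read off from the coefficients.
\<close>

locale twisted_group_irr = twisted_group G \<theta> for G :: "('g, 'b) monoid_scheme" (structure) and \<theta> +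
  fixes R :: "('g \<Rightarrow> complex mat) set"
  assumes representatives: "irr_representatives G \<theta> R"
begin

abbreviation "\<tau> \<equiv> twisted_dual G \<theta>"

lemma irreducible: "\<pi> \<in> R \<Longrightarrow> irreducible_rep G \<pi>"
  using representatives by (auto simp: irr_representatives_def)

lemma rep: "\<pi> \<in> R \<Longrightarrow> is_rep G \<pi>"
  by (rule irreducible_repD(1)[OF irreducible])

lemma finite_R: "finite R"
  by (rule finite_representatives[OF is_group finite_carrier representatives])

lemma eq_on_carrier_iff_fourier:
  "(\<forall>g\<in>carrier G. f g = f' g) \<longleftrightarrow> (\<forall>\<pi>\<in>R. fourier G f \<pi> = fourier G f' \<pi>)"
proof
  assume "\<forall>g\<in>carrier G. f g = f' g"
  then have "fourier G f \<pi> = fourier G f' \<pi>" for \<pi>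
    by (intro fourier_cong) simp
  then show "\<forall>\<pi>\<in>R. fourier G f \<pi> = fourier G f' \<pi>" by simp
next
  assume *: "\<forall>\<pi>\<in>R. fourier G f \<pi> = fourier G f' \<pi>"
  have "restrict f (carrier G) = restrict f' (carrier G)"
  proof (rule fourier_injective[OF is_group finite_carrier representatives])
    fix \<pi> assume "\<pi> \<in> R"
    have "fourier G (restrict f (carrier G)) \<pi> = fourier G f \<pi>"
      "fourier G (restrict f' (carrier G)) \<pi> = fourier G f' \<pi>"
      by (rule fourier_cong, simp)+
    then show "fourier G (restrict f (carrier G)) \<pi> = fourier G (restrict f' (carrier G)) \<pi>"
      using * \<open>\<pi> \<in> R\<close> by simp
  qed auto
  then have "restrict f (carrier G) g = restrict f' (carrier G) g" for g by simp
  then show "\<forall>g\<in>carrier G. f g = f' g" by (metis restrict_apply')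
qed

lemma left_invariant_iff_fourier:
  assumes h: "h \<in> carrier G"
  shows "(\<forall>g\<in>carrier G. f (h \<otimes> g) = f g) \<longleftrightarrow> (\<forall>\<pi>\<in>R. \<pi> h * fourier G f \<pi> = fourier G f \<pi>)"
proof -
  have "fourier G (\<lambda>g. f (h \<otimes> g)) \<pi> = fourier G f \<pi> \<longleftrightarrow> \<pi> h * fourier G f \<pi> = fourier G f \<pi>"
    if \<pi>: "\<pi> \<in> R" for \<pi>
  proof -
    have t: "\<pi> h * fourier G (\<lambda>g. f (h \<otimes> g)) \<pi> = fourier G f \<pi>"
      by (rule fourier_left_translate[OF is_group rep[OF \<pi>] h])
    have "fourier G (\<lambda>g. f (h \<otimes> g)) \<pi> = fourier G f \<pi>" if "\<pi> h * fourier G f \<pi> = fourier G f \<pi>"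
      by (rule mult_left_cancel_mat[OF is_rep_carrier[OF rep[OF \<pi>] h] is_rep_carrier[OF rep[OF \<pi>], of "inv h"]
            rep_inv(1)[OF is_group rep[OF \<pi>] h], where m = "rep_dim G \<pi>"]) (use t that h in auto)
    then show ?thesis using t by metis
  qed
  then show ?thesis unfolding eq_on_carrier_iff_fourier by blast
qed

lemma right_invariant_iff_fourier:
  assumes h: "h \<in> carrier G"
  shows "(\<forall>g\<in>carrier G. f (g \<otimes> h) = f g) \<longleftrightarrow> (\<forall>\<pi>\<in>R. fourier G f \<pi> * \<pi> h = fourier G f \<pi>)"
proof -
  have "fourier G (\<lambda>g. f (g \<otimes> h)) \<pi> = fourier G f \<pi> \<longleftrightarrow> fourier G f \<pi> * \<pi> h = fourier G f \<pi>"
    if \<pi>: "\<pi> \<in> R" for \<pi>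
  proof -
    have t: "fourier G (\<lambda>g. f (g \<otimes> h)) \<pi> * \<pi> h = fourier G f \<pi>"
      by (rule fourier_right_translate[OF is_group rep[OF \<pi>] h])
    have "fourier G (\<lambda>g. f (g \<otimes> h)) \<pi> = fourier G f \<pi>" if "fourier G f \<pi> * \<pi> h = fourier G f \<pi>"
      by (rule mult_right_cancel_mat[OF is_rep_carrier[OF rep[OF \<pi>] h] is_rep_carrier[OF rep[OF \<pi>], of "inv h"]
            rep_inv(2)[OF is_group rep[OF \<pi>] h], where m = "rep_dim G \<pi>"]) (use t that h in auto)
    then show ?thesis using t by metis
  qed
  then show ?thesis unfolding eq_on_carrier_iff_fourier by blast
qed

lemma anti_invariant_iff_fourier:
  "(\<forall>g\<in>carrier G. f (\<theta> (inv g)) = - f g) \<longleftrightarrow>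
    (\<forall>\<pi>\<in>R. transpose_mat (fourier G f (\<tau> \<pi>)) = - fourier G f \<pi>)"
  unfolding eq_on_carrier_iff_fourier
proof (rule ball_cong[OF refl])
  fix \<pi> assume "\<pi> \<in> R"
  show "fourier G (\<lambda>g. f (\<theta> (inv g))) \<pi> = fourier G (\<lambda>g. - f g) \<pi> \<longleftrightarrow>
      transpose_mat (fourier G f (\<tau> \<pi>)) = - fourier G f \<pi>"
    by (simp only: fourier_twist[OF rep[OF \<open>\<pi> \<in> R\<close>], of f] fourier_uminus[of G f \<pi>])
qed

lemma anti_invariant_functions_iff:
  assumes H: "subgroup H G"
  shows "f \<in> carrier (anti_invariant_functions G \<theta> H) \<longleftrightarrow> f \<in> carrier G \<rightarrow>\<^sub>E UNIV \<and>
    (\<forall>\<pi>\<in>R. (\<forall>h\<in>H. \<pi> h * fourier G f \<pi> = fourier G f \<pi>) \<and>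
      (\<forall>h\<in>H. fourier G f \<pi> * \<pi> (\<theta> h) = fourier G f \<pi>) \<and>
      transpose_mat (fourier G f (\<tau> \<pi>)) = - fourier G f \<pi>)"
proof -
  have HG: "h \<in> carrier G" "\<theta> h \<in> carrier G" if "h \<in> H" for h
    using H that by (auto simp: subgroup_def)
  have "f \<in> carrier (anti_invariant_functions G \<theta> H) \<longleftrightarrow> f \<in> carrier G \<rightarrow>\<^sub>E UNIV \<and>
      (\<forall>h\<in>H. \<forall>g\<in>carrier G. f (h \<otimes> g) = f g) \<and>
      (\<forall>h\<in>H. \<forall>g\<in>carrier G. f (g \<otimes> \<theta> h) = f g) \<and>
      (\<forall>g\<in>carrier G. f (\<theta> (inv g)) = - f g)"
    by (simp add: anti_invariant_functions_def)
  also have "(\<forall>h\<in>H. \<forall>g\<in>carrier G. f (h \<otimes> g) = f g) \<longleftrightarrow>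
      (\<forall>h\<in>H. \<forall>\<pi>\<in>R. \<pi> h * fourier G f \<pi> = fourier G f \<pi>)"
    by (rule ball_cong[OF refl]) (rule left_invariant_iff_fourier[OF HG(1)])
  also have "(\<forall>h\<in>H. \<forall>g\<in>carrier G. f (g \<otimes> \<theta> h) = f g) \<longleftrightarrow>
      (\<forall>h\<in>H. \<forall>\<pi>\<in>R. fourier G f \<pi> * \<pi> (\<theta> h) = fourier G f \<pi>)"
    by (rule ball_cong[OF refl]) (rule right_invariant_iff_fourier[OF HG(2)])
  finally show ?thesis unfolding anti_invariant_iff_fourier by blast
qed

end

context twisted_group
begin

text \<open>The dual is the twisted dual for the trivial involution.\<close>

lemma dual_is_rep:
  assumes "is_rep G \<pi>"
  shows "is_rep G (dual_rep G \<pi>) \<and> rep_dim G (dual_rep G \<pi>) = rep_dim G \<pi>"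
proof -
  interpret id: twisted_group G "\<lambda>g. g"
    by unfold_locales (auto simp: finite_carrier hom_def)
  have "twisted_dual G (\<lambda>g. g) \<pi> = dual_rep G \<pi>"
    by (auto simp: twisted_dual_def dual_rep_def compose_def)
  then show ?thesis using id.twisted_dual_rep[OF assms] by simp
qed

lemma theta_image_subgroup:
  assumes "subgroup H G"
  shows "subgroup (\<theta> ` H) G"
proof -
  interpret t: group_hom G G \<theta>
    using theta_hom by unfold_locales
  show ?thesis by (rule t.subgroup_img_is_subgroup[OF assms])
qed

lemma zero_tensor_iff:
  assumes rep: "is_rep G \<pi>" and n: "rep_dim G \<pi> = n" and H: "subgroup H G"
  shows "T \<in> carrier (tensor_space n n (invariants G \<pi> H) (invariants G (dual_rep G \<pi>) (\<theta> ` H))) \<longleftrightarrow>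
    T \<in> carrier_mat n n \<and> (\<forall>h\<in>H. \<pi> h * T = T) \<and> (\<forall>h\<in>H. T * \<pi> (\<theta> h) = T)"
proof -
  have d: "is_rep G (dual_rep G \<pi>)" "rep_dim G (dual_rep G \<pi>) = n" using dual_is_rep[OF rep] n by auto
  have HG: "h \<in> carrier G" "inv h \<in> H" if "h \<in> H" for h
    using H that by (auto simp: subgroup_def)
  have "dual_rep G \<pi> (\<theta> h) * transpose_mat T = transpose_mat T \<longleftrightarrow> T * \<pi> (\<theta> (inv h)) = T"
    if h: "h \<in> H" and T: "T \<in> carrier_mat n n" for h
  proof -
    have c: "\<pi> (\<theta> (inv h)) \<in> carrier_mat n n"
      using is_rep_carrier[OF rep, of "\<theta> (inv h)"] HG[OF h] n by simp
    have "dual_rep G \<pi> (\<theta> h) = transpose_mat (\<pi> (\<theta> (inv h)))"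
      using HG[OF h] by (simp add: dual_rep_def theta_inv)
    then have "dual_rep G \<pi> (\<theta> h) * transpose_mat T = transpose_mat (T * \<pi> (\<theta> (inv h)))"
      using transpose_mult[OF T c] by simp
    then show ?thesis by (metis transpose_transpose)
  qed
  then have "(\<forall>k\<in>\<theta> ` H. dual_rep G \<pi> k * transpose_mat T = transpose_mat T) \<longleftrightarrow>
      (\<forall>h\<in>H. T * \<pi> (\<theta> (inv h)) = T)" if "T \<in> carrier_mat n n"
    using that by simp
  moreover have "(\<forall>h\<in>H. T * \<pi> (\<theta> (inv h)) = T) \<longleftrightarrow> (\<forall>h\<in>H. T * \<pi> (\<theta> h) = T)"
    using HG by (metis inv_inv)
  ultimately show ?thesis
    unfolding tensor_space_invariants[OF is_group finite_carrier rep d(1) n d(2) H theta_image_subgroup[OF H]]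
    by blast
qed

text \<open>For an eigenvector of the transposition, invariance of the columns implies that of the rows.\<close>

lemma square_tensor_iff:
  assumes rep: "is_rep G \<pi>" and n: "rep_dim G \<pi> = n" and H: "subgroup H G"
    and T: "transpose_mat T = c \<cdot>\<^sub>m T"
  shows "T \<in> carrier (tensor_space n n (invariants G \<pi> H) (invariants G \<pi> H)) \<longleftrightarrow>
    T \<in> carrier_mat n n \<and> (\<forall>h\<in>H. \<pi> h * T = T)"
proof -
  have c: "\<pi> h \<in> carrier_mat n n" if "h \<in> H" for h
    using is_rep_carrier[OF rep, of h] H that n by (auto simp: subgroup_def)
  have "\<pi> h * transpose_mat T = transpose_mat T" if "h \<in> H" "T \<in> carrier_mat n n" "\<pi> h * T = T" for h
    unfolding T using that mult_smult_distrib[OF c[OF that(1)] that(2)] by simp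
  then show ?thesis
    unfolding tensor_space_invariants[OF is_group finite_carrier rep rep n n H H] by blast
qed

text \<open>
  With \<open>T = A * Q\<close>, so that \<open>A = T * P\<close>, the matrix \<open>P * A * Q\<close> is \<open>P * T\<close>, with transpose
  \<open>\<epsilon> T\<^sup>T * P\<close>; cancelling \<open>P\<close> against \<open>- A = - T * P\<close> gives the eigenvalue of \<open>T\<close>. The
  intertwiner turns \<open>\<pi> (\<theta> h)\<close> on the right of \<open>A\<close> into the transpose of \<open>\<pi> (inv h)\<close> on
  the right of \<open>T\<close>, so right invariance of \<open>A\<close> follows from left invariance and
  the symmetry of \<open>T\<close>.
\<close>

lemma anti_invariant_coefficient_iff:
  assumes rep: "is_rep G \<pi>" and n: "rep_dim G \<pi> = n" and H: "H \<subseteq> carrier G"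
    and P: "P \<in> carrier_mat n n" "Q \<in> carrier_mat n n" "Q * P = 1\<^sub>m n" "P * Q = 1\<^sub>m n"
    and tw: "\<And>g. g \<in> carrier G \<Longrightarrow> P * \<pi> g = twisted_dual G \<theta> \<pi> g * P"
    and \<epsilon>: "transpose_mat P = \<epsilon> \<cdot>\<^sub>m P" "\<epsilon> * \<epsilon> = 1"
    and A: "A \<in> carrier_mat n n"
  shows "(\<forall>h\<in>H. \<pi> h * A = A) \<and> (\<forall>h\<in>H. A * \<pi> (\<theta> h) = A) \<and> transpose_mat (P * A * Q) = - A \<longleftrightarrow>
    (\<forall>h\<in>H. \<pi> h * (A * Q) = A * Q) \<and> transpose_mat (A * Q) = (- \<epsilon>) \<cdot>\<^sub>m (A * Q)"
proof -
  define T where "T = A * Q"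
  have T: "T \<in> carrier_mat n n" using A P by (simp add: T_def)
  have c: "\<pi> g \<in> carrier_mat n n" if "g \<in> carrier G" for g
    using is_rep_carrier[OF rep that] n by simp
  have AT: "A = T * P"
    unfolding T_def using A P by (simp add: assoc_mult_mat[of _ n n _ n _ n])
  have left: "\<pi> h * A = A \<longleftrightarrow> \<pi> h * T = T" if "h \<in> carrier G" for h
  proof
    assume "\<pi> h * A = A"
    then show "\<pi> h * T = T"
      unfolding T_def using assoc_mult_mat[OF c[OF that] A P(2)] by simp
  next
    assume "\<pi> h * T = T"
    then show "\<pi> h * A = A"
      unfolding AT using assoc_mult_mat[OF c[OF that] T P(1)] by simp
  qed
  have "transpose_mat (P * A * Q) = transpose_mat (P * T)"
    unfolding T_def using assoc_mult_mat[OF P(1) A P(2)] by simp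
  also have "\<dots> = \<epsilon> \<cdot>\<^sub>m transpose_mat T * P"
    unfolding transpose_mult[OF P(1) T] \<epsilon>(1) using T P(1)
    by (simp add: mult_smult_distrib[of _ n n _ n] mult_smult_assoc_mat[of _ n n _ n])
  finally have twist: "transpose_mat (P * A * Q) = - A \<longleftrightarrow> \<epsilon> \<cdot>\<^sub>m transpose_mat T * P = (- 1) \<cdot>\<^sub>m T * P"
    using T P(1) by (simp add: uminus_mat_eq_smult AT mult_smult_assoc_mat[of _ n n _ n])
  also have "\<dots> \<longleftrightarrow> \<epsilon> \<cdot>\<^sub>m transpose_mat T = (- 1) \<cdot>\<^sub>m T"
    using mult_right_cancel_mat[OF P(1,2,4), of "\<epsilon> \<cdot>\<^sub>m transpose_mat T" n "(- 1) \<cdot>\<^sub>m T"] T by auto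
  also have "\<dots> \<longleftrightarrow> transpose_mat T = (- \<epsilon>) \<cdot>\<^sub>m T"
  proof
    assume "\<epsilon> \<cdot>\<^sub>m transpose_mat T = (- 1) \<cdot>\<^sub>m T"
    then have "\<epsilon> \<cdot>\<^sub>m (\<epsilon> \<cdot>\<^sub>m transpose_mat T) = \<epsilon> \<cdot>\<^sub>m ((- 1) \<cdot>\<^sub>m T)" by simp
    then show "transpose_mat T = (- \<epsilon>) \<cdot>\<^sub>m T"
      by (simp add: smult_smult_mat \<epsilon>(2) one_smult_mat)
  next
    assume *: "transpose_mat T = (- \<epsilon>) \<cdot>\<^sub>m T"
    show "\<epsilon> \<cdot>\<^sub>m transpose_mat T = (- 1) \<cdot>\<^sub>m T"
      unfolding * smult_smult_mat using \<epsilon>(2) by simp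
  qed
  finally have twist: "transpose_mat (P * A * Q) = - A \<longleftrightarrow> transpose_mat T = (- \<epsilon>) \<cdot>\<^sub>m T" .
  have right: "A * \<pi> (\<theta> h) = A"
    if h: "h \<in> carrier G" and fixed: "\<pi> h * T = T" and sym: "transpose_mat T = (- \<epsilon>) \<cdot>\<^sub>m T" for h
  proof -
    have ci: "\<pi> (inv h) \<in> carrier_mat n n" using c h by simp
    have ct: "transpose_mat (\<pi> (inv h)) \<in> carrier_mat n n" using ci by simp
    have "transpose_mat (T * transpose_mat (\<pi> (inv h))) = \<pi> (inv h) * transpose_mat T"
      using transpose_mult[OF T ct] by simp
    also have "\<dots> = transpose_mat T"
      unfolding sym mult_smult_distrib[OF ci T] rep_inv_fixes[OF is_group rep n h T fixed] ..
    finally have Tt: "T * transpose_mat (\<pi> (inv h)) = T" by simp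
    have "A * \<pi> (\<theta> h) = T * (P * \<pi> (\<theta> h))"
      unfolding AT using T P(1) c[of "\<theta> h"] h by (simp add: assoc_mult_mat[of _ n n _ n _ n])
    also have "P * \<pi> (\<theta> h) = transpose_mat (\<pi> (inv h)) * P"
      using tw[of "\<theta> h"] h by (simp add: twisted_dual_apply theta_theta)
    also have "T * (transpose_mat (\<pi> (inv h)) * P) = A"
      unfolding AT using assoc_mult_mat[OF T ct P(1)] Tt by simp
    finally show ?thesis .
  qed
  show ?thesis
    unfolding twist T_def[symmetric] using left right H by blast
qed

end

section \<open>The decomposition\<close>

lemma ext_square_simps:
  "carrier (ext_square n U) = {T \<in> carrier (tensor_space n n U U). transpose_mat T = - T}"
  "\<zero>\<^bsub>ext_square n U\<^esub> = 0\<^sub>m n n" "A \<oplus>\<^bsub>ext_square n U\<^esub> B = A + B"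
  "c \<odot>\<^bsub>ext_square n U\<^esub> A = c \<cdot>\<^sub>m A"
  by (simp_all add: ext_square_def tensor_space_simps)

lemma sym_square_simps:
  "carrier (sym_square n U) = {T \<in> carrier (tensor_space n n U U). transpose_mat T = T}"
  "\<zero>\<^bsub>sym_square n U\<^esub> = 0\<^sub>m n n" "A \<oplus>\<^bsub>sym_square n U\<^esub> B = A + B"
  "c \<odot>\<^bsub>sym_square n U\<^esub> A = c \<cdot>\<^sub>m A"
  by (simp_all add: sym_square_def tensor_space_simps)

lemma func_space_simps:
  "carrier (ring.func_space class_ring S) = S \<rightarrow>\<^sub>E (UNIV :: complex set)"
  "\<zero>\<^bsub>ring.func_space class_ring S\<^esub> = (\<lambda>x\<in>S. 0 :: complex)"
  "f \<oplus>\<^bsub>ring.func_space class_ring S\<^esub> f' = (\<lambda>x\<in>S. f x + f' x :: complex)"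
  "c \<odot>\<^bsub>ring.func_space class_ring S\<^esub> f = (\<lambda>x\<in>S. c * f x :: complex)"
  by (simp_all add: class_ring.func_space_def)

lemma anti_invariant_functions_simps:
  "f \<oplus>\<^bsub>anti_invariant_functions G \<theta> H\<^esub> f' = (\<lambda>x\<in>carrier G. f x + f' x)"
  "c \<odot>\<^bsub>anti_invariant_functions G \<theta> H\<^esub> f = (\<lambda>x\<in>carrier G. c * f x)"
  using func_space_simps(3,4) by (simp_all add: anti_invariant_functions_def)

lemma anti_invariant_functions_vs:
  fixes G :: "('g, 'b) monoid_scheme"
  assumes "group G" "\<theta> \<in> hom G G" "H \<subseteq> carrier G"
  shows "vectorspace class_ring (anti_invariant_functions G \<theta> H)"
proof -
  interpret group G by fact
  have th: "\<theta> g \<in> carrier G" if "g \<in> carrier G" for g using assms(2) that by (auto simp: hom_def)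
  have hG: "h \<in> carrier G" if "h \<in> H" for h using assms(3) that by blast
  have vs: "vectorspace class_ring (ring.func_space class_ring (carrier G) :: (complex, 'g \<Rightarrow> complex) module)"
    by (rule vectorspace.func_space_is_vs[OF matrix_vs[of 0 0]])
  have "VectorSpace.subspace class_ring (carrier (anti_invariant_functions G \<theta> H))
      (ring.func_space class_ring (carrier G))"
    unfolding VectorSpace.subspace_def submodule_def func_space_simps
    using vs vectorspace.axioms(1)[OF vs] th hG
    by (auto simp: anti_invariant_functions_def)
  from vectorspace.subspace_is_vs[OF vs this] show ?thesis
    by (simp add: anti_invariant_functions_def)
qed

lemma invariants_subset: "invariants G \<pi> K \<subseteq> carrier_vec (rep_dim G \<pi>)"
  by (auto simp: invariants_def)

context twisted_group_irr
begin

lemma indicator_zero_iff: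
  assumes "\<pi> \<in> R"
  shows "fs_indicator G \<theta> \<pi> = 0 \<longleftrightarrow> \<not> rep_iso G \<pi> (\<tau> \<pi>)"
proof (cases "rep_iso G \<pi> (\<tau> \<pi>)")
  case True
  have "fs_indicator G \<theta> \<pi> \<in> {1, -1}"
    by (rule fs_indicator_iso[OF irreducible[OF assms] True refl]) blast
  then show ?thesis using True by auto
next
  case False
  then show ?thesis using fs_indicator_not_iso[OF irreducible[OF assms]] by simp
qed

lemma indicator_cases:
  assumes "\<pi> \<in> R"
  obtains "\<pi> \<in> irr_with G \<theta> R 0" | "\<pi> \<in> irr_with G \<theta> R 1" | "\<pi> \<in> irr_with G \<theta> R (-1)"
proof (cases "rep_iso G \<pi> (\<tau> \<pi>)")
  case True
  have "fs_indicator G \<theta> \<pi> \<in> {1, -1}"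
    by (rule fs_indicator_iso[OF irreducible[OF assms] True refl]) blast
  then show ?thesis using that assms by auto
next
  case False
  then show ?thesis using fs_indicator_not_iso[OF irreducible[OF assms]] that assms by simp
qed

text \<open>The swap is therefore well defined on the sum over the representations of indicator zero.\<close>

lemma twisted_dual_zero_indicator:
  assumes "\<pi> \<in> irr_with G \<theta> R 0"
  shows "\<tau> \<pi> \<in> irr_with G \<theta> R 0"
proof -
  have \<pi>: "\<pi> \<in> R" and not_iso: "\<not> rep_iso G \<pi> (\<tau> \<pi>)"
    using assms indicator_zero_iff by auto
  have \<tau>: "\<tau> \<pi> \<in> R"
    using representatives \<pi> not_iso by (simp add: irr_representatives_def)
  have "\<tau> (\<tau> \<pi>) = \<pi>"
    by (rule twisted_dual_involution[OF is_group theta_hom theta_theta rep[OF \<pi>]])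
  then have "\<not> rep_iso G (\<tau> \<pi>) (\<tau> (\<tau> \<pi>))"
    using rep_iso_sym[OF rep[OF \<tau>] rep[OF \<pi>]] not_iso by auto
  then show ?thesis using \<tau> indicator_zero_iff by simp
qed

definition intertwiner_pair :: "('g \<Rightarrow> complex mat) \<Rightarrow> complex mat \<Rightarrow> complex mat \<Rightarrow> bool" where
  "intertwiner_pair \<pi> P Q \<longleftrightarrow>
    P \<in> carrier_mat (rep_dim G \<pi>) (rep_dim G \<pi>) \<and> Q \<in> carrier_mat (rep_dim G \<pi>) (rep_dim G \<pi>) \<and>
    Q * P = 1\<^sub>m (rep_dim G \<pi>) \<and> P * Q = 1\<^sub>m (rep_dim G \<pi>) \<and>
    (\<forall>g\<in>carrier G. P * \<pi> g = \<tau> \<pi> g * P) \<and>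
    transpose_mat P = of_int (fs_indicator G \<theta> \<pi>) \<cdot>\<^sub>m P"

lemma intertwiner_choice:
  obtains P Q where "\<forall>\<pi>\<in>R. fs_indicator G \<theta> \<pi> \<noteq> 0 \<longrightarrow> intertwiner_pair \<pi> (P \<pi>) (Q \<pi>)"
proof -
  have "\<exists>p q. \<pi> \<in> R \<longrightarrow> fs_indicator G \<theta> \<pi> \<noteq> 0 \<longrightarrow> intertwiner_pair \<pi> p q" for \<pi>
  proof (cases "\<pi> \<in> R \<and> fs_indicator G \<theta> \<pi> \<noteq> 0")
    case True
    then have "rep_iso G \<pi> (\<tau> \<pi>)" using indicator_zero_iff by blast
    from fs_indicator_iso[OF irreducible this refl] True
    show ?thesis unfolding intertwiner_pair_def by metis
  qed auto
  then obtain P Q where "\<And>\<pi>. \<pi> \<in> R \<longrightarrow> fs_indicator G \<theta> \<pi> \<noteq> 0 \<longrightarrow> intertwiner_pair \<pi> (P \<pi>) (Q \<pi>)" by metis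
  then show ?thesis using that[of P Q] by blast
qed

lemma zero_sum_carrier:
  "carrier (zero_indicator_sum G \<theta> H R) = Pi\<^sub>E (irr_with G \<theta> R 0) (\<lambda>\<pi>. carrier
    (tensor_space (rep_dim G \<pi>) (rep_dim G \<pi>) (invariants G \<pi> H) (invariants G (dual_rep G \<pi>) (\<theta> ` H))))"
  using finite_R by (simp add: zero_indicator_sum_def direct_sum_family_simps)

lemma zero_sum_simps:
  "\<zero>\<^bsub>zero_indicator_sum G \<theta> H R\<^esub> = (\<lambda>\<pi>\<in>irr_with G \<theta> R 0. 0\<^sub>m (rep_dim G \<pi>) (rep_dim G \<pi>))"
  "S \<oplus>\<^bsub>zero_indicator_sum G \<theta> H R\<^esub> T = (\<lambda>\<pi>\<in>irr_with G \<theta> R 0. S \<pi> + T \<pi>)"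
  "c \<odot>\<^bsub>zero_indicator_sum G \<theta> H R\<^esub> T = (\<lambda>\<pi>\<in>irr_with G \<theta> R 0. c \<cdot>\<^sub>m T \<pi>)"
  by (simp_all add: zero_indicator_sum_def direct_sum_family_simps tensor_space_simps)

lemma zero_summand_submodule:
  assumes "\<pi> \<in> R"
  shows "submodule class_ring (carrier (tensor_space (rep_dim G \<pi>) (rep_dim G \<pi>)
      (invariants G \<pi> H) (invariants G (dual_rep G \<pi>) (\<theta> ` H))))
    (module_mat TYPE(complex) (rep_dim G \<pi>) (rep_dim G \<pi>))"
  using invariants_subset[of G \<pi> H] invariants_subset[of G "dual_rep G \<pi>"] dual_is_rep[OF rep[OF assms]]
  by (intro tensor_space_submodule) auto

lemma zero_sum_vs: "vectorspace class_ring (zero_indicator_sum G \<theta> H R)"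
  unfolding zero_indicator_sum_def
proof (rule direct_sum_family_vs[OF class_field])
  fix \<pi> assume "\<pi> \<in> irr_with G \<theta> R 0"
  then have "is_rep G \<pi>" using rep by simp
  then show "vectorspace class_ring (tensor_space (rep_dim G \<pi>) (rep_dim G \<pi>)
      (invariants G \<pi> H) (invariants G (dual_rep G \<pi>) (\<theta> ` H)))"
    using invariants_subset[of G \<pi> H] invariants_subset[of G "dual_rep G \<pi>"] dual_is_rep[of \<pi>]
    by (intro tensor_space_vs) auto
qed

lemma zero_sum_sign_carrier:
  "T \<in> carrier (zero_indicator_sum_sign G \<theta> H R) \<longleftrightarrow> T \<in> carrier (zero_indicator_sum G \<theta> H R) \<and>
    (\<forall>\<pi>\<in>irr_with G \<theta> R 0. transpose_mat (T (\<tau> \<pi>)) = - T \<pi>)"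
proof -
  interpret vectorspace class_ring "zero_indicator_sum G \<theta> H R" by (rule zero_sum_vs)
  have "\<ominus>\<^bsub>zero_indicator_sum G \<theta> H R\<^esub> T = (\<lambda>\<pi>\<in>irr_with G \<theta> R 0. - T \<pi>)"
    if "T \<in> carrier (zero_indicator_sum G \<theta> H R)"
    using smult_minus_1[OF that] by (simp add: class_ring_simps zero_sum_simps uminus_mat_eq_smult)
  moreover have "swap G \<theta> R T = (\<lambda>\<pi>\<in>irr_with G \<theta> R 0. - T \<pi>) \<longleftrightarrow>
      (\<forall>\<pi>\<in>irr_with G \<theta> R 0. transpose_mat (T (\<tau> \<pi>)) = - T \<pi>)"
    unfolding swap_def by (metis (no_types, lifting) restrict_apply' restrict_ext)
  ultimately show ?thesis by (auto simp: zero_indicator_sum_sign_def)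
qed

lemma zero_sum_sign_simps:
  "S \<oplus>\<^bsub>zero_indicator_sum_sign G \<theta> H R\<^esub> T = (\<lambda>\<pi>\<in>irr_with G \<theta> R 0. S \<pi> + T \<pi>)"
  "c \<odot>\<^bsub>zero_indicator_sum_sign G \<theta> H R\<^esub> T = (\<lambda>\<pi>\<in>irr_with G \<theta> R 0. c \<cdot>\<^sub>m T \<pi>)"
  using zero_sum_simps(2,3) by (simp_all add: zero_indicator_sum_sign_def)

lemma zero_sum_sign_vs: "vectorspace class_ring (zero_indicator_sum_sign G \<theta> H R)"
proof -
  let ?Z = "zero_indicator_sum G \<theta> H R"
  let ?S = "carrier (zero_indicator_sum_sign G \<theta> H R)"
  interpret vectorspace class_ring ?Z by (rule zero_sum_vs)
  have mat: "T \<pi> \<in> carrier_mat (rep_dim G \<pi>) (rep_dim G \<pi>)"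
    if "T \<in> carrier ?Z" "\<pi> \<in> irr_with G \<theta> R 0" for T \<pi>
    using that zero_summand_submodule[of \<pi> H] unfolding zero_sum_carrier submodule_mat_iff by fastforce
  have dim: "rep_dim G (\<tau> \<pi>) = rep_dim G \<pi>" if "\<pi> \<in> irr_with G \<theta> R 0" for \<pi>
    using twisted_dual_rep[OF rep] that by simp
  have "submodule class_ring ?S ?Z"
  proof (rule submodule.intro)
    show "Module.module class_ring ?Z" by (rule module_axioms)
    show "?S \<subseteq> carrier ?Z" using zero_sum_sign_carrier by blast
    show "\<zero>\<^bsub>?Z\<^esub> \<in> ?S"
      unfolding zero_sum_sign_carrier
    proof (intro conjI ballI)
      fix \<pi> assume \<pi>: "\<pi> \<in> irr_with G \<theta> R 0"
      show "transpose_mat (\<zero>\<^bsub>?Z\<^esub> (\<tau> \<pi>)) = - \<zero>\<^bsub>?Z\<^esub> \<pi>"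
        using \<pi> twisted_dual_zero_indicator[OF \<pi>] dim[OF \<pi>]
        by (auto simp only: zero_sum_simps restrict_apply') auto
    qed (rule M.zero_closed)
  next
    fix S T assume ST: "S \<in> ?S" "T \<in> ?S"
    then have c: "S \<in> carrier ?Z" "T \<in> carrier ?Z" using zero_sum_sign_carrier by blast+
    show "S \<oplus>\<^bsub>?Z\<^esub> T \<in> ?S"
      unfolding zero_sum_sign_carrier
    proof (intro conjI ballI)
      fix \<pi> assume \<pi>: "\<pi> \<in> irr_with G \<theta> R 0"
      note \<tau>\<pi> = twisted_dual_zero_indicator[OF \<pi>]
      have "transpose_mat (S (\<tau> \<pi>) + T (\<tau> \<pi>)) = - S \<pi> + - T \<pi>"
        using ST \<pi> transpose_add[OF mat[OF c(1) \<tau>\<pi>] mat[OF c(2) \<tau>\<pi>]] by (simp add: zero_sum_sign_carrier)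
      also have "\<dots> = - (S \<pi> + T \<pi>)"
        using mat[OF c(1) \<pi>] mat[OF c(2) \<pi>] by (intro eq_matI) auto
      finally show "transpose_mat ((S \<oplus>\<^bsub>?Z\<^esub> T) (\<tau> \<pi>)) = - (S \<oplus>\<^bsub>?Z\<^esub> T) \<pi>"
        using \<pi> \<tau>\<pi> by (simp only: zero_sum_simps restrict_apply')
    qed (use c in simp)
  next
    fix a T assume T: "T \<in> ?S"
    then have c: "T \<in> carrier ?Z" using zero_sum_sign_carrier by blast
    show "a \<odot>\<^bsub>?Z\<^esub> T \<in> ?S"
      unfolding zero_sum_sign_carrier
    proof (intro conjI ballI)
      fix \<pi> assume \<pi>: "\<pi> \<in> irr_with G \<theta> R 0"
      note \<tau>\<pi> = twisted_dual_zero_indicator[OF \<pi>]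
      have "transpose_mat (a \<cdot>\<^sub>m T (\<tau> \<pi>)) = a \<cdot>\<^sub>m - T \<pi>"
        using T \<pi> by (simp add: zero_sum_sign_carrier transpose_smult)
      also have "\<dots> = - (a \<cdot>\<^sub>m T \<pi>)" by (intro eq_matI) auto
      finally show "transpose_mat ((a \<odot>\<^bsub>?Z\<^esub> T) (\<tau> \<pi>)) = - (a \<odot>\<^bsub>?Z\<^esub> T) \<pi>"
        using \<pi> \<tau>\<pi> by (simp only: zero_sum_simps restrict_apply')
    qed (use c in \<open>simp add: class_ring_simps\<close>)
  qed
  then have "VectorSpace.subspace class_ring ?S ?Z"
    unfolding VectorSpace.subspace_def using vectorspace_axioms by blast
  from subspace_is_vs[OF this] show ?thesis
    by (simp add: zero_indicator_sum_sign_def)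
qed

text \<open>
  The isomorphism takes Fourier coefficients, and for indicator \<open>\<plusminus>1\<close> multiplies them on the right by
  the inverse of an intertwiner to the twisted dual. On all functions it is a bijection onto all
  families of matrices. It remains to match the conditions cutting out the two sides, summand by
  summand.
\<close>

theorem decomposition:
  assumes H: "subgroup H G"
  shows "\<exists>\<Phi>. linear_map class_ring
      (anti_invariant_functions G \<theta> H)
      (direct_sum (zero_indicator_sum_sign G \<theta> H R)
        (direct_sum
          (direct_sum_family (irr_with G \<theta> R 1) (\<lambda>\<pi>. ext_square (rep_dim G \<pi>) (invariants G \<pi> H)))
          (direct_sum_family (irr_with G \<theta> R (-1)) (\<lambda>\<pi>. sym_square (rep_dim G \<pi>) (invariants G \<pi> H)))))
      \<Phi> \<and>
    bij_betw \<Phi>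
      (carrier (anti_invariant_functions G \<theta> H))
      (carrier (direct_sum (zero_indicator_sum_sign G \<theta> H R)
        (direct_sum
          (direct_sum_family (irr_with G \<theta> R 1) (\<lambda>\<pi>. ext_square (rep_dim G \<pi>) (invariants G \<pi> H)))
          (direct_sum_family (irr_with G \<theta> R (-1)) (\<lambda>\<pi>. sym_square (rep_dim G \<pi>) (invariants G \<pi> H))))))"
proof -
  define V where "V = anti_invariant_functions G \<theta> H"
  define W0 where "W0 = zero_indicator_sum_sign G \<theta> H R"
  define W1 where "W1 = direct_sum_family (irr_with G \<theta> R 1) (\<lambda>\<pi>. ext_square (rep_dim G \<pi>) (invariants G \<pi> H))"
  define W2 where "W2 = direct_sum_family (irr_with G \<theta> R (-1)) (\<lambda>\<pi>. sym_square (rep_dim G \<pi>) (invariants G \<pi> H))"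
  define W where "W = direct_sum W0 (direct_sum W1 W2)"
  have HG: "H \<subseteq> carrier G" using H by (simp add: subgroup_def)
  obtain P Q where pair: "\<forall>\<pi>\<in>R. fs_indicator G \<theta> \<pi> \<noteq> 0 \<longrightarrow> intertwiner_pair \<pi> (P \<pi>) (Q \<pi>)"
    by (rule intertwiner_choice)
  note PQ = pair[unfolded intertwiner_pair_def, rule_format]
  have Pc: "P \<pi> \<in> carrier_mat (rep_dim G \<pi>) (rep_dim G \<pi>)"
    and Qc: "Q \<pi> \<in> carrier_mat (rep_dim G \<pi>) (rep_dim G \<pi>)"
    and PQ1: "P \<pi> * Q \<pi> = 1\<^sub>m (rep_dim G \<pi>)"
    if "\<pi> \<in> irr_with G \<theta> R 1 \<union> irr_with G \<theta> R (-1)" for \<pi>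
    using PQ[of \<pi>] that by auto
  define \<Phi> where "\<Phi> f = ((\<lambda>\<pi>\<in>irr_with G \<theta> R 0. fourier G f \<pi>),
    (\<lambda>\<pi>\<in>irr_with G \<theta> R 1. fourier G f \<pi> * Q \<pi>), (\<lambda>\<pi>\<in>irr_with G \<theta> R (-1). fourier G f \<pi> * Q \<pi>))"
    for f :: "'g \<Rightarrow> complex"
  define C where "C f \<pi> \<longleftrightarrow> (\<forall>h\<in>H. \<pi> h * fourier G f \<pi> = fourier G f \<pi>) \<and>
      (\<forall>h\<in>H. fourier G f \<pi> * \<pi> (\<theta> h) = fourier G f \<pi>) \<and>
      transpose_mat (fourier G f (\<tau> \<pi>)) = - fourier G f \<pi>" for f \<pi>
  have V_iff: "f \<in> carrier V \<longleftrightarrow> f \<in> carrier G \<rightarrow>\<^sub>E UNIV \<and> (\<forall>\<pi>\<in>R. C f \<pi>)" for f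
    unfolding V_def C_def by (rule anti_invariant_functions_iff[OF H])
  have C0: "C f \<pi> \<longleftrightarrow> fourier G f \<pi> \<in> carrier (tensor_space (rep_dim G \<pi>) (rep_dim G \<pi>)
      (invariants G \<pi> H) (invariants G (dual_rep G \<pi>) (\<theta> ` H))) \<and>
      transpose_mat (fourier G f (\<tau> \<pi>)) = - fourier G f \<pi>" if "\<pi> \<in> irr_with G \<theta> R 0" for f \<pi>
  proof -
    have "is_rep G \<pi>" using that rep by simp
    then show ?thesis unfolding C_def zero_tensor_iff[OF \<open>is_rep G \<pi>\<close> refl H] by simp
  qed
  have C_square: "C f \<pi> \<longleftrightarrow> fourier G f \<pi> * Q \<pi> \<in> carrier (tensor_space (rep_dim G \<pi>) (rep_dim G \<pi>)
      (invariants G \<pi> H) (invariants G \<pi> H)) \<and>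
      transpose_mat (fourier G f \<pi> * Q \<pi>) = (- of_int (fs_indicator G \<theta> \<pi>)) \<cdot>\<^sub>m (fourier G f \<pi> * Q \<pi>)"
    if \<pi>: "\<pi> \<in> irr_with G \<theta> R 1 \<union> irr_with G \<theta> R (-1)" for f \<pi>
  proof -
    define n where "n = rep_dim G \<pi>"
    have \<pi>R: "\<pi> \<in> R" "fs_indicator G \<theta> \<pi> \<noteq> 0"
      and sq: "(of_int (fs_indicator G \<theta> \<pi>) :: complex) * of_int (fs_indicator G \<theta> \<pi>) = 1"
      using \<pi> by auto
    have p: "P \<pi> \<in> carrier_mat n n" "Q \<pi> \<in> carrier_mat n n" "Q \<pi> * P \<pi> = 1\<^sub>m n" "P \<pi> * Q \<pi> = 1\<^sub>m n"
      and tw: "\<And>g. g \<in> carrier G \<Longrightarrow> P \<pi> * \<pi> g = \<tau> \<pi> g * P \<pi>"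
      and pt: "transpose_mat (P \<pi>) = of_int (fs_indicator G \<theta> \<pi>) \<cdot>\<^sub>m P \<pi>"
      using PQ[OF \<pi>R] by (auto simp: n_def)
    have F: "fourier G f \<pi> \<in> carrier_mat n n" by (simp add: n_def)
    have \<tau>r: "is_rep G (\<tau> \<pi>)" "rep_dim G (\<tau> \<pi>) = n"
      using twisted_dual_rep[OF rep[OF \<pi>R(1)]] by (auto simp: n_def)
    have F\<tau>: "fourier G f (\<tau> \<pi>) \<in> carrier_mat n n" using fourier_carrier[of G f "\<tau> \<pi>"] \<tau>r by simp
    have "P \<pi> * fourier G f \<pi> = fourier G f (\<tau> \<pi>) * P \<pi>"
      by (rule fourier_intertwine[OF rep[OF \<pi>R(1)] \<tau>r(1)]) (use p tw \<tau>r in \<open>auto simp: n_def\<close>)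
    then have "P \<pi> * fourier G f \<pi> * Q \<pi> = fourier G f (\<tau> \<pi>) * (P \<pi> * Q \<pi>)"
      using assoc_mult_mat[OF F\<tau> p(1,2)] by simp
    then have tw_coeff: "P \<pi> * fourier G f \<pi> * Q \<pi> = fourier G f (\<tau> \<pi>)" using p(4) F\<tau> by simp
    have T: "fourier G f \<pi> * Q \<pi> \<in> carrier_mat n n" using F p by simp
    show ?thesis
      unfolding C_def
      using anti_invariant_coefficient_iff[OF rep[OF \<pi>R(1)] n_def[symmetric] HG p tw pt sq F]
        square_tensor_iff[OF rep[OF \<pi>R(1)] n_def[symmetric] H, of "fourier G f \<pi> * Q \<pi>"] T
      unfolding tw_coeff n_def by blast
  qed
  have C1: "C f \<pi> \<longleftrightarrow> fourier G f \<pi> * Q \<pi> \<in> carrier (ext_square (rep_dim G \<pi>) (invariants G \<pi> H))"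
    if "\<pi> \<in> irr_with G \<theta> R 1" for f \<pi>
    using C_square[of \<pi> f] that by (simp add: ext_square_simps uminus_mat_eq_smult)
  have C2: "C f \<pi> \<longleftrightarrow> fourier G f \<pi> * Q \<pi> \<in> carrier (sym_square (rep_dim G \<pi>) (invariants G \<pi> H))"
    if "\<pi> \<in> irr_with G \<theta> R (-1)" for f \<pi>
    using C_square[of \<pi> f] that by (simp add: sym_square_simps one_smult_mat)
  have W1_carrier: "carrier W1 = Pi\<^sub>E (irr_with G \<theta> R 1) (\<lambda>\<pi>. carrier (ext_square (rep_dim G \<pi>) (invariants G \<pi> H)))"
    and W2_carrier: "carrier W2 = Pi\<^sub>E (irr_with G \<theta> R (-1)) (\<lambda>\<pi>. carrier (sym_square (rep_dim G \<pi>) (invariants G \<pi> H)))"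
    using finite_R by (simp_all add: W1_def W2_def direct_sum_family_simps)
  have W_carrier: "(x, y, z) \<in> carrier W \<longleftrightarrow> x \<in> carrier W0 \<and> y \<in> carrier W1 \<and> z \<in> carrier W2" for x y z
    by (simp add: W_def direct_sum_def)
  have R_split: "(\<forall>\<pi>\<in>R. K \<pi>) \<longleftrightarrow> (\<forall>\<pi>\<in>irr_with G \<theta> R 0. K \<pi>) \<and> (\<forall>\<pi>\<in>irr_with G \<theta> R 1. K \<pi>) \<and>
      (\<forall>\<pi>\<in>irr_with G \<theta> R (-1). K \<pi>)" for K
    using indicator_cases by blast
  have \<Phi>_iff: "\<Phi> f \<in> carrier W \<longleftrightarrow> (\<forall>\<pi>\<in>R. C f \<pi>)" for f
  proof -
    have "(\<lambda>\<pi>\<in>irr_with G \<theta> R 0. fourier G f \<pi>) \<in> carrier W0 \<longleftrightarrow> (\<forall>\<pi>\<in>irr_with G \<theta> R 0. C f \<pi>)"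
    proof -
      have "(\<lambda>\<pi>\<in>irr_with G \<theta> R 0. fourier G f \<pi>) (\<tau> \<pi>) = fourier G f (\<tau> \<pi>)"
        "(\<lambda>\<pi>\<in>irr_with G \<theta> R 0. fourier G f \<pi>) \<pi> = fourier G f \<pi>"
        if "\<pi> \<in> irr_with G \<theta> R 0" for \<pi>
        using that twisted_dual_zero_indicator[OF that] by (simp_all only: restrict_apply')
      then show ?thesis
        unfolding W0_def zero_sum_sign_carrier zero_sum_carrier restrict_PiE_iff using C0 by auto
    qed
    moreover have "(\<lambda>\<pi>\<in>irr_with G \<theta> R 1. fourier G f \<pi> * Q \<pi>) \<in> carrier W1 \<longleftrightarrow> (\<forall>\<pi>\<in>irr_with G \<theta> R 1. C f \<pi>)"
      unfolding W1_carrier restrict_PiE_iff using C1 by blast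
    moreover have "(\<lambda>\<pi>\<in>irr_with G \<theta> R (-1). fourier G f \<pi> * Q \<pi>) \<in> carrier W2 \<longleftrightarrow>
        (\<forall>\<pi>\<in>irr_with G \<theta> R (-1). C f \<pi>)"
      unfolding W2_carrier restrict_PiE_iff using C2 by blast
    ultimately show ?thesis unfolding \<Phi>_def W_carrier R_split[of "C f"] by blast
  qed
  have inj: "f = f'" if f: "f \<in> carrier G \<rightarrow>\<^sub>E UNIV" "f' \<in> carrier G \<rightarrow>\<^sub>E UNIV" and eq: "\<Phi> f = \<Phi> f'" for f f'
  proof (rule fourier_injective[OF is_group finite_carrier representatives f])
    fix \<pi> assume \<pi>: "\<pi> \<in> R"
    have e0: "(\<lambda>\<pi>\<in>irr_with G \<theta> R 0. fourier G f \<pi>) = (\<lambda>\<pi>\<in>irr_with G \<theta> R 0. fourier G f' \<pi>)"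
      and e1: "(\<lambda>\<pi>\<in>irr_with G \<theta> R 1. fourier G f \<pi> * Q \<pi>) = (\<lambda>\<pi>\<in>irr_with G \<theta> R 1. fourier G f' \<pi> * Q \<pi>)"
      and e2: "(\<lambda>\<pi>\<in>irr_with G \<theta> R (-1). fourier G f \<pi> * Q \<pi>) = (\<lambda>\<pi>\<in>irr_with G \<theta> R (-1). fourier G f' \<pi> * Q \<pi>)"
      using eq by (simp_all add: \<Phi>_def)
    have cancel: "fourier G f \<pi> = fourier G f' \<pi>"
      if "fs_indicator G \<theta> \<pi> \<noteq> 0" "fourier G f \<pi> * Q \<pi> = fourier G f' \<pi> * Q \<pi>"
      by (rule mult_right_cancel_mat[where P = "Q \<pi>" and Q = "P \<pi>" and n = "rep_dim G \<pi>" and m = "rep_dim G \<pi>"])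
        (use PQ[OF \<pi> that(1)] that(2) in auto)
    show "fourier G f \<pi> = fourier G f' \<pi>"
      using \<pi>
    proof (cases rule: indicator_cases)
      case 1
      then show ?thesis using fun_cong[OF e0, of \<pi>] by simp
    next
      case 2
      then show ?thesis using fun_cong[OF e1, of \<pi>] cancel by simp
    next
      case 3
      then show ?thesis using fun_cong[OF e2, of \<pi>] cancel by simp
    qed
  qed
  have surj: "\<exists>f\<in>carrier G \<rightarrow>\<^sub>E UNIV. \<Phi> f = w" if w: "w \<in> carrier W" for w
  proof -
    obtain x y z where xyz: "w = (x, y, z)" by (metis prod.exhaust)
    have x: "x \<in> carrier (zero_indicator_sum G \<theta> H R)" and y: "y \<in> carrier W1" and z: "z \<in> carrier W2"
      using w zero_sum_sign_carrier by (auto simp: xyz W_carrier W0_def)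
    have xc: "x \<pi> \<in> carrier_mat (rep_dim G \<pi>) (rep_dim G \<pi>)" if "\<pi> \<in> irr_with G \<theta> R 0" for \<pi>
      using x that zero_summand_submodule[of \<pi> H] unfolding zero_sum_carrier submodule_mat_iff by fastforce
    have yc: "y \<pi> \<in> carrier_mat (rep_dim G \<pi>) (rep_dim G \<pi>)" if "\<pi> \<in> irr_with G \<theta> R 1" for \<pi>
      using y that tensor_space_submodule[OF invariants_subset[of G \<pi> H] invariants_subset[of G \<pi> H]]
      unfolding W1_carrier submodule_mat_iff by (fastforce simp: ext_square_simps)
    have zc: "z \<pi> \<in> carrier_mat (rep_dim G \<pi>) (rep_dim G \<pi>)" if "\<pi> \<in> irr_with G \<theta> R (-1)" for \<pi>
      using z that tensor_space_submodule[OF invariants_subset[of G \<pi> H] invariants_subset[of G \<pi> H]]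
      unfolding W2_carrier submodule_mat_iff by (fastforce simp: sym_square_simps)
    define A where "A \<pi> = (if fs_indicator G \<theta> \<pi> = 0 then x \<pi>
      else if fs_indicator G \<theta> \<pi> = 1 then y \<pi> * P \<pi> else z \<pi> * P \<pi>)" for \<pi>
    have "A \<pi> \<in> carrier_mat (rep_dim G \<pi>) (rep_dim G \<pi>)" if "\<pi> \<in> R" for \<pi>
      using that
    proof (cases rule: indicator_cases)
      case 1
      then show ?thesis using xc by (simp add: A_def)
    next
      case 2
      then show ?thesis using mult_carrier_mat[OF yc Pc] by (simp add: A_def)
    next
      case 3
      then show ?thesis using mult_carrier_mat[OF zc Pc] by (simp add: A_def)
    qed
    from fourier_surjective[OF is_group finite_carrier representatives this]
    obtain f where f: "f \<in> carrier G \<rightarrow>\<^sub>E UNIV" and Ff: "\<And>\<pi>. \<pi> \<in> R \<Longrightarrow> fourier G f \<pi> = A \<pi>" by metis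
    have "(\<lambda>\<pi>\<in>irr_with G \<theta> R 0. fourier G f \<pi>) = x"
      by (rule extensionalityI[of _ "irr_with G \<theta> R 0"])
        (use x Ff in \<open>auto simp: A_def zero_sum_carrier PiE_def\<close>)
    moreover have "(\<lambda>\<pi>\<in>irr_with G \<theta> R 1. fourier G f \<pi> * Q \<pi>) = y"
    proof (rule extensionalityI[of _ "irr_with G \<theta> R 1"])
      fix \<pi> assume \<pi>: "\<pi> \<in> irr_with G \<theta> R 1"
      have "y \<pi> * P \<pi> * Q \<pi> = y \<pi>"
        using assoc_mult_mat[OF yc[OF \<pi>] Pc Qc] PQ1[of \<pi>] \<pi> yc[OF \<pi>] by simp
      then show "(\<lambda>\<pi>\<in>irr_with G \<theta> R 1. fourier G f \<pi> * Q \<pi>) \<pi> = y \<pi>"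
        using \<pi> Ff by (simp add: A_def)
    qed (use y in \<open>auto simp: W1_carrier PiE_def\<close>)
    moreover have "(\<lambda>\<pi>\<in>irr_with G \<theta> R (-1). fourier G f \<pi> * Q \<pi>) = z"
    proof (rule extensionalityI[of _ "irr_with G \<theta> R (-1)"])
      fix \<pi> assume \<pi>: "\<pi> \<in> irr_with G \<theta> R (-1)"
      have "z \<pi> * P \<pi> * Q \<pi> = z \<pi>"
        using assoc_mult_mat[OF zc[OF \<pi>] Pc Qc] PQ1[of \<pi>] \<pi> zc[OF \<pi>] by simp
      then show "(\<lambda>\<pi>\<in>irr_with G \<theta> R (-1). fourier G f \<pi> * Q \<pi>) \<pi> = z \<pi>"
        using \<pi> Ff by (simp add: A_def)
    qed (use z in \<open>auto simp: W2_carrier PiE_def\<close>)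
    ultimately show ?thesis using f by (auto simp: \<Phi>_def xyz)
  qed
  have "bij_betw \<Phi> (carrier V) (carrier W)"
  proof (rule bij_betw_imageI)
    show "inj_on \<Phi> (carrier V)" using inj V_iff by (auto simp: inj_on_def)
    show "\<Phi> ` carrier V = carrier W"
    proof
      show "\<Phi> ` carrier V \<subseteq> carrier W" using V_iff \<Phi>_iff by auto
      show "carrier W \<subseteq> \<Phi> ` carrier V"
      proof
        fix w assume "w \<in> carrier W"
        with surj obtain f where "f \<in> carrier G \<rightarrow>\<^sub>E UNIV" "\<Phi> f = w" by blast
        with \<open>w \<in> carrier W\<close> show "w \<in> \<Phi> ` carrier V" using V_iff \<Phi>_iff by blast
      qed
    qed
  qed
  moreover have "linear_map class_ring V W \<Phi>"
  proof -
    have V_vs: "vectorspace class_ring V"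
      unfolding V_def by (rule anti_invariant_functions_vs[OF is_group theta_hom HG])
    have W1_vs: "vectorspace class_ring W1" and W2_vs: "vectorspace class_ring W2"
      unfolding W1_def W2_def
      by (rule direct_sum_family_vs[OF class_field], rule ext_square_vs sym_square_vs, rule invariants_subset)+
    have W_vs: "vectorspace class_ring W"
      unfolding W_def W0_def by (intro direct_sum_is_vs zero_sum_sign_vs W1_vs W2_vs)
    have "\<Phi> \<in> LinearCombinations.module_hom class_ring V W"
    proof -
      have add_coeff: "fourier G (\<lambda>g\<in>carrier G. f g + f' g) \<pi> = fourier G f \<pi> + fourier G f' \<pi>" for f f' \<pi>
        using fourier_cong[of G "\<lambda>g\<in>carrier G. f g + f' g" "\<lambda>g. f g + f' g"] fourier_add by auto
      have smult_coeff: "fourier G (\<lambda>g\<in>carrier G. c * f g) \<pi> = c \<cdot>\<^sub>m fourier G f \<pi>" for c f \<pi>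
        using fourier_cong[of G "\<lambda>g\<in>carrier G. c * f g" "\<lambda>g. c * f g"] fourier_smult by auto
      have "\<Phi> (f \<oplus>\<^bsub>V\<^esub> f') = \<Phi> f \<oplus>\<^bsub>W\<^esub> \<Phi> f'" for f f'
        unfolding V_def W_def W0_def W1_def W2_def \<Phi>_def anti_invariant_functions_simps add_coeff
          direct_sum_def direct_sum_family_simps ext_square_simps sym_square_simps
        using Qc by (auto simp: zero_sum_sign_simps intro!: restrict_ext add_mult_distrib_mat[OF fourier_carrier fourier_carrier Qc])
      moreover have "\<Phi> (c \<odot>\<^bsub>V\<^esub> f) = c \<odot>\<^bsub>W\<^esub> \<Phi> f" for c f
        unfolding V_def W_def W0_def W1_def W2_def \<Phi>_def anti_invariant_functions_simps smult_coeff
          direct_sum_def direct_sum_family_simps ext_square_simps sym_square_simps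
        using Qc by (auto simp: zero_sum_sign_simps intro!: restrict_ext mult_smult_assoc_mat[OF fourier_carrier Qc])
      moreover have "\<Phi> \<in> carrier V \<rightarrow> carrier W" using V_iff \<Phi>_iff by auto
      ultimately show ?thesis by (simp add: LinearCombinations.module_hom_def)
    qed
    then show ?thesis
      using V_vs W_vs vectorspace.axioms(1)[OF V_vs] vectorspace.axioms(1)[OF W_vs]
      by (intro linear_map.intro mod_hom.intro mod_hom_axioms.intro)
  qed
  ultimately show ?thesis unfolding V_def W_def W0_def W1_def W2_def by blast
qed

end

theorem proposition4:
  fixes G :: "('g, 'b) monoid_scheme" and \<theta> :: "'g \<Rightarrow> 'g" and H :: "'g set"
    and R :: "('g \<Rightarrow> complex mat) set"
  assumes "group G" and "finite (carrier G)"
    and "\<theta> \<in> hom G G" and "\<And>g. g \<in> carrier G \<Longrightarrow> \<theta> (\<theta> g) = g"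
    and "subgroup H G"
    and "irr_representatives G \<theta> R"
  shows "\<exists>\<Phi>. linear_map class_ring
      (anti_invariant_functions G \<theta> H)
      (direct_sum (zero_indicator_sum_sign G \<theta> H R)
        (direct_sum
          (direct_sum_family (irr_with G \<theta> R 1) (\<lambda>\<pi>. ext_square (rep_dim G \<pi>) (invariants G \<pi> H)))
          (direct_sum_family (irr_with G \<theta> R (-1)) (\<lambda>\<pi>. sym_square (rep_dim G \<pi>) (invariants G \<pi> H)))))
      \<Phi> \<and>
    bij_betw \<Phi>
      (carrier (anti_invariant_functions G \<theta> H))
      (carrier (direct_sum (zero_indicator_sum_sign G \<theta> H R)
        (direct_sum
          (direct_sum_family (irr_with G \<theta> R 1) (\<lambda>\<pi>. ext_square (rep_dim G \<pi>) (invariants G \<pi> H)))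
          (direct_sum_family (irr_with G \<theta> R (-1)) (\<lambda>\<pi>. sym_square (rep_dim G \<pi>) (invariants G \<pi> H))))))"
proof -
  interpret twisted_group_irr G \<theta> R
    using assms by (intro twisted_group_irr.intro twisted_group.intro twisted_group_axioms.intro
        twisted_group_irr_axioms.intro) auto
  show ?thesis by (rule decomposition[OF assms(5)])
qed

end
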